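(* Let $G$ be a polycyclic-by-finite group which is not polycyclic. Then there exists a nonzero projective right $\mathbb{Z}G$-module $P$ which has no nonzero finitely generated direct summand. In particular $P$ is not free.
   Context: A group is polycyclic if it has a subnormal series with cyclic factors, and polycyclic-by-finite if it has a subnormal series whose factors are cyclic or finite. *)

theory Defs
  imports "HOL-Algebra.Elementary_Groups" "HOL-Algebra.Coset" "HOL-Library.Function_Algebras"
begin

definition subnormal_series :: "('g, 'b) monoid_scheme \<Rightarrow> 'g set list \<Rightarrow> bool" where
  "subnormal_series G Hs \<longleftrightarrow>
     Hs \<noteq> [] \<and> hd Hs = carrier G \<and> last Hs = {\<one>\<^bsub>G\<^esub>} \<and>
     (\<forall>i < length Hs. subgroup (Hs ! i) G) \<and>
     (\<forall>i. Suc i < length Hs \<longrightarrow> Hs ! Suc i \<lhd> G\<lparr>carrier := Hs ! i\<rparr>)"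

definition series_factor :: "('g, 'b) monoid_scheme \<Rightarrow> 'g set list \<Rightarrow> nat \<Rightarrow> 'g set monoid" where
  "series_factor G Hs i = (G\<lparr>carrier := Hs ! i\<rparr>) Mod (Hs ! Suc i)"

definition polycyclic :: "('g, 'b) monoid_scheme \<Rightarrow> bool" where
  "polycyclic G \<longleftrightarrow> (\<exists>Hs. subnormal_series G Hs \<and>
     (\<forall>i. Suc i < length Hs \<longrightarrow> cyclic_group (series_factor G Hs i)))"

definition polycyclic_by_finite :: "('g, 'b) monoid_scheme \<Rightarrow> bool" where
  "polycyclic_by_finite G \<longleftrightarrow> (\<exists>Hs. subnormal_series G Hs \<and>
     (\<forall>i. Suc i < length Hs \<longrightarrow>
        cyclic_group (series_factor G Hs i) \<or> finite (carrier (series_factor G Hs i))))"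

definition group_ring :: "('g, 'b) monoid_scheme \<Rightarrow> ('g \<Rightarrow> int) set" where
  "group_ring G = {a. finite {x. a x \<noteq> 0} \<and> (\<forall>x. a x \<noteq> 0 \<longrightarrow> x \<in> carrier G)}"

definition gr_mult :: "('g, 'b) monoid_scheme \<Rightarrow> ('g \<Rightarrow> int) \<Rightarrow> ('g \<Rightarrow> int) \<Rightarrow> ('g \<Rightarrow> int)" where
  "gr_mult G a b = (\<lambda>g. if g \<in> carrier G
      then (\<Sum>h\<in>{x. a x \<noteq> 0}. a h * b (inv\<^bsub>G\<^esub> h \<otimes>\<^bsub>G\<^esub> g)) else 0)"

definition free_mod :: "('g, 'b) monoid_scheme \<Rightarrow> (nat \<Rightarrow> 'g \<Rightarrow> int) set" where
  "free_mod G = {v. finite {n. v n \<noteq> 0} \<and> (\<forall>n. v n \<in> group_ring G)}"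

definition rsmult :: "('g, 'b) monoid_scheme \<Rightarrow> (nat \<Rightarrow> 'g \<Rightarrow> int) \<Rightarrow> ('g \<Rightarrow> int) \<Rightarrow> (nat \<Rightarrow> 'g \<Rightarrow> int)" where
  "rsmult G v r = (\<lambda>n. gr_mult G (v n) r)"

definition submod :: "('g, 'b) monoid_scheme \<Rightarrow> (nat \<Rightarrow> 'g \<Rightarrow> int) set \<Rightarrow> bool" where
  "submod G S \<longleftrightarrow> S \<subseteq> free_mod G \<and> 0 \<in> S \<and>
     (\<forall>x\<in>S. \<forall>y\<in>S. x + y \<in> S) \<and> (\<forall>x\<in>S. - x \<in> S) \<and>
     (\<forall>x\<in>S. \<forall>r\<in>group_ring G. rsmult G x r \<in> S)"

definition is_dsum :: "('g, 'b) monoid_scheme \<Rightarrow> (nat \<Rightarrow> 'g \<Rightarrow> int) set \<Rightarrow>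
    (nat \<Rightarrow> 'g \<Rightarrow> int) set \<Rightarrow> (nat \<Rightarrow> 'g \<Rightarrow> int) set \<Rightarrow> bool" where
  "is_dsum G A B C \<longleftrightarrow> submod G A \<and> submod G B \<and> A \<inter> B = {0} \<and>
     C = {a + b | a b. a \<in> A \<and> b \<in> B}"

definition direct_summand :: "('g, 'b) monoid_scheme \<Rightarrow> (nat \<Rightarrow> 'g \<Rightarrow> int) set \<Rightarrow>
    (nat \<Rightarrow> 'g \<Rightarrow> int) set \<Rightarrow> bool" where
  "direct_summand G S P \<longleftrightarrow> (\<exists>T. is_dsum G S T P)"

definition projective_submod :: "('g, 'b) monoid_scheme \<Rightarrow> (nat \<Rightarrow> 'g \<Rightarrow> int) set \<Rightarrow> bool" where
  "projective_submod G P \<longleftrightarrow> direct_summand G P (free_mod G)"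

definition rspan :: "('g, 'b) monoid_scheme \<Rightarrow> (nat \<Rightarrow> 'g \<Rightarrow> int) set \<Rightarrow> (nat \<Rightarrow> 'g \<Rightarrow> int) set" where
  "rspan G X = {(\<Sum>x\<in>Y. rsmult G x (c x)) | Y c. finite Y \<and> Y \<subseteq> X \<and> (\<forall>x\<in>Y. c x \<in> group_ring G)}"

definition fin_gen :: "('g, 'b) monoid_scheme \<Rightarrow> (nat \<Rightarrow> 'g \<Rightarrow> int) set \<Rightarrow> bool" where
  "fin_gen G S \<longleftrightarrow> (\<exists>X. finite X \<and> X \<subseteq> S \<and> S = rspan G X)"

definition rlin_indep :: "('g, 'b) monoid_scheme \<Rightarrow> (nat \<Rightarrow> 'g \<Rightarrow> int) set \<Rightarrow> bool" where
  "rlin_indep G B \<longleftrightarrow> (\<forall>Y c. finite Y \<and> Y \<subseteq> B \<and> (\<forall>x\<in>Y. c x \<in> group_ring G) \<and>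
      (\<Sum>x\<in>Y. rsmult G x (c x)) = 0 \<longrightarrow> (\<forall>x\<in>Y. c x = 0))"

definition free_submod :: "('g, 'b) monoid_scheme \<Rightarrow> (nat \<Rightarrow> 'g \<Rightarrow> int) set \<Rightarrow> bool" where
  "free_submod G P \<longleftrightarrow> (\<exists>B. B \<subseteq> P \<and> rlin_indep G B \<and> P = rspan G B)"

end

(* Let G be polycyclic-by-finite but not polycyclic. Then G is not soluble, and if D = D' A with A normal
   and soluble, some term of the derived series of D is perfect; so G has a nontrivial finitely generated
   perfect subgroup H. Its augmentation ideal is an idempotent, finitely generated left ideal, with
   generators a_1, ..., a_n say. The direct limit of the free modules R -> R^n -> R^(n^2) -> ... over
   R = ZG, whose maps are direct sums of x |-> (a_1 x, ..., a_n x), is then a nonzero projective module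
   (Whitehead), and all these maps have augmentation zero. A finitely generated direct summand is therefore
   the image of an idempotent matrix over ZG of augmentation zero, and such a matrix vanishes: every g
   different from 1 is, for some prime p, not a p^m-th power for large m, and expanding E = E^(p^k) shows
   that the coefficients of the trace of E over the class of g sum to 0. So the coefficient at 1 is also 0,
   and E = 0 by Kaplansky's positivity theorem. *)

theory Submission
  imports Defs "HOL-Algebra.Multiplicative_Group" "HOL-Computational_Algebra.Primes" "HOL-Analysis.L2_Norm"
begin

section \<open>Series with cyclic or finite factors\<close>

text \<open>Solubility decides polycyclicity here because every subgroup of G is finitely generated:
  a soluble G would have its derived series refined to cyclic factors. The modules of the statement
  are submodules of one free module of countable rank, so the direct limit has to appear as a direct
  summand there. It is the quotient of the sum of all R^(n^l), whose coordinates are the nodes of an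
  n-ary tree, by the elements x - A x, with A the structure map. Idempotence of the augmentation
  ideal supplies a map undoing the second of two consecutive steps, and this splits the quotient
  map. Integral coefficients are essential for the vanishing of the matrices: a nontrivial finite
  subgroup F gives the rational idempotent 1 - (1/|F|) sum F, nonzero and of augmentation zero.
  Integrality enters through divisibility by all powers of p, while the positivity argument concerns
  real coefficients; both take place in the convolution algebra of a groupoid with finitely many
  objects, which covers the group ring and its matrix rings at once. Non-freeness comes for free,
  since a basis element generates a finitely generated summand.\<close>

inductive series_of :: "('g, 'b) monoid_scheme \<Rightarrow> ('g set monoid \<Rightarrow> bool) \<Rightarrow> 'g set \<Rightarrow> bool"
  for G \<Phi> where
  trivial: "series_of G \<Phi> {\<one>\<^bsub>G\<^esub>}"
| extend: "series_of G \<Phi> K \<Longrightarrow> subgroup L G \<Longrightarrow> K \<lhd> G\<lparr>carrier := L\<rparr> \<Longrightarrow>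
    \<Phi> (G\<lparr>carrier := L\<rparr> Mod K) \<Longrightarrow> series_of G \<Phi> L"

lemma (in group) series_of_subgroup: "series_of G \<Phi> L \<Longrightarrow> subgroup L G"
  by (induction rule: series_of.induct) (auto intro: triv_subgroup)

text \<open>The lists of the definitions descend from the group, while the inductive predicate
  ascends from the trivial subgroup; so the induction counts positions from the end of the list.
  Arguments along a series then extend a subgroup by one factor at a time.\<close>

lemma series_ofI:
  assumes "subnormal_series G Hs"
    and "\<And>i. Suc i < length Hs \<Longrightarrow> \<Phi> (series_factor G Hs i)"
  shows "series_of G \<Phi> (carrier G)"
proof -
  have "n < length Hs \<Longrightarrow> series_of G \<Phi> (Hs ! (length Hs - 1 - n))" for n
  proof (induction n)
    case 0
    then show ?case
      using assms(1) series_of.trivial[of G \<Phi>] by (simp add: subnormal_series_def last_conv_nth)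
  next
    case (Suc n)
    define i where "i = length Hs - 1 - Suc n"
    have i: "Suc i = length Hs - 1 - n" "Suc i < length Hs"
      using Suc.prems unfolding i_def by auto
    have "series_of G \<Phi> (Hs ! Suc i)"
      using Suc i by simp
    moreover have "subgroup (Hs ! i) G" "Hs ! Suc i \<lhd> G\<lparr>carrier := Hs ! i\<rparr>"
      using assms(1) i(2) unfolding subnormal_series_def by auto
    moreover have "\<Phi> (G\<lparr>carrier := Hs ! i\<rparr> Mod Hs ! Suc i)"
      using assms(2)[OF i(2)] unfolding series_factor_def .
    ultimately show ?case
      unfolding i_def[symmetric] by (rule series_of.extend)
  qed
  from this[of "length Hs - 1"] show ?thesis
    using assms(1) unfolding subnormal_series_def by (metis diff_self_eq_0 diff_less hd_conv_nth length_greater_0_conv zero_less_one)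
qed

lemma (in group) series_ofE:
  assumes "series_of G \<Phi> (carrier G)"
  obtains Hs where "subnormal_series G Hs"
    and "\<And>i. Suc i < length Hs \<Longrightarrow> \<Phi> (series_factor G Hs i)"
proof -
  have "\<exists>Hs. Hs \<noteq> [] \<and> hd Hs = L \<and> last Hs = {\<one>} \<and> (\<forall>i<length Hs. subgroup (Hs ! i) G) \<and>
      (\<forall>i. Suc i < length Hs \<longrightarrow> Hs ! Suc i \<lhd> G\<lparr>carrier := Hs ! i\<rparr> \<and> \<Phi> (series_factor G Hs i))"
    if "series_of G \<Phi> L" for L
    using that
  proof induction
    case trivial
    then show ?case by (intro exI[of _ "[{\<one>}]"]) (auto intro: triv_subgroup)
  next
    case (extend K L)
    then obtain Hs where Hs: "Hs \<noteq> []" "hd Hs = K" "last Hs = {\<one>}"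
      "\<And>i. i < length Hs \<Longrightarrow> subgroup (Hs ! i) G"
      "\<And>i. Suc i < length Hs \<Longrightarrow> Hs ! Suc i \<lhd> G\<lparr>carrier := Hs ! i\<rparr> \<and> \<Phi> (series_factor G Hs i)"
      by blast
    have K: "Hs ! 0 = K" using Hs(1,2) by (simp add: hd_conv_nth)
    have "(L # Hs) ! Suc i \<lhd> G\<lparr>carrier := (L # Hs) ! i\<rparr> \<and> \<Phi> (series_factor G (L # Hs) i)"
      if "Suc i < length (L # Hs)" for i
      using that Hs(5) extend.hyps K by (cases i) (auto simp: series_factor_def)
    moreover have "subgroup ((L # Hs) ! i) G" if "i < length (L # Hs)" for i
      using that Hs(4) extend.hyps by (cases i) auto
    ultimately show ?case
      using Hs(1,3) by (intro exI[of _ "L # Hs"]) auto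
  qed
  from this[OF assms] show ?thesis
    using that unfolding subnormal_series_def by blast
qed

lemma (in normal) coset_eq_one_iff:
  assumes "x \<in> carrier G"
  shows "H #> x = \<one>\<^bsub>G Mod H\<^esub> \<longleftrightarrow> x \<in> H"
  using assms by (metis coset_join1 coset_join2 one_FactGroup subgroup_axioms subset)

lemma (in normal) group_hom_Mod: "group_hom G (G Mod H) (\<lambda>x. H #> x)"
  using factorgroup_is_group r_coset_hom_Mod
  by (simp add: group_hom_def group_hom_axioms_def is_group)

subsection \<open>Elements that are not infinitely divisible\<close>

text \<open>For p dividing \<open>ord g\<close> let p^s be the full p-part of the group order. If g
  were a p^s-th power, it would be killed by the remaining factor e' of the order, which p does not
  divide.\<close>

lemma (in group) finite_not_prime_power_root:
  assumes "finite (carrier G)" "g \<in> carrier G" "g \<noteq> \<one>"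
  obtains p m where "prime (p::nat)" "\<And>x. x \<in> carrier G \<Longrightarrow> x [^] (p ^ m) \<noteq> g"
proof -
  from assms have "ord g \<noteq> 1" using ord_eq_1 by blast
  then obtain p where p: "prime p" "p dvd ord g" using prime_factor_nat by blast
  have e0: "order G > 0" using assms(1) order_gt_0_iff_finite by blast
  define s where "s = multiplicity p (order G)"
  obtain e' where e': "order G = p ^ s * e'" "\<not> p dvd e'"
    using multiplicity_decompose'[of "order G" p] e0 p unfolding s_def by (metis neq0_conv not_prime_unit)
  have "x [^] (p ^ s) \<noteq> g" if x: "x \<in> carrier G" for x
  proof
    assume eq: "x [^] (p ^ s) = g"
    have "g [^] e' = x [^] order G" using x e'(1) by (simp add: nat_pow_pow flip: eq)
    also have "\<dots> = \<one>" using x by (rule pow_order_eq_1)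
    finally have "ord g dvd e'" using pow_eq_id assms(2) by blast
    then show False using p e' dvd_trans by blast
  qed
  then show ?thesis using that p by blast
qed

text \<open>A uniform exponent, rather than one for each element, is what lifting through an
  extension needs. The group order itself serves as s, since an element of order p^i forces i < p^i
  \<le> \<open>order G\<close>.\<close>

lemma (in group) finite_prime_power_torsion:
  assumes "finite (carrier G)" "prime (p::nat)"
  obtains s where "\<And>x m. x \<in> carrier G \<Longrightarrow> x [^] (p ^ m) = \<one> \<Longrightarrow> x [^] (p ^ s) = \<one>"
proof -
  have e0: "order G > 0" using assms(1) order_gt_0_iff_finite by blast
  have "x [^] (p ^ order G) = \<one>" if x: "x \<in> carrier G" "x [^] (p ^ m) = \<one>" for x m
  proof -
    have "ord x dvd p ^ m" using x pow_eq_id by blast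
    then obtain i where i: "ord x = p ^ i" using assms(2) by (meson divides_primepow_nat)
    have "p ^ i \<le> order G" using ord_le_group_order[OF assms(1) x(1)] i by simp
    then have "i \<le> order G"
      using assms(2) by (meson less_exp less_imp_le order_trans power_mono prime_ge_2_nat zero_le_numeral)
    then have "ord x dvd p ^ order G" using i le_imp_power_dvd by metis
    then show ?thesis using x pow_eq_id by blast
  qed
  then show ?thesis using that by blast
qed

lemma (in group) infinite_cyclic_int_pow:
  assumes "infinite (carrier G)" "carrier G = range (\<lambda>n::int. t [^] n)" "t \<in> carrier G"
  shows "t [^] (k::int) = t [^] (l::int) \<longleftrightarrow> k = l"
proof -
  have "ord t = 0"
  proof (rule ccontr)
    assume o: "ord t \<noteq> 0"
    have "t [^] n \<in> (\<lambda>n. t [^] n) ` {0..<int (ord t)}" for n :: int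
    proof -
      have "t [^] n = t [^] (n mod int (ord t))"
        unfolding int_pow_eq[OF assms(3)] by (metis dvd_minus_mod dvd_minus_iff minus_diff_eq)
      then show ?thesis using o by auto
    qed
    then have "carrier G \<subseteq> (\<lambda>n. t [^] n) ` {0..<int (ord t)}" using assms(2) by auto
    then show False using assms(1) finite_surj by blast
  qed
  then show ?thesis using int_pow_eq[OF assms(3)] by auto
qed

lemma (in group) cyclic_not_prime_power_root:
  assumes "cyclic_group G" "g \<in> carrier G" "g \<noteq> \<one>"
  obtains p m where "prime (p::nat)" "\<And>x. x \<in> carrier G \<Longrightarrow> x [^] (p ^ m) \<noteq> g"
proof (cases "finite (carrier G)")
  case True
  then show ?thesis using finite_not_prime_power_root assms that by blast
next
  case False
  obtain t where t: "t \<in> carrier G" "carrier G = range (\<lambda>n::int. t [^] n)"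
    using assms(1) cyclic_group by blast
  then obtain k :: int where k: "g = t [^] k" using assms(2) by blast
  have "k \<noteq> 0" using k assms(3) by auto
  \<comment> \<open>For g = t^k the choice is p = 2 and m = |k|, because 2^|k| exceeds |k| and
    cannot divide the nonzero k.\<close>
  have "x [^] (2 ^ nat \<bar>k\<bar> :: nat) \<noteq> g" if x: "x \<in> carrier G" for x
  proof
    obtain l :: int where l: "x = t [^] l" using t x by blast
    assume "x [^] (2 ^ nat \<bar>k\<bar> :: nat) = g"
    then have "t [^] (l * int (2 ^ nat \<bar>k\<bar>)) = t [^] k"
      using k l t(1) by (metis int_pow_int int_pow_pow)
    then have "l * int (2 ^ nat \<bar>k\<bar>) = k" using infinite_cyclic_int_pow[OF False t(2,1)] by blast
    then have "int (2 ^ nat \<bar>k\<bar>) dvd k" by (metis dvd_triv_right)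
    then have "int (2 ^ nat \<bar>k\<bar>) \<le> \<bar>k\<bar>" using \<open>k \<noteq> 0\<close> by (metis dvd_imp_le_int abs_of_nat)
    then have "(2::nat) ^ nat \<bar>k\<bar> \<le> nat \<bar>k\<bar>" by linarith
    then show False using less_exp[of "nat \<bar>k\<bar>"] by linarith
  qed
  then show ?thesis using that[of 2 "nat \<bar>k\<bar>"] two_is_prime_nat by auto
qed

lemma (in group) cyclic_prime_power_torsion:
  assumes "cyclic_group G" "prime (p::nat)"
  obtains s where "\<And>x m. x \<in> carrier G \<Longrightarrow> x [^] (p ^ m) = \<one> \<Longrightarrow> x [^] (p ^ s) = \<one>"
proof (cases "finite (carrier G)")
  case True
  then show ?thesis using finite_prime_power_torsion assms that by blast
next
  case False
  obtain t where t: "t \<in> carrier G" "carrier G = range (\<lambda>n::int. t [^] n)"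
    using assms(1) cyclic_group by blast
  have "x [^] (p ^ 0) = \<one>" if x: "x \<in> carrier G" "x [^] (p ^ m) = \<one>" for x m
  proof -
    obtain l :: int where l: "x = t [^] l" using t x by blast
    have "t [^] (l * int (p ^ m)) = t [^] (0::int)"
      using x l t(1) by (metis int_pow_int int_pow_pow int_pow_0)
    then have "l * int (p ^ m) = 0" using infinite_cyclic_int_pow[OF False t(2,1)] by blast
    then have "l = 0" using assms(2) by (simp add: prime_nat_iff)
    then show ?thesis using l by simp
  qed
  then show ?thesis using that by blast
qed

lemma (in group) not_prime_power_root:
  assumes "cyclic_group G \<or> finite (carrier G)" "g \<in> carrier G" "g \<noteq> \<one>"
  shows "\<exists>p m. prime (p::nat) \<and> (\<forall>x\<in>carrier G. x [^] (p ^ m) \<noteq> g)"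
  using assms(1)
proof
  assume c: "cyclic_group G"
  show ?thesis by (rule cyclic_not_prime_power_root[OF c assms(2,3)]) blast
next
  assume f: "finite (carrier G)"
  show ?thesis by (rule finite_not_prime_power_root[OF f assms(2,3)]) blast
qed

lemma (in group) prime_power_torsion:
  assumes "cyclic_group G \<or> finite (carrier G)" "prime (p::nat)"
  shows "\<exists>s. \<forall>x m. x \<in> carrier G \<longrightarrow> x [^] (p ^ m) = \<one> \<longrightarrow> x [^] (p ^ s) = \<one>"
  using assms(1)
proof
  assume c: "cyclic_group G"
  show ?thesis by (rule cyclic_prime_power_torsion[OF c assms(2)]) blast
next
  assume f: "finite (carrier G)"
  show ?thesis by (rule finite_prime_power_torsion[OF f assms(2)]) blast
qed

abbreviation cyclic_or_finite :: "'a monoid \<Rightarrow> bool" where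
  "cyclic_or_finite Q \<equiv> cyclic_group Q \<or> finite (carrier Q)"

text \<open>Outside the kernel the obstruction for the image of g suffices. Inside it, a p^(s+m)-th
  root x of g has an image of p-power order, so x^(p^s) already lies in the kernel, where it would
  be a p^m-th root of g.\<close>

lemma (in group_hom) not_prime_power_root_lift:
  assumes "cyclic_group H \<or> finite (carrier H)"
    and ker: "\<And>g. g \<in> kernel G H h \<Longrightarrow> g \<noteq> \<one> \<Longrightarrow>
      \<exists>p m. prime (p::nat) \<and> (\<forall>x\<in>kernel G H h. x [^] (p ^ m) \<noteq> g)"
    and g: "g \<in> carrier G" "g \<noteq> \<one>"
  shows "\<exists>p m. prime (p::nat) \<and> (\<forall>x\<in>carrier G. x [^] (p ^ m) \<noteq> g)"
proof (cases "h g = \<one>\<^bsub>H\<^esub>")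
  case False
  obtain p m where p: "prime (p::nat)"
    and m: "\<And>x. x \<in> carrier H \<Longrightarrow> x [^]\<^bsub>H\<^esub> (p ^ m) \<noteq> h g"
    using H.not_prime_power_root[OF assms(1) hom_closed[OF g(1)] False] by blast
  have "x [^] (p ^ m) \<noteq> g" if "x \<in> carrier G" for x
    using m[OF hom_closed[OF that]] that by (metis hom_nat_pow)
  then show ?thesis using p by blast
next
  case True
  then have "g \<in> kernel G H h" using g(1) by (simp add: kernel_def)
  from ker[OF this g(2)] obtain p m where p: "prime (p::nat)"
    and m: "\<And>x. x \<in> kernel G H h \<Longrightarrow> x [^] (p ^ m) \<noteq> g" by blast
  obtain s where s: "\<And>x m. x \<in> carrier H \<Longrightarrow> x [^]\<^bsub>H\<^esub> (p ^ m) = \<one>\<^bsub>H\<^esub> \<Longrightarrow>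
      x [^]\<^bsub>H\<^esub> (p ^ s) = \<one>\<^bsub>H\<^esub>"
    using H.prime_power_torsion[OF assms(1) p] by blast
  have "x [^] (p ^ (s + m)) \<noteq> g" if x: "x \<in> carrier G" for x
  proof
    assume eq: "x [^] (p ^ (s + m)) = g"
    then have "h x [^]\<^bsub>H\<^esub> (p ^ (s + m)) = \<one>\<^bsub>H\<^esub>"
      using True x by (metis hom_nat_pow)
    from s[OF hom_closed[OF x] this] have "x [^] (p ^ s) \<in> kernel G H h"
      using x by (simp add: kernel_def hom_nat_pow)
    from m[OF this] show False using eq x by (simp add: G.nat_pow_pow power_add)
  qed
  then show ?thesis using p by blast
qed

lemma (in normal) kernel_coset: "kernel G (G Mod H) (\<lambda>x. H #> x) = H"
  unfolding kernel_def using coset_eq_one_iff mem_carrier by blast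

lemma (in group) series_not_prime_power_root:
  assumes "series_of G cyclic_or_finite L" "g \<in> L" "g \<noteq> \<one>"
  shows "\<exists>p m. prime (p::nat) \<and> (\<forall>x\<in>L. x [^] (p ^ m) \<noteq> g)"
  using assms
proof (induction arbitrary: g)
  case trivial
  then show ?case by simp
next
  case (extend K L g)
  let ?L = "G\<lparr>carrier := L\<rparr>"
  interpret K: normal K ?L using extend.hyps(3) .
  have pow: "x [^]\<^bsub>?L\<^esub> (n::nat) = x [^] n" for x n by (simp add: nat_pow_def)
  have "\<exists>p m. prime (p::nat) \<and> (\<forall>x\<in>carrier ?L. x [^]\<^bsub>?L\<^esub> (p ^ m) \<noteq> g)"
  proof (rule group_hom.not_prime_power_root_lift[OF K.group_hom_Mod extend.hyps(4)])
    fix g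
    assume "g \<in> kernel ?L (?L Mod K) (\<lambda>x. K #>\<^bsub>?L\<^esub> x)" "g \<noteq> \<one>\<^bsub>?L\<^esub>"
    then have "g \<in> K" "g \<noteq> \<one>" unfolding K.kernel_coset by simp_all
    from extend.IH[OF this]
    show "\<exists>p m. prime (p::nat) \<and>
        (\<forall>x\<in>kernel ?L (?L Mod K) (\<lambda>x. K #>\<^bsub>?L\<^esub> x). x [^]\<^bsub>?L\<^esub> (p ^ m) \<noteq> g)"
      unfolding K.kernel_coset pow .
  qed (use extend.prems in simp_all)
  then show ?case unfolding pow by simp
qed

subsection \<open>Finite generation of subgroups\<close>

lemma (in group) cyclic_or_finite_subgroup_fg:
  assumes "cyclic_group G \<or> finite (carrier G)" "subgroup H G"
  shows "\<exists>X. finite X \<and> X \<subseteq> H \<and> H \<subseteq> generate G X"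
  using assms(1)
proof
  assume "finite (carrier G)"
  then have "finite H" using assms(2) by (meson finite_subset subgroup.subset)
  then show ?thesis by (intro exI[of _ H]) (auto intro: generate.incl)
next
  interpret H: subgroup H G using assms(2) .
  assume "cyclic_group G"
  then obtain t where t: "t \<in> carrier G" "carrier G = range (\<lambda>n::int. t [^] n)"
    using cyclic_group by blast
  show ?thesis
  proof (cases "\<exists>n::nat. n > 0 \<and> t [^] n \<in> H")
    case False
    have "h = \<one>" if h: "h \<in> H" for h
    proof -
      obtain k :: int where k: "h = t [^] k" using h t(2) H.subset by blast
      consider "k = 0" | "k > 0" | "k < 0" by linarith
      then show ?thesis
      proof cases
        case 2
        then have "t [^] nat k \<in> H" using h int_pow_int[of G t "nat k"] by (simp flip: k)
        moreover have "nat k > 0" using 2 by simp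
        ultimately show ?thesis using False by blast
      next
        case 3
        then have "t [^] nat (- k) = inv h"
          using int_pow_int[of G t "nat (- k)"] int_pow_neg[OF t(1), of k] by (simp flip: k)
        then have "t [^] nat (- k) \<in> H" using h by simp
        moreover have "nat (- k) > 0" using 3 by simp
        ultimately show ?thesis using False by blast
      qed (use k in simp)
    qed
    then show ?thesis by (intro exI[of _ "{}"]) (auto simp: generate_empty)
  next
    case True
    \<comment> \<open>Division with remainder by the least positive exponent occurring in H shows
      that t^d generates H.\<close>
    define d where "d = (LEAST n::nat. n > 0 \<and> t [^] n \<in> H)"
    have d: "d > 0" "t [^] d \<in> H" using LeastI_ex[OF True] unfolding d_def by auto
    have least: "n \<ge> d" if "n > 0" "t [^] n \<in> H" for n :: nat
      unfolding d_def using that by (simp add: Least_le)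
    have "h \<in> generate G {t [^] d}" if h: "h \<in> H" for h
    proof -
      obtain k :: int where k: "h = t [^] k" using h t(2) H.subset by blast
      define q r where "q = k div int d" and "r = nat (k mod int d)"
      have r: "int r = k mod int d" "r < d"
        using d(1) by (auto simp: r_def nat_less_iff)
      have "k = int d * q + int r" unfolding r(1) q_def by simp
      then have h_eq: "h = (t [^] d) [^] q \<otimes> t [^] r"
        using k t(1) by (simp add: int_pow_mult int_pow_pow flip: int_pow_int)
      have q: "(t [^] d) [^] q \<in> H" using d(2) subgroup_int_pow_closed[OF assms(2)] by blast
      have "t [^] r = inv ((t [^] d) [^] q) \<otimes> h"
        unfolding h_eq using t(1) by (simp add: inv_solve_left)
      then have "t [^] r \<in> H" using q h by simp
      then have "r = 0" using least[of r] r(2) by auto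
      then have "h = (t [^] d) [^] q" using h_eq t(1) by simp
      then show ?thesis using generate_pow[of "t [^] d"] t(1) by auto
    qed
    then show ?thesis using d(2) by (intro exI[of _ "{t [^] d}"]) auto
  qed
qed

text \<open>Generators of the part of S in the kernel and preimages in S of generators of its image
  suffice: a product of the latter moves any element of S into the kernel.\<close>

lemma (in group_hom) subgroup_fg_lift:
  assumes "cyclic_group H \<or> finite (carrier H)" "subgroup S G"
    and ker: "\<exists>X. finite X \<and> X \<subseteq> S \<inter> kernel G H h \<and> S \<inter> kernel G H h \<subseteq> generate G X"
  shows "\<exists>X. finite X \<and> X \<subseteq> S \<and> S \<subseteq> generate G X"
proof -
  interpret S: subgroup S G using assms(2) .
  have "subgroup (h ` S) H" using assms(2) by (rule subgroup_img_is_subgroup)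
  from H.cyclic_or_finite_subgroup_fg[OF assms(1) this]
  obtain Z where Z: "finite Z" "Z \<subseteq> h ` S" "h ` S \<subseteq> generate H Z" by blast
  obtain Y where Y: "Y \<subseteq> S" "finite Y" "Z = h ` Y" using finite_subset_image[OF Z(1,2)] by blast
  obtain X where X: "finite X" "X \<subseteq> S \<inter> kernel G H h" "S \<inter> kernel G H h \<subseteq> generate G X"
    using ker by blast
  have "s \<in> generate G (X \<union> Y)" if s: "s \<in> S" for s
  proof -
    have "h s \<in> h ` generate G Y"
      using s Z(3) Y generate_img[of Y] S.subset by auto
    then obtain u where u: "u \<in> generate G Y" "h u = h s" by auto
    have uS: "u \<in> S" using u(1) Y(1) G.generate_subgroup_incl[OF _ assms(2)] by blast
    have "inv u \<otimes> s \<in> S \<inter> kernel G H h"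
      using uS s u(2) S.subset by (auto simp: kernel_def)
    then have "inv u \<otimes> s \<in> generate G (X \<union> Y)"
      using X(3) G.mono_generate[of X "X \<union> Y"] by blast
    moreover have "u \<in> generate G (X \<union> Y)" using u(1) G.mono_generate[of Y "X \<union> Y"] by blast
    ultimately have "u \<otimes> (inv u \<otimes> s) \<in> generate G (X \<union> Y)" by (rule generate.eng[rotated])
    then show ?thesis using uS s S.subset by (simp add: G.m_assoc[symmetric] subset_iff)
  qed
  then show ?thesis using X Y by (intro exI[of _ "X \<union> Y"]) auto
qed

text \<open>This serves two purposes: the perfect subgroup becomes finitely generated, hence its
  augmentation ideal too, and the derived series of a soluble group of this kind can be refined to
  cyclic factors.\<close>

lemma (in group) series_subgroup_fg:
  assumes "series_of G cyclic_or_finite L" "subgroup S G" "S \<subseteq> L"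
  shows "\<exists>X. finite X \<and> X \<subseteq> S \<and> S \<subseteq> generate G X"
  using assms
proof (induction arbitrary: S)
  case trivial
  then show ?case by (intro exI[of _ "{}"]) (auto simp: generate_empty)
next
  case (extend K L S)
  let ?L = "G\<lparr>carrier := L\<rparr>"
  interpret K: normal K ?L using extend.hyps(3) .
  have gen: "generate ?L X = generate G X" if "X \<subseteq> S" for X
    using that extend.prems extend.hyps(2) by (simp add: generate_consistent)
  have "subgroup K G" using extend.hyps(1) by (rule series_of_subgroup)
  then have "subgroup (S \<inter> K) G" using extend.prems(1) by (rule subgroups_Inter_pair[rotated])
  from extend.IH[OF this] obtain X where "finite X" "X \<subseteq> S \<inter> K" "S \<inter> K \<subseteq> generate G X"
    by blast
  then have ker: "\<exists>X. finite X \<and> X \<subseteq> S \<inter> kernel ?L (?L Mod K) (\<lambda>x. K #>\<^bsub>?L\<^esub> x) \<and>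
      S \<inter> kernel ?L (?L Mod K) (\<lambda>x. K #>\<^bsub>?L\<^esub> x) \<subseteq> generate ?L X"
    unfolding K.kernel_coset using gen[of X] by (intro exI[of _ X]) auto
  have S: "subgroup S ?L" using extend.prems extend.hyps(2) by (simp add: subgroup_incl)
  show ?case
    using group_hom.subgroup_fg_lift[OF K.group_hom_Mod extend.hyps(4) S ker] gen by blast
qed

subsection \<open>Perfect subgroups and solubility\<close>

lemma (in group) commute_generate:
  assumes "S \<subseteq> carrier G" "y \<in> carrier G" "\<And>s. s \<in> S \<Longrightarrow> s \<otimes> y = y \<otimes> s" "b \<in> generate G S"
  shows "b \<otimes> y = y \<otimes> b"
  using assms(4)
proof induction
  case (inv s)
  then have "s \<in> carrier G" using assms(1) by blast
  then show ?case using assms(2) assms(3)[OF inv]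
    by (metis inv_closed inv_solve_left inv_solve_right m_assoc m_closed)
next
  case (eng a b)
  then have "a \<in> carrier G" "b \<in> carrier G" using assms(1) generate_in_carrier by blast+
  then show ?case using assms(2) eng by (metis m_assoc)
qed (use assms in auto)

text \<open>The commutators of an element of \<open>A\<close> lie in \<open>A \<inter> G'\<close>, which is central. So commuting with
  a fixed element of \<open>A\<close> is a homomorphism into an abelian group, and its kernel contains \<open>G'\<close>.\<close>

lemma (in group) comm_group_if_generated:
  assumes A: "A \<lhd> G" "\<And>a b. a \<in> A \<Longrightarrow> b \<in> A \<Longrightarrow> a \<otimes> b = b \<otimes> a"
    and C: "\<And>a b. a \<in> derived G (carrier G) \<Longrightarrow> b \<in> derived G (carrier G) \<Longrightarrow> a \<otimes> b = b \<otimes> a"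
    and gen: "carrier G \<subseteq> generate G (derived G (carrier G) \<union> A)"
  shows "comm_group G"
proof -
  let ?C = "derived G (carrier G)"
  interpret A: normal A G using A(1) .
  interpret C: subgroup ?C G by (rule derived_is_subgroup) simp
  have comm_mem: "x \<otimes> y \<otimes> inv x \<otimes> inv y \<in> ?C" if "x \<in> carrier G" "y \<in> carrier G" for x y
    unfolding derived_def using that by (intro generate.incl) blast
  have central: "z \<otimes> x = x \<otimes> z" if z: "z \<in> carrier G" "x \<in> carrier G"
    "\<And>c. c \<in> ?C \<Longrightarrow> c \<otimes> z = z \<otimes> c" "\<And>a. a \<in> A \<Longrightarrow> a \<otimes> z = z \<otimes> a" for z x
  proof -
    have "x \<in> generate G (?C \<union> A)" using z(2) gen by blast
    moreover have "s \<otimes> z = z \<otimes> s" if "s \<in> ?C \<union> A" for s using that z by blast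
    ultimately show ?thesis
      using commute_generate[of "?C \<union> A" z x] z(1) A.subset C.subset by simp
  qed
  have A_C: "a \<otimes> c = c \<otimes> a" if a: "a \<in> A" and c: "c \<in> ?C" for a c
  proof -
    have aG: "a \<in> carrier G" using a by simp
    define \<zeta> where "\<zeta> x = a \<otimes> x \<otimes> inv a \<otimes> inv x" for x
    have \<zeta>_closed: "\<zeta> x \<in> carrier G" if "x \<in> carrier G" for x using that aG by (simp add: \<zeta>_def)
    have \<zeta>_central: "\<zeta> x \<otimes> y = y \<otimes> \<zeta> x" if x: "x \<in> carrier G" and y: "y \<in> carrier G" for x y
    proof -
      have "\<zeta> x = a \<otimes> (x \<otimes> inv a \<otimes> inv x)" using x aG by (simp add: \<zeta>_def m_assoc)
      then have "\<zeta> x \<in> A" using a x A.inv_op_closed2 by simp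
      moreover have "\<zeta> x \<in> ?C" using comm_mem[OF aG x] by (simp add: \<zeta>_def)
      ultimately show ?thesis using central[OF \<zeta>_closed[OF x] y] A(2) C by metis
    qed
    have conj: "a \<otimes> x \<otimes> inv a = \<zeta> x \<otimes> x" if "x \<in> carrier G" for x
      using that aG by (simp add: \<zeta>_def m_assoc)
    have comm_s: "s \<otimes> a = a \<otimes> s" if s: "s \<in> derived_set G (carrier G)" for s
    proof -
      obtain x y where xy: "x \<in> carrier G" "y \<in> carrier G" "s = x \<otimes> y \<otimes> inv x \<otimes> inv y"
        using s by blast
      \<comment> \<open>Conjugation by a changes x and y only by the central factors
        \<open>\<zeta> x\<close> and \<open>\<zeta> y\<close>, which cancel in the commutator
        s.\<close>
      have "a \<otimes> s \<otimes> inv a = (a \<otimes> x \<otimes> inv a) \<otimes> (a \<otimes> y \<otimes> inv a) \<otimes> inv (a \<otimes> x \<otimes> inv a) \<otimes> inv (a \<otimes> y \<otimes> inv a)"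
      proof -
        have "inv a \<otimes> (a \<otimes> z) = z" if "z \<in> carrier G" for z
          using that aG by (simp flip: m_assoc)
        then show ?thesis
          unfolding xy(3) using xy(1,2) aG by (simp add: m_assoc inv_mult_group)
      qed
      also have "\<dots> = \<zeta> x \<otimes> x \<otimes> (\<zeta> y \<otimes> y) \<otimes> inv (\<zeta> x \<otimes> x) \<otimes> inv (\<zeta> y \<otimes> y)"
        using conj xy by simp
      also have "\<dots> = \<zeta> x \<otimes> (x \<otimes> \<zeta> y) \<otimes> y \<otimes> inv x \<otimes> inv (\<zeta> x) \<otimes> inv y \<otimes> inv (\<zeta> y)"
        using xy \<zeta>_closed by (simp add: m_assoc inv_mult_group)
      also have "\<dots> = \<zeta> x \<otimes> (\<zeta> y \<otimes> (x \<otimes> y \<otimes> inv x)) \<otimes> inv (\<zeta> x) \<otimes> inv y \<otimes> inv (\<zeta> y)"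
        unfolding \<zeta>_central[OF xy(2,1), symmetric] using xy \<zeta>_closed by (simp add: m_assoc)
      also have "\<dots> = (\<zeta> y \<otimes> (x \<otimes> y \<otimes> inv x)) \<otimes> \<zeta> x \<otimes> inv (\<zeta> x) \<otimes> inv y \<otimes> inv (\<zeta> y)"
        using xy \<zeta>_closed \<zeta>_central[of x "\<zeta> y \<otimes> (x \<otimes> y \<otimes> inv x)"] by simp
      also have "\<dots> = \<zeta> y \<otimes> s \<otimes> inv (\<zeta> y)"
        using xy \<zeta>_closed by (simp add: m_assoc)
      also have "\<dots> = s"
        using xy \<zeta>_closed \<zeta>_central[of y s] by (simp add: m_assoc)
      finally have "a \<otimes> s \<otimes> inv a = s" .
      then show ?thesis using xy aG by (metis inv_closed inv_solve_right' m_closed)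
    qed
    show ?thesis
      using commute_generate[OF derived_set_in_carrier[OF subset_refl] aG comm_s c[unfolded derived_def]]
      by (rule sym)
  qed
  have "x \<otimes> y = y \<otimes> x" if x: "x \<in> carrier G" and y: "y \<in> carrier G" for x y
  proof -
    have "s \<otimes> y = y \<otimes> s" if s: "s \<in> ?C \<union> A" for s
      using s
    proof
      assume s: "s \<in> ?C"
      show ?thesis
        by (rule central[OF C.mem_carrier[OF s] y C[OF _ s] A_C[OF _ s]])
    next
      assume s: "s \<in> A"
      show ?thesis
        by (rule central[OF A.mem_carrier[OF s] y A_C[OF s, symmetric] A(2)[OF _ s]])
    qed
    moreover have "x \<in> generate G (?C \<union> A)" using x gen by blast
    ultimately show ?thesis using commute_generate[of "?C \<union> A" y x] y A.subset C.subset by simp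
  qed
  then show ?thesis by (intro group_comm_groupI) auto
qed

text \<open>Modulo the normal subgroup generated by G'' and A', the images of G' and A are both
  abelian, so the quotient is abelian by \<open>comm_group_if_generated\<close> and G' lies in that
  subgroup. Thus G = G' A is inherited as G' = G'' A', which can be iterated.\<close>

lemma (in group) derived_subset_generate:
  assumes A: "A \<lhd> G" and gen: "carrier G \<subseteq> generate G (derived G (carrier G) \<union> A)"
  shows "derived G (carrier G) \<subseteq> generate G (derived G (derived G (carrier G)) \<union> derived G A)"
proof -
  let ?D = "derived G (carrier G)"
  let ?X = "generate G (derived G ?D \<union> derived G A)"
  interpret A: normal A G using A .
  have D_normal: "?D \<lhd> G" by (rule derived_self_is_normal)
  then interpret D: normal ?D G .
  interpret D2: normal "derived G ?D" G using D_normal by (rule derived_is_normal)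
  interpret A2: normal "derived G A" G using A by (rule derived_is_normal)
  have "?X \<lhd> G"
  proof (rule normal_generateI)
    show "derived G ?D \<union> derived G A \<subseteq> carrier G" using D2.subset A2.subset by blast
    show "g \<otimes> h \<otimes> inv g \<in> derived G ?D \<union> derived G A"
      if "h \<in> derived G ?D \<union> derived G A" "g \<in> carrier G" for h g
      using that D2.inv_op_closed2 A2.inv_op_closed2 by blast
  qed
  then interpret X: normal ?X G .
  let ?B = "G Mod ?X" and ?q = "\<lambda>x. ?X #> x"
  interpret q: group_hom G ?B ?q by (rule X.group_hom_Mod)
  have surj: "carrier ?B = ?q ` carrier G" by (rule carrier_FactGroup)
  have commute: "?q a \<otimes>\<^bsub>?B\<^esub> ?q b = ?q b \<otimes>\<^bsub>?B\<^esub> ?q a"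
    if ab: "a \<in> K" "b \<in> K" and K: "K \<subseteq> carrier G" "derived G K \<subseteq> ?X" for a b K
  proof -
    have G: "a \<in> carrier G" "b \<in> carrier G" using ab K by auto
    have "a \<otimes> b \<otimes> inv a \<otimes> inv b \<in> derived G K"
      unfolding derived_def using ab by (intro generate.incl) blast
    then have "a \<otimes> b \<otimes> inv a \<otimes> inv b \<in> ?X" using K by blast
    then have "a \<otimes> b \<otimes> inv (b \<otimes> a) \<in> ?X" using G by (simp add: inv_mult_group m_assoc)
    then have "?q (a \<otimes> b) = ?q (b \<otimes> a)"
      using G X.rcos_module_rev[OF is_group, of "b \<otimes> a" "a \<otimes> b"] repr_independence[OF _ _ X.subgroup_axioms]
      by (metis m_closed)
    then show ?thesis using G q.hom_mult by metis
  qed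
  have X: "derived G ?D \<subseteq> ?X" "derived G A \<subseteq> ?X"
    by (auto intro: generate.incl)
  have D_img: "derived ?B (carrier ?B) = ?q ` ?D"
    unfolding surj by (rule q.derived_img) simp
  have "comm_group ?B"
  proof (rule q.H.comm_group_if_generated)
    show "?q ` A \<lhd> ?B"
    proof (rule q.H.normal_invI)
      show "subgroup (?q ` A) ?B" using A.subgroup_axioms by (rule q.subgroup_img_is_subgroup)
      fix x y assume "x \<in> carrier ?B" "y \<in> ?q ` A"
      then obtain g a where g: "g \<in> carrier G" "x = ?q g" and a: "a \<in> A" "y = ?q a"
        unfolding surj by blast
      have eq: "x \<otimes>\<^bsub>?B\<^esub> y \<otimes>\<^bsub>?B\<^esub> inv\<^bsub>?B\<^esub> x = ?q (g \<otimes> a \<otimes> inv g)"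
        unfolding g(2) a(2) using g(1) a(1) A.mem_carrier
        by (simp only: q.hom_mult q.hom_inv m_closed inv_closed)
      show "x \<otimes>\<^bsub>?B\<^esub> y \<otimes>\<^bsub>?B\<^esub> inv\<^bsub>?B\<^esub> x \<in> ?q ` A"
        unfolding eq using A.inv_op_closed2[OF g(1) a(1)] by (rule imageI)
    qed
    show "x \<otimes>\<^bsub>?B\<^esub> y = y \<otimes>\<^bsub>?B\<^esub> x" if "x \<in> ?q ` A" "y \<in> ?q ` A" for x y
      using that commute[OF _ _ A.subset] X by (elim imageE) simp
    show "x \<otimes>\<^bsub>?B\<^esub> y = y \<otimes>\<^bsub>?B\<^esub> x"
      if "x \<in> derived ?B (carrier ?B)" "y \<in> derived ?B (carrier ?B)" for x y
      using that commute[OF _ _ D.subset] X unfolding D_img by (elim imageE) simp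
    have "carrier ?B \<subseteq> ?q ` generate G (?D \<union> A)" unfolding surj using gen by blast
    also have "\<dots> = generate ?B (?q ` (?D \<union> A))"
      using q.generate_img[of "?D \<union> A"] D.subset A.subset by simp
    finally show "carrier ?B \<subseteq> generate ?B (derived ?B (carrier ?B) \<union> ?q ` A)"
      unfolding D_img image_Un .
  qed
  then show ?thesis using derived_minimal X.normal_axioms by blast
qed

lemma (in group) derived_subset_generate_subgroup:
  assumes D: "subgroup D G" and A: "A \<lhd> G\<lparr>carrier := D\<rparr>" and gen: "D \<subseteq> generate G (derived G D \<union> A)"
  shows "derived G A \<lhd> G\<lparr>carrier := derived G D\<rparr>"
    and "derived G D \<subseteq> generate G (derived G (derived G D) \<union> derived G A)"
proof -
  let ?D = "G\<lparr>carrier := D\<rparr>"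
  interpret D: group ?D using D by (rule subgroup_imp_group)
  interpret A: normal A ?D using A .
  have AD: "A \<subseteq> D" using A.subset by simp
  have D': "derived G D \<subseteq> D" using derived_incl[OF subset_refl D] .
  have DG: "D \<subseteq> carrier G" using D by (rule subgroup.subset)
  have A': "derived G A \<subseteq> derived G D" using AD by (rule mono_derived)
  have cons: "derived ?D K = derived G K" "generate ?D K = generate G K" if "K \<subseteq> D" for K
    using that D by (auto simp: derived_consistent generate_consistent)
  have "derived ?D A \<lhd> ?D" using A by (rule D.derived_is_normal)
  then have "derived G A \<lhd> ?D" using cons(1)[OF AD] by simp
  moreover have "subgroup (derived G D) ?D"
    using derived_is_subgroup[OF DG] D D' by (simp add: subgroup_incl)
  ultimately show "derived G A \<lhd> G\<lparr>carrier := derived G D\<rparr>"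
    using D.normal_restrict_supergroup[of "derived G D" "derived G A"] A' by simp
  have "derived ?D D \<subseteq> generate ?D (derived ?D (derived ?D D) \<union> derived ?D A)"
    using D.derived_subset_generate[OF A] gen cons D' AD by simp
  moreover have "derived G (derived G D) \<union> derived G A \<subseteq> D"
    using D' A' mono_derived[OF D'] by blast
  ultimately show "derived G D \<subseteq> generate G (derived G (derived G D) \<union> derived G A)"
    using cons D' AD by simp
qed

text \<open>The factorisation passes down the derived series: each term of the series of D is
  generated by the next term and the corresponding term for A. Once the latter is trivial, the term
  of D equals its own derived subgroup.\<close>

lemma (in group) derived_power_perfect:
  assumes D: "subgroup D G" and A: "A \<lhd> G\<lparr>carrier := D\<rparr>" and gen: "D \<subseteq> generate G (derived G D \<union> A)"
    and n: "(derived G ^^ n) A \<subseteq> {\<one>}"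
  shows "derived G ((derived G ^^ n) D) = (derived G ^^ n) D"
proof -
  have "subgroup ((derived G ^^ i) D) G \<and>
      (derived G ^^ i) A \<lhd> G\<lparr>carrier := (derived G ^^ i) D\<rparr> \<and>
      (derived G ^^ i) D \<subseteq> generate G (derived G ((derived G ^^ i) D) \<union> (derived G ^^ i) A)" for i
    by (induction i) (use assms derived_subset_generate_subgroup derived_is_subgroup[OF subgroup.subset] in auto)
  note * = this[of n]
  let ?E = "(derived G ^^ n) D"
  have E': "subgroup (derived G ?E) G" using * derived_is_subgroup[OF subgroup.subset] by blast
  have "derived G ?E \<union> (derived G ^^ n) A \<subseteq> derived G ?E"
    using n subgroup.one_closed[OF E'] by blast
  then have "generate G (derived G ?E \<union> (derived G ^^ n) A) \<subseteq> derived G ?E"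
    using E' by (rule generate_subgroup_incl)
  then have "?E \<subseteq> derived G ?E" using * by blast
  then show ?thesis using derived_incl[OF subset_refl, of ?E] * by blast
qed

lemma funpow_decreasing_image_stable:
  assumes "\<And>X. F X \<subseteq> X" "finite (f ` (X :: 'a set))"
  shows "\<exists>n. f ` ((F ^^ n) X) \<subseteq> f ` ((F ^^ Suc n) X)"
proof (rule ccontr)
  assume contra: "\<not> ?thesis"
  have mono: "f ` ((F ^^ Suc n) X) \<subseteq> f ` ((F ^^ n) X)" for n using assms(1) by auto
  have "finite (f ` ((F ^^ n) X)) \<and> card (f ` ((F ^^ n) X)) + n \<le> card (f ` X)" for n
  proof (induction n)
    case (Suc n)
    have "\<not> f ` ((F ^^ n) X) \<subseteq> f ` ((F ^^ Suc n) X)" using contra by (rule contrapos_nn) (rule exI)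
    then have "f ` ((F ^^ Suc n) X) \<subset> f ` ((F ^^ n) X)" using mono[of n] by (simp add: less_le_not_le)
    moreover have fin: "finite (f ` ((F ^^ n) X))" using Suc by (rule conjunct1)
    ultimately have "card (f ` ((F ^^ Suc n) X)) < card (f ` ((F ^^ n) X))"
      by (intro psubset_card_mono)
    moreover have "finite (f ` ((F ^^ Suc n) X))" using mono[of n] fin by (rule finite_subset)
    ultimately show ?case using Suc by linarith
  qed (use assms(2) in simp)
  from this[of "Suc (card (f ` X))"] show False by simp
qed

text \<open>A cyclic factor costs one derived step. For a finite factor L/K the images of the
  derived series of L in L/K become stationary, at a term D say; then D = D' (D \<inter> K) with D
  \<inter> K soluble by induction, and so a later term of the series is perfect, hence
  trivial.\<close>

lemma (in group) series_soluble_if_no_perfect: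
  assumes "series_of G cyclic_or_finite L"
    and perfect: "\<And>H. subgroup H G \<Longrightarrow> derived G H = H \<Longrightarrow> H = {\<one>}"
  shows "\<exists>n. (derived G ^^ n) L \<subseteq> {\<one>}"
  using assms(1)
proof induction
  case trivial
  then show ?case by (intro exI[of _ 0]) simp
next
  case (extend K L)
  then obtain k where k: "(derived G ^^ k) K \<subseteq> {\<one>}" by blast
  let ?L = "G\<lparr>carrier := L\<rparr>"
  interpret L: group ?L using extend.hyps(2) by (rule subgroup_imp_group)
  interpret K: normal K ?L using extend.hyps(3) .
  from extend.hyps(4) show ?case
  proof
    assume "cyclic_group (?L Mod K)"
    then have "comm_group (?L Mod K)"
      using group.cyclic_imp_abelian_group K.factorgroup_is_group by blast
    then have "derived ?L L \<subseteq> K" using L.derived_minimal[OF extend.hyps(3)] by simp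
    then have "derived G L \<subseteq> K" using derived_consistent[OF subset_refl extend.hyps(2)] by simp
    then have "(derived G ^^ k) (derived G L) \<subseteq> {\<one>}"
      using mono_exp_of_derived[of "derived G L" K k] k by (metis order_trans)
    then show ?thesis by (intro exI[of _ "Suc k"]) (simp only: funpow_Suc_right o_apply)
  next
    let ?q = "\<lambda>x. K #>\<^bsub>?L\<^esub> x"
    assume "finite (carrier (?L Mod K))"
    then have fin: "finite (?q ` L)" using carrier_FactGroup[of ?L K] by simp
    \<comment> \<open>\<open>derived G X\<close> lies in X only for subgroups X, whereas the
      stabilisation lemma wants a map that is decreasing on all sets. On the derived series the two
      maps agree.\<close>
    define F where "F X = (if subgroup X G then derived G X else X)" for X
    have F_sub: "F X \<subseteq> X" for X unfolding F_def using derived_incl[OF subset_refl] by auto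
    have F_pow: "(F ^^ n) L = (derived G ^^ n) L" for n
      using exp_of_derived_is_subgroup[OF extend.hyps(2)] by (induction n) (auto simp: F_def)
    obtain n where "?q ` ((F ^^ n) L) \<subseteq> ?q ` ((F ^^ Suc n) L)"
      using funpow_decreasing_image_stable[of F ?q L, OF F_sub fin] by blast
    define D where "D = (derived G ^^ n) L"
    have D_sub: "subgroup D G" unfolding D_def by (rule exp_of_derived_is_subgroup[OF extend.hyps(2)])
    have DL: "D \<subseteq> L"
      unfolding D_def F_pow[symmetric] by (induction n) (use F_sub in auto)
    have D': "derived G D \<subseteq> D" by (rule derived_incl[OF subset_refl D_sub])
    have q: "?q ` D \<subseteq> ?q ` derived G D"
      using \<open>?q ` ((F ^^ n) L) \<subseteq> ?q ` ((F ^^ Suc n) L)\<close> unfolding F_pow by (simp add: D_def)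
    define A where "A = D \<inter> K"
    have "D \<subseteq> generate G (derived G D \<union> A)"
    proof
      fix d assume d: "d \<in> D"
      then obtain d' where d': "d' \<in> derived G D" "?q d = ?q d'" using q by blast
      have in_L: "d \<in> carrier ?L" "d' \<in> carrier ?L" using d d' D' DL by auto
      have "d \<in> ?q d'" using L.rcos_self[OF in_L(1) K.subgroup_axioms] d'(2) by simp
      then obtain c where c: "c \<in> K" "d = c \<otimes> d'" by (auto simp: r_coset_def)
      have "c \<in> carrier G" "d' \<in> carrier G" "d \<in> carrier G"
        using c(1) K.mem_carrier[of c] in_L extend.hyps(2) subgroup.mem_carrier[OF extend.hyps(2)] by auto
      then have "c = d \<otimes> inv d'" using c(2) by (simp add: m_assoc)
      then have "c \<in> D"
        using d d'(1) D' subgroup.m_closed[OF D_sub] subgroup.m_inv_closed[OF D_sub] by auto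
      then have "c \<in> A" using c(1) by (simp add: A_def)
      then show "d \<in> generate G (derived G D \<union> A)"
        unfolding c(2) using d'(1) by (intro generate.eng) (auto intro: generate.incl)
    qed
    moreover have "A \<lhd> G\<lparr>carrier := D\<rparr>"
      using L.normal_Int_subgroup[of D K] extend.hyps(2,3) D_sub DL
      by (simp add: A_def subgroup_incl Int_commute)
    moreover have "(derived G ^^ k) A \<subseteq> {\<one>}"
      using mono_exp_of_derived[of A K k] k by (auto simp: A_def)
    ultimately have "derived G ((derived G ^^ k) D) = (derived G ^^ k) D"
      using derived_power_perfect D_sub by blast
    then have "(derived G ^^ k) D = {\<one>}"
      using perfect exp_of_derived_is_subgroup[OF D_sub] by blast
    then show ?thesis by (intro exI[of _ "k + n"]) (simp add: D_def funpow_add)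
  qed
qed

text \<open>Since L' lies in K, every subgroup between K and L is normal in L. Adjoining the
  generators one at a time therefore gives normal inclusions with cyclic factors.\<close>

lemma (in group) series_of_cyclic_generate:
  assumes K: "series_of G cyclic_group K" and L: "subgroup L G" "K \<subseteq> L" "derived G L \<subseteq> K"
    and X: "finite X" "X \<subseteq> L"
  shows "series_of G cyclic_group (generate G (K \<union> X))"
  using X
proof (induction rule: finite_induct)
  case empty
  then show ?case
    using K generate_subgroup_incl[OF subset_refl series_of_subgroup[OF K]] generate.incl[of _ K G]
    by (metis Un_empty_right subsetI subset_antisym)
next
  case (insert x X)
  let ?M = "generate G (K \<union> X)" and ?N = "generate G (K \<union> insert x X)"
  let ?G = "G\<lparr>carrier := ?N\<rparr>"
  have LG: "L \<subseteq> carrier G" using L(1) by (rule subgroup.subset)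
  have N_L: "?N \<subseteq> L" using insert.prems L by (intro generate_subgroup_incl) auto
  have M_N: "?M \<subseteq> ?N" by (intro mono_generate) auto
  have gen_sub: "K \<union> X \<subseteq> carrier G" "K \<union> insert x X \<subseteq> carrier G" using insert.prems L LG by auto
  have M: "subgroup ?M G" and N: "subgroup ?N G" using gen_sub by (auto intro: generate_is_subgroup)
  interpret N: group ?G using N by (rule subgroup_imp_group)
  have M_N_sub: "subgroup ?M (?G)" using M N M_N by (rule subgroup_incl)
  have normal: "?M \<lhd> ?G"
  proof (rule N.normal_invI[OF M_N_sub])
    fix g m assume g: "g \<in> carrier (?G)" and m: "m \<in> ?M"
    have gm: "g \<in> L" "m \<in> L" "g \<in> carrier G" "m \<in> carrier G"
      using g m N_L M_N LG by auto
    have "g \<otimes> m \<otimes> inv g \<otimes> inv m \<in> derived G L"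
      unfolding derived_def using gm by (intro generate.incl) blast
    then have "g \<otimes> m \<otimes> inv g \<otimes> inv m \<in> ?M" using L(3) by (auto intro: generate.incl)
    then have "g \<otimes> m \<otimes> inv g \<otimes> inv m \<otimes> m \<in> ?M" using m by (rule generate.eng)
    then show "g \<otimes>\<^bsub>?G\<^esub> m \<otimes>\<^bsub>?G\<^esub> inv\<^bsub>?G\<^esub> g \<in> ?M"
      using gm g N m_inv_consistent[OF N] by (simp add: m_assoc)
  qed
  interpret M: normal ?M ?G by (rule normal)
  let ?B = "?G Mod ?M" and ?q = "\<lambda>y. ?M #>\<^bsub>?G\<^esub> y"
  interpret q: group_hom ?G ?B ?q by (rule M.group_hom_Mod)
  have x: "x \<in> ?N" by (rule generate.incl) simp
  have "carrier ?B = ?q ` ?N" using carrier_FactGroup[of ?G ?M] by simp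
  also have "\<dots> = ?q ` generate (?G) (K \<union> insert x X)"
    using generate_consistent[OF _ N, of "K \<union> insert x X"] generate.incl[of _ "K \<union> insert x X" G]
    by (metis subsetI)
  also have "\<dots> = generate ?B (?q ` (K \<union> insert x X))"
    by (rule q.generate_img[symmetric]) (auto intro: generate.incl)
  also have "\<dots> \<subseteq> generate ?B {?q x}"
  proof (rule q.H.generate_subgroup_incl)
    show "subgroup (generate ?B {?q x}) ?B" using q.hom_closed[of x] x by (intro q.H.generate_is_subgroup) simp
    have "?q y \<in> generate ?B {?q x}" if y: "y \<in> K \<union> X" for y
    proof -
      have "y \<in> ?M" using y by (rule generate.incl)
      then have "?q y = \<one>\<^bsub>?B\<^esub>" using M.coset_eq_one_iff M.mem_carrier by blast
      then show ?thesis using generate.one by metis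
    qed
    then show "?q ` (K \<union> insert x X) \<subseteq> generate ?B {?q x}" by (auto intro: generate.incl)
  qed
  finally have "carrier ?B \<subseteq> generate ?B {?q x}" .
  then have "carrier ?B = range (\<lambda>n::int. ?q x [^]\<^bsub>?B\<^esub> n)"
    using q.H.generate_pow[of "?q x"] q.hom_closed[of x] x q.H.int_pow_closed by auto
  moreover have "?q x \<in> carrier ?B" using q.hom_closed[of x] x by simp
  ultimately have cyc: "cyclic_group ?B" unfolding q.H.cyclic_group by (rule bexI)
  have "series_of G cyclic_group ?M" using insert.prems by (intro insert.IH) simp
  from series_of.extend[OF this N normal cyc] show ?case .
qed

text \<open>The series obtained for L' is extended through the finitely generated abelian group
  L/L'. Finite generation is assumed for all subgroups of L, so that the assumption passes to
  L'.\<close>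

lemma (in group) soluble_series_of_cyclic:
  assumes fg: "\<And>S. subgroup S G \<Longrightarrow> S \<subseteq> L \<Longrightarrow> \<exists>X. finite X \<and> X \<subseteq> S \<and> S \<subseteq> generate G X"
    and L: "subgroup L G" "(derived G ^^ n) L \<subseteq> {\<one>}"
  shows "series_of G cyclic_group L"
  using assms
proof (induction n arbitrary: L)
  case 0
  then have "L = {\<one>}" using subgroup.one_closed by fastforce
  then show ?case using series_of.trivial by simp
next
  case (Suc n)
  have L': "derived G L \<subseteq> L" by (rule derived_incl[OF subset_refl Suc.prems(2)])
  have "series_of G cyclic_group (derived G L)"
  proof (rule Suc.IH)
    show "subgroup (derived G L) G" using Suc.prems(2) by (intro derived_is_subgroup subgroup.subset)
    show "(derived G ^^ n) (derived G L) \<subseteq> {\<one>}" using Suc.prems(3) by (simp only: funpow_Suc_right o_apply)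
    show "\<exists>X. finite X \<and> X \<subseteq> S \<and> S \<subseteq> generate G X" if "subgroup S G" "S \<subseteq> derived G L" for S
      using Suc.prems(1) that L' by blast
  qed
  moreover obtain X where X: "finite X" "X \<subseteq> L" "L \<subseteq> generate G X" using Suc.prems(1)[OF Suc.prems(2)] by blast
  ultimately have "series_of G cyclic_group (generate G (derived G L \<union> X))"
    using L' Suc.prems(2) by (intro series_of_cyclic_generate[where L = L]) auto
  moreover have "generate G (derived G L \<union> X) = L"
  proof
    show "generate G (derived G L \<union> X) \<subseteq> L"
      using X L' Suc.prems(2) by (intro generate_subgroup_incl) auto
    show "L \<subseteq> generate G (derived G L \<union> X)" using X(3) mono_generate[of X "derived G L \<union> X"] by blast
  qed
  ultimately show ?case by simp
qed

proposition (in group) not_polycyclic_perfect_subgroup: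
  assumes "polycyclic_by_finite G" "\<not> polycyclic G"
  obtains X where "finite X" "X \<subseteq> carrier G" "derived G (generate G X) = generate G X"
    "generate G X \<noteq> {\<one>}"
proof -
  have s: "series_of G cyclic_or_finite (carrier G)"
    using assms(1) series_ofI[of G _ cyclic_or_finite] unfolding polycyclic_by_finite_def by blast
  have "\<exists>H. subgroup H G \<and> derived G H = H \<and> H \<noteq> {\<one>}"
  proof (rule ccontr)
    assume contra: "\<not> ?thesis"
    then obtain n where "(derived G ^^ n) (carrier G) \<subseteq> {\<one>}"
      using series_soluble_if_no_perfect[OF s] by blast
    then have "series_of G cyclic_group (carrier G)"
      using soluble_series_of_cyclic[OF series_subgroup_fg[OF s] subgroup_self] by blast
    then have "polycyclic G" unfolding polycyclic_def by (rule series_ofE) blast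
    then show False using assms(2) by simp
  qed
  then obtain H where H: "subgroup H G" "derived G H = H" "H \<noteq> {\<one>}" by blast
  then obtain X where X: "finite X" "X \<subseteq> H" "H \<subseteq> generate G X"
    using series_subgroup_fg[OF s H(1)] subgroup.subset by blast
  then have "generate G X = H" using H(1) generate_subgroup_incl by blast
  then show ?thesis using that[of X] X H subgroup.subset[OF H(1)] by blast
qed

section \<open>Convolution algebras of groupoids\<close>

abbreviation supp :: "('x \<Rightarrow> 'y :: zero) \<Rightarrow> 'x set" where
  "supp f \<equiv> {x. f x \<noteq> 0}"

text \<open>The sum runs over the support of A alone, so \<phi> may be any function: the pairing is
  an inner product on finitely supported functions and also evaluates arbitrary linear functionals.
  Identities between convolutions are proved by comparing all functionals.\<close>

definition pairing :: "('x \<Rightarrow> real) \<Rightarrow> ('x \<Rightarrow> real) \<Rightarrow> real" where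
  "pairing A \<phi> = (\<Sum>x | A x \<noteq> 0. A x * \<phi> x)"

lemma pairing_superset:
  assumes "finite B" "supp A \<subseteq> B"
  shows "pairing A \<phi> = (\<Sum>x\<in>B. A x * \<phi> x)"
  unfolding pairing_def by (rule sum.mono_neutral_left[OF assms]) auto

lemma pairing_cong: "(\<And>x. A x \<noteq> 0 \<Longrightarrow> \<phi> x = \<psi> x) \<Longrightarrow> pairing A \<phi> = pairing A \<psi>"
  unfolding pairing_def by (rule sum.cong) auto

lemma pairing_diff_right: "pairing A (\<lambda>x. \<phi> x - \<psi> x) = pairing A \<phi> - pairing A \<psi>"
  unfolding pairing_def by (simp add: right_diff_distrib sum_subtractf)

lemma pairing_scale_right: "pairing A (\<lambda>x. c * \<phi> x) = c * pairing A \<phi>"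
  unfolding pairing_def by (simp add: sum_distrib_left mult_ac)

lemma pairing_swap: "pairing A (\<lambda>x. pairing B (\<lambda>y. f x y)) = pairing B (\<lambda>y. pairing A (\<lambda>x. f x y))"
  unfolding pairing_def sum_distrib_left by (subst sum.swap) (simp add: mult_ac)

lemma pairing_indicator:
  assumes "finite (supp A)"
  shows "pairing A (\<lambda>x. if x = z then 1 else 0) = A z"
  using pairing_superset[of "insert z (supp A)" A] assms
  by (subst pairing_superset[of "insert z (supp A)"]) (auto simp: if_distrib cong: if_cong)

lemma pairing_ext:
  assumes "finite (supp A)" "finite (supp B)" "\<And>\<phi>. pairing A \<phi> = pairing B \<phi>"
  shows "A = B"
proof
  fix z show "A z = B z"
    using assms(3)[of "\<lambda>x. if x = z then 1 else 0"]
    by (simp add: pairing_indicator[OF assms(1)] pairing_indicator[OF assms(2)])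
qed

lemma pairing_sym:
  assumes "finite (supp A)" "finite (supp B)"
  shows "pairing A B = pairing B A"
  using assms
  by (simp add: pairing_superset[of "supp A \<union> supp B"] subset_iff mult.commute)

text \<open>There are two instances: a group as a groupoid with one object, for its group ring, and
  the pair groupoid on N points times a group, for N by N matrices. Finitely many objects are
  required so that the sum of the identity arrows has finite support.\<close>

locale groupoid =
  fixes M :: "'x set" and src tgt :: "'x \<Rightarrow> 'v" and mul :: "'x \<Rightarrow> 'x \<Rightarrow> 'x"
    and inverse_of :: "'x \<Rightarrow> 'x" and idt :: "'v \<Rightarrow> 'x"
  assumes mul_closed: "\<And>x y. x \<in> M \<Longrightarrow> y \<in> M \<Longrightarrow> tgt x = src y \<Longrightarrow> mul x y \<in> M"
    and src_mul: "\<And>x y. x \<in> M \<Longrightarrow> y \<in> M \<Longrightarrow> tgt x = src y \<Longrightarrow> src (mul x y) = src x"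
    and tgt_mul: "\<And>x y. x \<in> M \<Longrightarrow> y \<in> M \<Longrightarrow> tgt x = src y \<Longrightarrow> tgt (mul x y) = tgt y"
    and mul_assoc: "\<And>x y z. x \<in> M \<Longrightarrow> y \<in> M \<Longrightarrow> z \<in> M \<Longrightarrow> tgt x = src y \<Longrightarrow> tgt y = src z \<Longrightarrow>
        mul (mul x y) z = mul x (mul y z)"
    and inverse_closed: "\<And>x. x \<in> M \<Longrightarrow> inverse_of x \<in> M"
    and src_inverse: "\<And>x. x \<in> M \<Longrightarrow> src (inverse_of x) = tgt x"
    and tgt_inverse: "\<And>x. x \<in> M \<Longrightarrow> tgt (inverse_of x) = src x"
    and inverse_inverse: "\<And>x. x \<in> M \<Longrightarrow> inverse_of (inverse_of x) = x"
    and inverse_mul: "\<And>x y. x \<in> M \<Longrightarrow> y \<in> M \<Longrightarrow> tgt x = src y \<Longrightarrow>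
        inverse_of (mul x y) = mul (inverse_of y) (inverse_of x)"
    and mul_inverse_cancel: "\<And>x y. x \<in> M \<Longrightarrow> y \<in> M \<Longrightarrow> tgt x = src y \<Longrightarrow>
        mul (inverse_of x) (mul x y) = y"
    and finite_units: "finite (src ` M)"
    and idt_closed: "\<And>x. x \<in> M \<Longrightarrow> idt (src x) \<in> M"
    and src_idt: "\<And>x. x \<in> M \<Longrightarrow> src (idt (src x)) = src x"
    and tgt_idt: "\<And>x. x \<in> M \<Longrightarrow> tgt (idt (src x)) = src x"
    and idt_mul: "\<And>x. x \<in> M \<Longrightarrow> mul (idt (src x)) x = x"
    and inverse_idt: "\<And>x. x \<in> M \<Longrightarrow> inverse_of (idt (src x)) = idt (src x)"
begin

lemmas closed = mul_closed inverse_closed idt_closed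
lemmas ends = src_mul tgt_mul src_inverse tgt_inverse src_idt tgt_idt

lemma mul_inverse_cancel':
  assumes "x \<in> M" "z \<in> M" "src x = src z"
  shows "mul x (mul (inverse_of x) z) = z"
  using mul_inverse_cancel[of "inverse_of x" z] assms by (simp add: closed ends inverse_inverse)

definition FA :: "('x \<Rightarrow> real) set" where
  "FA = {A. finite (supp A) \<and> supp A \<subseteq> M}"

lemma FA_finite: "A \<in> FA \<Longrightarrow> finite (supp A)"
  and FA_mem: "A \<in> FA \<Longrightarrow> A x \<noteq> 0 \<Longrightarrow> x \<in> M"
  by (auto simp: FA_def)

lemma FA_diff: "A \<in> FA \<Longrightarrow> B \<in> FA \<Longrightarrow> (\<lambda>x. A x - B x) \<in> FA"
  unfolding FA_def by (force intro: finite_subset[of _ "supp A \<union> supp B"])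

lemma FA_add: "A \<in> FA \<Longrightarrow> B \<in> FA \<Longrightarrow> (\<lambda>x. A x + B x) \<in> FA"
  unfolding FA_def by (force intro: finite_subset[of _ "supp A \<union> supp B"])

lemma FA_scale: "A \<in> FA \<Longrightarrow> (\<lambda>x. c * A x) \<in> FA"
  by (auto simp: FA_def intro: finite_subset[of _ "supp A"])

text \<open>Each factorisation of z is determined by its first factor x, as z = x (x^-1 z). The sum
  has the shape of \<open>gr_mult\<close>, so that group ring multiplication is an instance.\<close>

definition conv :: "('x \<Rightarrow> real) \<Rightarrow> ('x \<Rightarrow> real) \<Rightarrow> 'x \<Rightarrow> real" where
  "conv A B z = (if z \<in> M then \<Sum>x | A x \<noteq> 0 \<and> src x = src z. A x * B (mul (inverse_of x) z) else 0)"

definition star :: "('x \<Rightarrow> real) \<Rightarrow> 'x \<Rightarrow> real" where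
  "star A x = (if x \<in> M then A (inverse_of x) else 0)"

text \<open>Besides being the unit of the algebra, it represents the Kaplansky trace:
  \<open>pairing A unit_fun\<close> is the sum of the coefficients of A at the identity
  arrows.\<close>

definition unit_fun :: "'x \<Rightarrow> real" where
  "unit_fun x = (if x \<in> idt ` src ` M then 1 else 0)"

lemma conv_support:
  assumes "A \<in> FA" "B \<in> FA"
  shows "{z. conv A B z \<noteq> 0} \<subseteq> (\<lambda>(x, y). mul x y) ` {(x, y). A x \<noteq> 0 \<and> B y \<noteq> 0 \<and> tgt x = src y}"
proof
  fix z assume "z \<in> {z. conv A B z \<noteq> 0}"
  then have z: "z \<in> M" "(\<Sum>x | A x \<noteq> 0 \<and> src x = src z. A x * B (mul (inverse_of x) z)) \<noteq> 0"
    by (auto simp: conv_def split: if_splits)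
  then obtain x where x: "A x \<noteq> 0" "src x = src z" "B (mul (inverse_of x) z) \<noteq> 0"
    by (smt (verit) mem_Collect_eq mult_eq_0_iff sum.not_neutral_contains_not_neutral)
  then have "x \<in> M" using assms FA_mem by blast
  then show "z \<in> (\<lambda>(x, y). mul x y) ` {(x, y). A x \<noteq> 0 \<and> B y \<noteq> 0 \<and> tgt x = src y}"
    using x z by (intro image_eqI[of _ _ "(x, mul (inverse_of x) z)"])
      (auto simp: mul_inverse_cancel' ends closed)
qed

lemma finite_conv_support:
  assumes "A \<in> FA" "B \<in> FA"
  shows "finite ((\<lambda>(x, y). mul x y) ` {(x, y). A x \<noteq> 0 \<and> B y \<noteq> 0 \<and> tgt x = src y})"
proof (rule finite_imageI, rule finite_subset)
  show "{(x, y). A x \<noteq> 0 \<and> B y \<noteq> 0 \<and> tgt x = src y} \<subseteq> supp A \<times> supp B" by auto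
  show "finite (supp A \<times> supp B)"
    by (rule finite_cartesian_product[OF FA_finite[OF assms(1)] FA_finite[OF assms(2)]])
qed

lemma FA_conv:
  assumes "A \<in> FA" "B \<in> FA"
  shows "conv A B \<in> FA"
proof -
  have "finite {z. conv A B z \<noteq> 0}"
    by (rule finite_subset[OF conv_support[OF assms] finite_conv_support[OF assms]])
  moreover have "{z. conv A B z \<noteq> 0} \<subseteq> M" by (auto simp: conv_def split: if_splits)
  ultimately show ?thesis by (simp add: FA_def)
qed

lemma FA_star:
  assumes "A \<in> FA"
  shows "star A \<in> FA"
proof -
  have "{x. star A x \<noteq> 0} \<subseteq> inverse_of ` (supp A)"
  proof
    fix x assume "x \<in> {x. star A x \<noteq> 0}"
    then have "x \<in> M" "A (inverse_of x) \<noteq> 0" by (auto simp: star_def split: if_splits)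
    then show "x \<in> inverse_of ` (supp A)"
      by (intro image_eqI[of _ _ "inverse_of x"]) (simp_all add: inverse_inverse)
  qed
  then have "finite {x. star A x \<noteq> 0}" using FA_finite[OF assms] finite_surj by blast
  moreover have "{x. star A x \<noteq> 0} \<subseteq> M" by (auto simp: star_def split: if_splits)
  ultimately show ?thesis by (simp add: FA_def)
qed

lemma FA_unit_fun: "unit_fun \<in> FA"
  unfolding FA_def unit_fun_def
  using finite_units idt_closed by (auto intro: finite_subset[of _ "idt ` src ` M"])

text \<open>In the language of measures, a convolution is the image of the product measure under
  composition. In this form associativity and the rules for \<open>star\<close> reduce to exchanging
  sums.\<close>

lemma pairing_conv:
  assumes A: "A \<in> FA" and B: "B \<in> FA"
  shows "pairing (conv A B) \<phi> = pairing A (\<lambda>x. pairing B (\<lambda>y. if tgt x = src y then \<phi> (mul x y) else 0))"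
proof -
  define S where "S = (\<lambda>(x, y). mul x y) ` {(x, y). A x \<noteq> 0 \<and> B y \<noteq> 0 \<and> tgt x = src y}"
  have S: "finite S" "{z. conv A B z \<noteq> 0} \<subseteq> S"
    unfolding S_def by (rule finite_conv_support[OF A B], rule conv_support[OF A B])
  have SM: "S \<subseteq> M" unfolding S_def using FA_mem[OF A] FA_mem[OF B] mul_closed by auto
  have inner: "(\<Sum>z | z \<in> S \<and> src x = src z. B (mul (inverse_of x) z) * \<phi> z) =
      pairing B (\<lambda>y. if tgt x = src y then \<phi> (mul x y) else 0)" if x: "A x \<noteq> 0" for x
  proof -
    have xM: "x \<in> M" using A x FA_mem by blast
    have "(\<Sum>z | z \<in> S \<and> src x = src z. B (mul (inverse_of x) z) * \<phi> z) =
        (\<Sum>y | B y \<noteq> 0 \<and> tgt x = src y. B y * \<phi> (mul x y))"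
    proof -
      have "(\<Sum>z | z \<in> S \<and> src x = src z. B (mul (inverse_of x) z) * \<phi> z) =
          (\<Sum>z | z \<in> S \<and> src x = src z \<and> B (mul (inverse_of x) z) \<noteq> 0. B (mul (inverse_of x) z) * \<phi> z)"
        by (rule sum.mono_neutral_right) (use S(1) in auto)
      also have "\<dots> = (\<Sum>y | B y \<noteq> 0 \<and> tgt x = src y. B y * \<phi> (mul x y))"
      \<comment> \<open>For fixed x, left multiplication by x is a bijection from the arrows that
        start at \<open>tgt x\<close> to those that start at \<open>src x\<close>, with inverse
        multiplication by x^-1.\<close>
      proof (rule sum.reindex_bij_witness[of _ "\<lambda>y. mul x y" "\<lambda>z. mul (inverse_of x) z"])
        fix z assume "z \<in> {z. z \<in> S \<and> src x = src z \<and> B (mul (inverse_of x) z) \<noteq> 0}"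
        then have z: "z \<in> M" "src x = src z" "B (mul (inverse_of x) z) \<noteq> 0" using SM by auto
        show "mul x (mul (inverse_of x) z) = z"
          using mul_inverse_cancel' xM z by blast
        then show "B (mul (inverse_of x) z) * \<phi> (mul x (mul (inverse_of x) z)) =
            B (mul (inverse_of x) z) * \<phi> z" by simp
        show "mul (inverse_of x) z \<in> {y. B y \<noteq> 0 \<and> tgt x = src y}"
          using z xM by (simp add: ends closed)
      next
        fix y assume "y \<in> {y. B y \<noteq> 0 \<and> tgt x = src y}"
        then have y: "B y \<noteq> 0" "tgt x = src y" "y \<in> M" using FA_mem[OF B] by auto
        show eq: "mul (inverse_of x) (mul x y) = y" using mul_inverse_cancel xM y by blast
        have "mul x y \<in> S" unfolding S_def using x y by (intro image_eqI[of _ _ "(x, y)"]) auto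
        then show "mul x y \<in> {z. z \<in> S \<and> src x = src z \<and> B (mul (inverse_of x) z) \<noteq> 0}"
          using y xM eq by (simp add: ends)
      qed
      finally show ?thesis .
    qed
    also have "\<dots> = pairing B (\<lambda>y. if tgt x = src y then \<phi> (mul x y) else 0)"
      unfolding pairing_def by (rule sum.mono_neutral_cong_left) (use FA_finite[OF B] in auto)
    finally show ?thesis .
  qed
  have "pairing (conv A B) \<phi> = (\<Sum>z\<in>S. conv A B z * \<phi> z)" by (rule pairing_superset[OF S])
  also have "\<dots> = (\<Sum>z\<in>S. \<Sum>x | A x \<noteq> 0. if src x = src z then A x * (B (mul (inverse_of x) z) * \<phi> z) else 0)"
  proof (rule sum.cong[OF refl])
    fix z assume "z \<in> S"
    then have "conv A B z = (\<Sum>x | A x \<noteq> 0 \<and> src x = src z. A x * B (mul (inverse_of x) z))"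
      using SM by (auto simp: conv_def)
    also have "\<dots> = (\<Sum>x | A x \<noteq> 0. if src x = src z then A x * B (mul (inverse_of x) z) else 0)"
      by (rule sum.mono_neutral_cong_left) (use FA_finite[OF A] in auto)
    finally show "conv A B z * \<phi> z = (\<Sum>x | A x \<noteq> 0. if src x = src z then A x * (B (mul (inverse_of x) z) * \<phi> z) else 0)"
      by (simp add: sum_distrib_right if_distrib[of "\<lambda>u. u * _"] mult.assoc cong: if_cong)
  qed
  also have "\<dots> = (\<Sum>x | A x \<noteq> 0. \<Sum>z\<in>S. if src x = src z then A x * (B (mul (inverse_of x) z) * \<phi> z) else 0)"
    by (rule sum.swap)
  also have "\<dots> = (\<Sum>x | A x \<noteq> 0. A x * (\<Sum>z | z \<in> S \<and> src x = src z. B (mul (inverse_of x) z) * \<phi> z))"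
    unfolding sum_distrib_left
    by (intro sum.cong[OF refl] sum.mono_neutral_cong_right) (use S(1) in auto)
  also have "\<dots> = pairing A (\<lambda>x. pairing B (\<lambda>y. if tgt x = src y then \<phi> (mul x y) else 0))"
    unfolding pairing_def[of A] by (rule sum.cong[OF refl]) (simp add: inner)
  finally show ?thesis .
qed

lemma pairing_star:
  assumes "A \<in> FA"
  shows "pairing (star A) \<phi> = pairing A (\<lambda>x. \<phi> (inverse_of x))"
  unfolding pairing_def
  by (rule sum.reindex_bij_witness[of _ inverse_of inverse_of])
    (use FA_mem[OF assms] in \<open>auto simp: star_def inverse_inverse closed split: if_splits\<close>)

lemma FA_ext:
  assumes "A \<in> FA" "B \<in> FA" "\<And>\<phi>. pairing A \<phi> = pairing B \<phi>"
  shows "A = B"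
  by (rule pairing_ext[OF FA_finite[OF assms(1)] FA_finite[OF assms(2)] assms(3)])

lemma conv_assoc:
  assumes "A \<in> FA" "B \<in> FA" "C \<in> FA"
  shows "conv (conv A B) C = conv A (conv B C)"
proof (rule FA_ext)
  fix \<phi>
  have "pairing (conv (conv A B) C) \<phi> = pairing A (\<lambda>x. pairing B (\<lambda>y. if tgt x = src y then
      pairing C (\<lambda>z. if tgt (mul x y) = src z then \<phi> (mul (mul x y) z) else 0) else 0))"
    using assms by (simp add: pairing_conv FA_conv)
  also have "\<dots> = pairing A (\<lambda>x. pairing B (\<lambda>y. pairing C (\<lambda>z. if tgt y = src z then
      (if tgt x = src (mul y z) then \<phi> (mul x (mul y z)) else 0) else 0)))"
  proof (intro pairing_cong)
    fix x y assume xy: "A x \<noteq> 0" "B y \<noteq> 0"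
    have 0: "pairing C (\<lambda>z. if tgt y = src z then (if tgt x = src (mul y z) then \<phi> (mul x (mul y z)) else 0) else 0) = 0"
      if "tgt x \<noteq> src y"
      unfolding pairing_def
      by (rule sum.neutral) (use that xy assms FA_mem in \<open>auto simp: ends\<close>)
    have "pairing C (\<lambda>z. if tgt (mul x y) = src z then \<phi> (mul (mul x y) z) else 0) =
        pairing C (\<lambda>z. if tgt y = src z then (if tgt x = src (mul y z) then \<phi> (mul x (mul y z)) else 0) else 0)"
      if "tgt x = src y"
      by (rule pairing_cong) (use that xy assms FA_mem in \<open>auto simp: ends mul_assoc\<close>)
    then show "(if tgt x = src y then
      pairing C (\<lambda>z. if tgt (mul x y) = src z then \<phi> (mul (mul x y) z) else 0) else 0) =
      pairing C (\<lambda>z. if tgt y = src z then (if tgt x = src (mul y z) then \<phi> (mul x (mul y z)) else 0) else 0)"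
      using 0 by simp
  qed
  also have "\<dots> = pairing (conv A (conv B C)) \<phi>"
    using assms by (simp add: pairing_conv FA_conv)
  finally show "pairing (conv (conv A B) C) \<phi> = pairing (conv A (conv B C)) \<phi>" .
qed (use assms FA_conv in auto)

lemma star_conv:
  assumes "A \<in> FA" "B \<in> FA"
  shows "star (conv A B) = conv (star B) (star A)"
proof (rule FA_ext)
  fix \<phi>
  have "pairing (star (conv A B)) \<phi> =
      pairing A (\<lambda>x. pairing B (\<lambda>y. if tgt x = src y then \<phi> (inverse_of (mul x y)) else 0))"
    using assms by (simp add: pairing_conv pairing_star FA_conv)
  also have "\<dots> = pairing A (\<lambda>x. pairing B (\<lambda>y.
      if tgt (inverse_of y) = src (inverse_of x) then \<phi> (mul (inverse_of y) (inverse_of x)) else 0))"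
    by (intro pairing_cong) (use assms FA_mem in \<open>auto simp: ends inverse_mul\<close>)
  also have "\<dots> = pairing B (\<lambda>y. pairing A (\<lambda>x.
      if tgt (inverse_of y) = src (inverse_of x) then \<phi> (mul (inverse_of y) (inverse_of x)) else 0))"
    by (rule pairing_swap)
  also have "\<dots> = pairing (conv (star B) (star A)) \<phi>"
    using assms by (simp add: pairing_conv pairing_star FA_star)
  finally show "pairing (star (conv A B)) \<phi> = pairing (conv (star B) (star A)) \<phi>" .
qed (use assms FA_conv FA_star in auto)

lemma star_star: "A \<in> FA \<Longrightarrow> star (star A) = A"
  by (rule FA_ext) (auto simp: FA_star pairing_star inverse_inverse FA_mem intro!: pairing_cong)

lemma unit_conv: "A \<in> FA \<Longrightarrow> conv unit_fun A = A"
proof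
  fix z assume A: "A \<in> FA"
  have "conv unit_fun A z = A z" if z: "z \<in> M"
  proof -
    have "{x. unit_fun x \<noteq> 0 \<and> src x = src z} = {idt (src z)}"
      using z by (auto simp: unit_fun_def src_idt) (metis src_idt)
    moreover have "unit_fun (idt (src z)) = 1" using z by (auto simp: unit_fun_def)
    ultimately show ?thesis using z by (simp add: conv_def inverse_idt idt_mul)
  qed
  then show "conv unit_fun A z = A z" using FA_mem[OF A, of z] by (auto simp: conv_def)
qed

lemma star_unit: "star unit_fun = unit_fun"
proof
  fix x
  have inv_eq: "inverse_of u = u" if "u \<in> idt ` src ` M" for u using that inverse_idt by auto
  have "inverse_of x \<in> idt ` src ` M \<longleftrightarrow> x \<in> idt ` src ` M" if x: "x \<in> M"
  proof
    assume u: "inverse_of x \<in> idt ` src ` M"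
    show "x \<in> idt ` src ` M" using inv_eq[OF u] u unfolding inverse_inverse[OF x] by simp
  qed (simp add: inv_eq)
  then show "star unit_fun x = unit_fun x" using idt_closed by (auto simp: star_def unit_fun_def)
qed

lemma conv_unit:
  assumes "A \<in> FA"
  shows "conv A unit_fun = A"
proof -
  have "star (conv A unit_fun) = star A"
    using star_conv[OF assms FA_unit_fun] unit_conv[OF FA_star[OF assms]] star_unit by simp
  then show ?thesis using star_star assms FA_conv FA_unit_fun by metis
qed

lemma pairing_star_star:
  assumes "A \<in> FA" "B \<in> FA"
  shows "pairing (star A) (star B) = pairing A B"
  using assms by (auto simp: pairing_star star_def inverse_inverse closed FA_mem intro!: pairing_cong)

text \<open>Left translation by \<open>x\<close> is a partial isometry whose adjoint is translation by the inverse.\<close>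

lemma pairing_conv_left:
  assumes A: "A \<in> FA" and B: "B \<in> FA" and C: "C \<in> FA"
  shows "pairing (conv A B) C = pairing B (conv (star A) C)"
proof -
  have "pairing B (conv (star A) C) = pairing (conv (star A) C) B"
    by (rule pairing_sym) (use assms FA_finite FA_conv FA_star in auto)
  also have "\<dots> = pairing A (\<lambda>x. pairing C (\<lambda>z. if tgt (inverse_of x) = src z then B (mul (inverse_of x) z) else 0))"
    using assms by (simp add: pairing_conv pairing_star FA_star)
  also have "\<dots> = pairing A (\<lambda>x. pairing B (\<lambda>y. if tgt x = src y then C (mul x y) else 0))"
  proof (rule pairing_cong)
    fix x assume x: "A x \<noteq> 0"
    have xM: "x \<in> M" using A x FA_mem by blast
    have "pairing C (\<lambda>z. if tgt (inverse_of x) = src z then B (mul (inverse_of x) z) else 0) =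
        (\<Sum>z | C z \<noteq> 0 \<and> src x = src z \<and> B (mul (inverse_of x) z) \<noteq> 0. C z * B (mul (inverse_of x) z))"
      unfolding pairing_def
      by (rule sum.mono_neutral_cong_right) (use FA_finite[OF C] xM in \<open>auto simp: ends\<close>)
    also have "\<dots> = (\<Sum>y | B y \<noteq> 0 \<and> tgt x = src y \<and> C (mul x y) \<noteq> 0. B y * C (mul x y))"
      by (rule sum.reindex_bij_witness[of _ "\<lambda>y. mul x y" "\<lambda>z. mul (inverse_of x) z"])
        (use xM FA_mem[OF B] FA_mem[OF C] in
          \<open>auto simp: mul_inverse_cancel mul_inverse_cancel' ends closed\<close>)
    also have "\<dots> = pairing B (\<lambda>y. if tgt x = src y then C (mul x y) else 0)"
      unfolding pairing_def
      by (rule sum.mono_neutral_cong_left) (use FA_finite[OF B] xM in \<open>auto simp: ends\<close>)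
    finally show "pairing C (\<lambda>z. if tgt (inverse_of x) = src z then B (mul (inverse_of x) z) else 0) =
        pairing B (\<lambda>y. if tgt x = src y then C (mul x y) else 0)" .
  qed
  also have "\<dots> = pairing (conv A B) C" by (rule pairing_conv[OF A B, symmetric])
  finally show ?thesis by simp
qed

text \<open>\<open>star\<close> preserves the pairing and reverses products, so right multiplication
  inherits its adjoint from left multiplication.\<close>

lemma pairing_conv_right:
  assumes "A \<in> FA" "B \<in> FA" "C \<in> FA"
  shows "pairing (conv A B) C = pairing A (conv C (star B))"
proof -
  have "pairing (conv A B) C = pairing (conv (star B) (star A)) (star C)"
    using assms pairing_star_star[of "conv A B" C] by (simp add: FA_conv star_conv)
  also have "\<dots> = pairing (star A) (conv B (star C))"
    using assms by (simp add: pairing_conv_left FA_star star_star)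
  also have "\<dots> = pairing (star A) (star (conv C (star B)))"
    using assms by (simp add: star_conv FA_star star_star)
  also have "\<dots> = pairing A (conv C (star B))"
    using assms by (simp add: pairing_star_star FA_conv FA_star)
  finally show ?thesis .
qed

end

section \<open>The 2-norm on a convolution algebra and the trace of idempotents\<close>

lemma L2_set_subset_mono: "finite T \<Longrightarrow> S \<subseteq> T \<Longrightarrow> L2_set f S \<le> L2_set f T"
  unfolding L2_set_def by (intro real_sqrt_le_mono sum_mono2) auto

context groupoid
begin

definition fnorm :: "('x \<Rightarrow> real) \<Rightarrow> real" where
  "fnorm A = sqrt (pairing A A)"

lemma pairing_self_nonneg: "pairing A A \<ge> 0"
  unfolding pairing_def by (intro sum_nonneg) simp

lemma fnorm_nonneg: "fnorm A \<ge> 0"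
  by (simp add: fnorm_def pairing_self_nonneg)

lemma fnorm_square: "(fnorm A)\<^sup>2 = pairing A A"
  by (simp add: fnorm_def pairing_self_nonneg)

lemma fnorm_L2_set:
  assumes "finite S" "supp A \<subseteq> S"
  shows "fnorm A = L2_set A S"
  unfolding fnorm_def L2_set_def pairing_superset[OF assms] by (simp add: power2_eq_square)

lemma fnorm_eq_0:
  assumes "A \<in> FA" "fnorm A = 0"
  shows "A = (\<lambda>x. 0)"
proof -
  have "L2_set A (supp A) = 0"
    using fnorm_L2_set[OF FA_finite[OF assms(1)], of A] assms(2) by simp
  then show ?thesis using L2_set_eq_0_iff[OF FA_finite[OF assms(1)]] by blast
qed

lemma pairing_Cauchy_Schwarz:
  assumes "A \<in> FA" "B \<in> FA"
  shows "\<bar>pairing A B\<bar> \<le> fnorm A * fnorm B"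
proof -
  let ?S = "supp A \<union> supp B"
  have S: "finite ?S" using assms FA_finite by simp
  have "\<bar>pairing A B\<bar> \<le> (\<Sum>x\<in>?S. \<bar>A x\<bar> * \<bar>B x\<bar>)"
    unfolding pairing_superset[OF S Un_upper1] by (rule order_trans[OF sum_abs]) (simp add: abs_mult)
  also have "\<dots> \<le> L2_set A ?S * L2_set B ?S" by (rule L2_set_mult_ineq)
  also have "\<dots> = fnorm A * fnorm B"
    using fnorm_L2_set[OF S Un_upper1] fnorm_L2_set[OF S Un_upper2] by simp
  finally show ?thesis .
qed

lemma fnorm_triangle:
  assumes "A \<in> FA" "B \<in> FA"
  shows "fnorm (\<lambda>x. A x + B x) \<le> fnorm A + fnorm B"
proof -
  let ?S = "supp A \<union> supp B"
  have S: "finite ?S" using assms FA_finite by simp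
  have "fnorm (\<lambda>x. A x + B x) = L2_set (\<lambda>x. A x + B x) ?S" by (rule fnorm_L2_set[OF S]) auto
  also have "\<dots> \<le> L2_set A ?S + L2_set B ?S" by (rule L2_set_triangle_ineq)
  also have "\<dots> = fnorm A + fnorm B"
    using fnorm_L2_set[OF S Un_upper1] fnorm_L2_set[OF S Un_upper2] by simp
  finally show ?thesis .
qed

lemma fnorm_star: "A \<in> FA \<Longrightarrow> fnorm (star A) = fnorm A"
  by (simp add: fnorm_def pairing_star_star)

text \<open>Each arrow acts from the left as a partial isometry, so the sum of the absolute
  coefficients of A is a bound. The estimate is made for \<open>pairing (conv A B) C\<close> with
  arbitrary C and then applied to C = \<open>conv A B\<close>.\<close>

lemma conv_bounded:
  assumes A: "A \<in> FA"
  shows "\<exists>K\<ge>0. \<forall>B\<in>FA. fnorm (conv A B) \<le> K * fnorm B"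
proof (intro exI conjI ballI)
  let ?K = "\<Sum>x | A x \<noteq> 0. \<bar>A x\<bar>"
  show "?K \<ge> 0" by (rule sum_nonneg) simp
  fix B assume B: "B \<in> FA"
  have le: "pairing (conv A B) C \<le> ?K * (fnorm B * fnorm C)" if C: "C \<in> FA" for C
  proof -
    have "A x * pairing B (\<lambda>y. if tgt x = src y then C (mul x y) else 0) \<le> \<bar>A x\<bar> * (fnorm B * fnorm C)"
      if x: "A x \<noteq> 0" for x
    proof -
      have xM: "x \<in> M" using x A FA_mem by blast
      let ?S = "{y. B y \<noteq> 0 \<and> tgt x = src y}"
      have finS: "finite ?S" using FA_finite[OF B] by simp
      have inj: "inj_on (mul x) ?S"
        by (rule inj_on_inverseI[of _ "mul (inverse_of x)"]) (use xM FA_mem[OF B] mul_inverse_cancel in auto)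
      have "pairing B (\<lambda>y. if tgt x = src y then C (mul x y) else 0) = (\<Sum>y\<in>?S. B y * C (mul x y))"
        unfolding pairing_def by (rule sum.mono_neutral_cong_right) (use FA_finite[OF B] in auto)
      then have "\<bar>pairing B (\<lambda>y. if tgt x = src y then C (mul x y) else 0)\<bar> \<le> (\<Sum>y\<in>?S. \<bar>B y\<bar> * \<bar>C (mul x y)\<bar>)"
        using sum_abs[of "\<lambda>y. B y * C (mul x y)" ?S] by (simp add: abs_mult)
      also have "\<dots> \<le> L2_set B ?S * L2_set (\<lambda>y. C (mul x y)) ?S" by (rule L2_set_mult_ineq)
      also have "\<dots> \<le> fnorm B * fnorm C"
      proof (rule mult_mono)
        show "L2_set B ?S \<le> fnorm B"
          unfolding fnorm_L2_set[OF FA_finite[OF B] subset_refl]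
          by (rule L2_set_subset_mono) (use FA_finite[OF B] in auto)
        have "L2_set (\<lambda>y. C (mul x y)) ?S = L2_set C (mul x ` ?S)"
          unfolding L2_set_def by (simp add: sum.reindex[OF inj])
        also have "\<dots> \<le> L2_set C (mul x ` ?S \<union> supp C)"
          by (rule L2_set_subset_mono) (use finS FA_finite[OF C] in auto)
        also have "\<dots> = fnorm C"
          by (rule fnorm_L2_set[symmetric]) (use finS FA_finite[OF C] in auto)
        finally show "L2_set (\<lambda>y. C (mul x y)) ?S \<le> fnorm C" .
      qed (auto simp: fnorm_nonneg)
      finally have "\<bar>A x\<bar> * \<bar>pairing B (\<lambda>y. if tgt x = src y then C (mul x y) else 0)\<bar> \<le> \<bar>A x\<bar> * (fnorm B * fnorm C)"
        by (rule mult_left_mono) simp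
      then show ?thesis by (simp flip: abs_mult)
    qed
    then show ?thesis
      unfolding pairing_conv[OF A B] unfolding pairing_def[of A] sum_distrib_right
      by (intro sum_mono) simp
  qed
  have "(fnorm (conv A B))\<^sup>2 \<le> ?K * fnorm B * fnorm (conv A B)"
    using le[OF FA_conv[OF A B]] by (simp add: fnorm_square mult.assoc)
  then show "fnorm (conv A B) \<le> ?K * fnorm B"
    using fnorm_nonneg[of "conv A B"] fnorm_nonneg[of B] \<open>?K \<ge> 0\<close>
    by (cases "fnorm (conv A B) = 0") (auto simp: power2_eq_square)
qed

lemma conv_diff_right: "conv A (\<lambda>x. B x - C x) = (\<lambda>x. conv A B x - conv A C x)"
  by (rule ext) (simp add: conv_def right_diff_distrib sum_subtractf)

lemma conv_add_scale_right: "conv A (\<lambda>x. B x + t * C x) = (\<lambda>x. conv A B x + t * conv A C x)"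
  by (rule ext) (simp add: conv_def distrib_left sum.distrib sum_distrib_left mult_ac)

lemma star_diff: "star (\<lambda>x. B x - C x) = (\<lambda>x. star B x - star C x)"
  by (rule ext) (simp add: star_def)

text \<open>The value at the vertex t = -b/a gives the discriminant inequality. It will convert
  near-minimality of a distance into near-orthogonality.\<close>

lemma quadratic_nonneg_bound:
  fixes a b c :: real
  assumes "a \<ge> 0" "c \<ge> 0" "\<And>t. a * t\<^sup>2 + 2 * b * t + c \<ge> 0" "a = 0 \<Longrightarrow> b = 0"
  shows "\<bar>b\<bar> \<le> sqrt c * sqrt a"
proof (cases "a = 0")
  case False
  then have "a > 0" using assms(1) by simp
  have "a * (- b / a)\<^sup>2 + 2 * b * (- b / a) + c = c - b\<^sup>2 / a"
    using \<open>a > 0\<close> by (simp add: field_simps power2_eq_square)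
  then have "b\<^sup>2 / a \<le> c" using assms(3)[of "- b / a"] by simp
  then have "b\<^sup>2 \<le> c * a" using \<open>a > 0\<close> by (simp add: field_simps)
  then have "sqrt (b\<^sup>2) \<le> sqrt (c * a)" by (rule real_sqrt_le_mono)
  then show ?thesis by (simp add: real_sqrt_mult)
qed (use assms in auto)

text \<open>Kaplansky's theorem. If \<open>p = e x\<close> nearly minimises the distance from \<open>e FA\<close> to the unit, then
  \<open>p\<close> is nearly the orthogonal projection onto \<open>e FA\<close>, so its trace is nearly both \<open>\<parallel>p\<parallel>\<^sup>2\<close> and the
  trace of \<open>e\<close>.\<close>

theorem idempotent_trace_zero:
  assumes e: "e \<in> FA" "conv e e = e" "pairing e unit_fun = 0"
  shows "e = (\<lambda>x. 0)"
proof -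
  let ?I = unit_fun
  note I = FA_unit_fun
  define N where "N A = pairing A A" for A :: "'x \<Rightarrow> real"
  define D where "D x = (\<lambda>u. conv e x u - ?I u)" for x
  have D_FA: "D x \<in> FA" if "x \<in> FA" for x
    unfolding D_def using that e I by (intro FA_diff FA_conv)
  \<comment> \<open>The finitely supported functions need not be complete in the 2-norm, so no
    minimiser is claimed: x only comes close to the infimum, and the error \<eta> tends to 0 at the
    end.\<close>
  define d where "d = Inf ((\<lambda>x. N (D x)) ` FA)"
  have bdd: "bdd_below ((\<lambda>x. N (D x)) ` FA)"
    by (rule bdd_belowI[of _ 0]) (auto simp: N_def pairing_self_nonneg)
  have d_le: "d \<le> N (D x)" if "x \<in> FA" for x
    unfolding d_def using that bdd by (intro cInf_lower) auto
  obtain k1 where k1: "k1 \<ge> 0" "\<And>B. B \<in> FA \<Longrightarrow> fnorm (conv e B) \<le> k1 * fnorm B"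
    using conv_bounded[OF e(1)] by blast
  obtain k2 where k2: "k2 \<ge> 0" "\<And>B. B \<in> FA \<Longrightarrow> fnorm (conv (star e) B) \<le> k2 * fnorm B"
    using conv_bounded[OF FA_star[OF e(1)]] by blast
  define k where "k = max k1 k2"
  have k: "k \<ge> 0" using k1 by (simp add: k_def)
  have k_e: "fnorm (conv e B) \<le> k * fnorm B" and k_se: "fnorm (conv (star e) B) \<le> k * fnorm B"
    if "B \<in> FA" for B
    using k1(2)[OF that] k2(2)[OF that] mult_right_mono[OF _ fnorm_nonneg[of B], of k1 k]
      mult_right_mono[OF _ fnorm_nonneg[of B], of k2 k] unfolding k_def by force+
  \<comment> \<open>For \<eta> at most 1, c bounds the norm of p, and R collects the constants in
    the estimate \<open>pairing p p\<close> \<le> \<eta> R.\<close>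
  define c where "c = sqrt (N (D ?I) + 1) + fnorm ?I"
  define R where "R = fnorm e + 2 * (k * c * k) + c"
  have main: "fnorm e \<le> k * sqrt (\<eta> * R) + \<eta> * k" if \<eta>: "0 < \<eta>" "\<eta> \<le> 1" for \<eta>
  proof -
    have "Inf ((\<lambda>x. N (D x)) ` FA) < d + \<eta>\<^sup>2" using \<eta> by (simp add: d_def)
    then obtain x where x: "x \<in> FA" "N (D x) < d + \<eta>\<^sup>2"
      using bdd I by (subst (asm) cInf_less_iff) auto
    define p where "p = conv e x"
    have p: "p \<in> FA" unfolding p_def using e x by (intro FA_conv)
    have ep: "conv e p = p" unfolding p_def using e x conv_assoc by metis
    let ?D = "D x"
    have DF: "?D \<in> FA" using D_FA x by blast
    have p_eq: "p = (\<lambda>u. ?D u + ?I u)" by (simp add: D_def p_def)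
    \<comment> \<open>Moving x in the direction y cannot lower the squared distance by more than
      \<eta> squared. The discriminant of this quadratic in t bounds the inner product to first
      order in \<eta>, which is why the tolerance was chosen as a square.\<close>
    have near: "\<bar>pairing (conv e y) ?D\<bar> \<le> \<eta> * fnorm (conv e y)" if y: "y \<in> FA" for y
    proof -
      let ?w = "conv e y"
      have w: "?w \<in> FA" using e y FA_conv by blast
      have quad: "N ?w * t\<^sup>2 + 2 * pairing ?w ?D * t + \<eta>\<^sup>2 \<ge> 0" for t
      proof -
        have xy: "(\<lambda>u. x u + t * y u) \<in> FA" using x y by (intro FA_add FA_scale)
        have eq: "D (\<lambda>u. x u + t * y u) = (\<lambda>u. ?D u + t * ?w u)"
          by (rule ext) (simp add: D_def conv_add_scale_right)
        have tw: "(\<lambda>u. t * ?w u) \<in> FA" using w by (rule FA_scale)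
        have S: "finite ({u. ?D u \<noteq> 0} \<union> {u. ?w u \<noteq> 0})" (is "finite ?S") using DF w FA_finite by simp
        have "N (\<lambda>u. ?D u + t * ?w u) = (\<Sum>u\<in>?S. (?D u + t * ?w u) * (?D u + t * ?w u))"
          unfolding N_def by (rule pairing_superset[OF S]) auto
        also have "\<dots> = (\<Sum>u\<in>?S. ?D u * ?D u) + 2 * t * (\<Sum>u\<in>?S. ?w u * ?D u) + t\<^sup>2 * (\<Sum>u\<in>?S. ?w u * ?w u)"
          by (simp add: sum.distrib[symmetric] sum_distrib_left algebra_simps power2_eq_square)
        also have "\<dots> = N ?D + 2 * t * pairing ?w ?D + t\<^sup>2 * N ?w"
          unfolding N_def pairing_superset[OF S Un_upper1] pairing_superset[OF S Un_upper2] ..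
        finally have "d \<le> N ?D + 2 * t * pairing ?w ?D + t\<^sup>2 * N ?w" using d_le[OF xy] eq by simp
        then show ?thesis using x(2) by (simp add: algebra_simps)
      qed
      have "\<bar>pairing ?w ?D\<bar> \<le> sqrt (\<eta>\<^sup>2) * sqrt (N ?w)"
      proof (rule quadratic_nonneg_bound[OF _ _ quad])
        assume "N ?w = 0"
        then have "?w = (\<lambda>u. 0)" using fnorm_eq_0[OF w] by (simp add: fnorm_def N_def)
        then show "pairing ?w ?D = 0" by (simp add: pairing_def)
      qed (auto simp: N_def pairing_self_nonneg)
      then show ?thesis using \<eta> by (simp add: fnorm_def N_def)
    qed
    \<comment> \<open>z measures how far p - 1 is from being orthogonal to the range of e; testing
      near-orthogonality against e z bounds its norm by \<eta> k.\<close>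
    define z where "z = conv (star e) ?D"
    have z: "z \<in> FA" unfolding z_def using FA_conv FA_star e DF by blast
    have "(fnorm z)\<^sup>2 = pairing ?D (conv e z)"
      unfolding fnorm_square using pairing_conv_left[OF FA_star[OF e(1)] DF z] star_star[OF e(1)]
      by (simp add: z_def)
    also have "\<dots> = pairing (conv e z) ?D"
      by (rule pairing_sym) (use DF z e FA_conv FA_finite in auto)
    also have "\<dots> \<le> \<eta> * (k * fnorm z)"
      using near[OF z] k_e[OF z] \<eta> mult_left_mono[of "fnorm (conv e z)" "k * fnorm z" \<eta>] by linarith
    finally have z_norm: "fnorm z \<le> \<eta> * k"
      using fnorm_nonneg[of z] \<eta> k by (cases "fnorm z = 0") (auto simp: power2_eq_square)
    have "\<eta>\<^sup>2 \<le> 1" using \<eta> by (simp add: power_le_one)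
    then have "N ?D \<le> N (D ?I) + 1" using x(2) d_le[OF I] by linarith
    then have "fnorm ?D \<le> sqrt (N (D ?I) + 1)" unfolding fnorm_def N_def by (rule real_sqrt_le_mono)
    then have p_norm: "fnorm p \<le> c"
      using fnorm_triangle[OF DF I] unfolding p_eq[symmetric] c_def by linarith
    have D_right: "pairing a ?D = pairing a p - pairing a ?I" if "a \<in> FA" for a
      unfolding D_def p_def[symmetric] by (rule pairing_diff_right)
    have 3: "pairing p p \<le> pairing p ?I + \<eta> * c"
    proof -
      have "pairing p ?D \<le> \<eta> * fnorm p" using near[OF x(1)] unfolding p_def by linarith
      also have "\<dots> \<le> \<eta> * c" using p_norm \<eta> by simp
      finally show ?thesis using D_right[OF p] by simp
    qed
    \<comment> \<open>Because e p = p, the trace of p is an inner product with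
      \<open>star e\<close>. What is controlled is the product with e itself, which is close to the
      trace of e; the self-adjointness of p up to a small error has to bridge the two.\<close>
    have 4: "pairing p ?I = pairing (star e) p"
    proof -
      have "pairing p ?I = pairing (conv e p) ?I" using ep by simp
      also have "\<dots> = pairing p (conv (star e) ?I)" by (rule pairing_conv_left[OF e(1) p I])
      also have "\<dots> = pairing p (star e)" using conv_unit FA_star e by simp
      also have "\<dots> = pairing (star e) p" by (rule pairing_sym) (use p e FA_star FA_finite in auto)
      finally show ?thesis .
    qed
    have 5: "pairing e p \<le> \<eta> * fnorm e"
    proof -
      have "pairing e ?D \<le> \<eta> * fnorm e" using near[OF I] conv_unit[OF e(1)] by simp
      then show ?thesis using D_right[OF e(1)] e(3) by simp
    qed
    have pp: "conv (star p) p \<in> FA" using p FA_conv FA_star by blast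
    have star_pp: "star (conv (star p) p) = conv (star p) p" using p by (simp add: star_conv FA_star star_star)
    \<comment> \<open>Here \<open>star z\<close> is \<open>star ?D\<close> times e, and e p = p
      absorbs the factor e. What remains is the difference of \<open>conv (star p) p\<close> and p,
      so p is self-adjoint up to this small error.\<close>
    have "conv (star z) p = conv (star ?D) p"
      unfolding z_def using e DF p ep by (simp add: star_conv FA_star star_star conv_assoc)
    also have "\<dots> = star (conv (star p) ?D)" using DF p by (simp add: star_conv FA_star star_star)
    also have "\<dots> = star (\<lambda>u. conv (star p) p u - star p u)"
      unfolding D_def p_def[symmetric] conv_diff_right conv_unit[OF FA_star[OF p]] ..
    also have "\<dots> = (\<lambda>u. conv (star p) p u - p u)"
      unfolding star_diff star_pp star_star[OF p] ..
    finally have zp: "conv (star z) p = (\<lambda>u. conv (star p) p u - p u)" .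
    \<comment> \<open>This is applied to a = e and to a = \<open>star e\<close>. As
      \<open>conv (star p) p\<close> is self-adjoint it pairs equally with both, and so the pairings
      of p with e and with \<open>star e\<close> are close.\<close>
    have 6: "\<bar>pairing a (conv (star p) p) - pairing a p\<bar> \<le> k * c * k * \<eta>"
      if a: "a \<in> FA" "\<And>B. B \<in> FA \<Longrightarrow> fnorm (conv a B) \<le> k * fnorm B" for a
    proof -
      have "pairing a (conv (star p) p) - pairing a p = pairing a (conv (star z) p)"
        unfolding zp by (rule pairing_diff_right[symmetric])
      also have "\<dots> = pairing (conv a (star p)) (star z)"
        using pairing_conv_right[of a "star p" "star z"] a p z by (simp add: FA_star star_star)
      finally have "\<bar>pairing a (conv (star p) p) - pairing a p\<bar> \<le> fnorm (conv a (star p)) * fnorm (star z)"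
        using pairing_Cauchy_Schwarz[of "conv a (star p)" "star z"] a p z by (simp add: FA_star FA_conv)
      also have "\<dots> \<le> (k * c) * (\<eta> * k)"
      proof (rule mult_mono)
        show "fnorm (conv a (star p)) \<le> k * c"
          using a(2)[OF FA_star[OF p]] p_norm mult_left_mono[OF p_norm k] by (simp add: fnorm_star p)
        show "fnorm (star z) \<le> \<eta> * k" using z_norm by (simp add: fnorm_star z)
        show "0 \<le> k * c" using k p_norm fnorm_nonneg[of p] by simp
      qed (rule fnorm_nonneg)
      finally show ?thesis by (simp add: mult_ac)
    qed
    have 7: "pairing (star e) (conv (star p) p) = pairing e (conv (star p) p)"
      using pairing_star_star[OF e(1) pp] star_pp by simp
    have "pairing (star e) p \<le> pairing e p + 2 * (k * c * k * \<eta>)"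
      using 6[OF e(1) k_e] 6[OF FA_star[OF e(1)] k_se] 7 by linarith
    then have "pairing p p \<le> \<eta> * fnorm e + 2 * (k * c * k * \<eta>) + \<eta> * c"
      using 3 4 5 by linarith
    then have "pairing p p \<le> \<eta> * R" unfolding R_def by (simp add: algebra_simps)
    then have p_small: "fnorm p \<le> sqrt (\<eta> * R)" unfolding fnorm_def by (rule real_sqrt_le_mono)
    \<comment> \<open>Solved for \<open>star e\<close>, this bounds the norm of e by k times that of
      p plus that of z, and both are now small.\<close>
    have "z = (\<lambda>u. conv (star e) p u - star e u)"
      unfolding z_def D_def p_def[symmetric] conv_diff_right conv_unit[OF FA_star[OF e(1)]] ..
    then have e_eq: "star e = (\<lambda>u. conv (star e) p u + (- 1) * z u)" by (simp add: fun_eq_iff)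
    have "fnorm (\<lambda>u. conv (star e) p u + (- 1) * z u) \<le> fnorm (conv (star e) p) + fnorm (\<lambda>u. (- 1) * z u)"
      using e p z by (intro fnorm_triangle FA_conv FA_star FA_scale)
    moreover have "fnorm (\<lambda>u. (- 1) * z u) = fnorm z" by (simp add: fnorm_def pairing_def)
    ultimately have "fnorm e \<le> fnorm (conv (star e) p) + fnorm z"
      unfolding e_eq[symmetric] by (simp add: fnorm_star e)
    also have "\<dots> \<le> k * sqrt (\<eta> * R) + \<eta> * k"
      using k_se[OF p] mult_left_mono[OF p_small k] z_norm by linarith
    finally show ?thesis .
  qed
  have "((\<lambda>\<eta>. k * sqrt (\<eta> * R) + \<eta> * k) \<longlongrightarrow> k * sqrt (0 * R) + 0 * k) (at_right 0)"
    by (intro tendsto_intros)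
  moreover have "eventually (\<lambda>\<eta>. fnorm e \<le> k * sqrt (\<eta> * R) + \<eta> * k) (at_right (0::real))"
    unfolding eventually_at_right_field using main by (intro exI[of _ 1]) auto
  ultimately have "fnorm e \<le> k * sqrt (0 * R) + 0 * k"
    by (rule tendsto_lowerbound) simp
  then have "fnorm e = 0" using fnorm_nonneg[of e] by simp
  then show ?thesis using fnorm_eq_0 e by blast
qed

end

subsection \<open>Traces of idempotents on non-divisible classes\<close>

text \<open>Every cycle of f on W has a length p^j dividing p^k but not p^s, hence a multiple of
  p^s. As c is constant on a cycle, each cycle contributes a multiple of p^s; cycles are removed one
  by one.\<close>

lemma sum_dvd_if_no_short_periods:
  fixes c :: "'a \<Rightarrow> int"
  assumes "finite W" "prime p"
    and "\<And>w. w \<in> W \<Longrightarrow> f w \<in> W"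
    and "\<And>w. w \<in> W \<Longrightarrow> (f ^^ (p ^ k)) w = w"
    and "\<And>w. w \<in> W \<Longrightarrow> (f ^^ (p ^ s)) w \<noteq> w"
    and "\<And>w. w \<in> W \<Longrightarrow> c (f w) = c w"
  shows "int (p ^ s) dvd (\<Sum>w\<in>W. c w)"
  using assms
proof (induction "card W" arbitrary: W rule: less_induct)
  case less
  note prems = less.prems
  show ?case
  proof (cases "W = {}")
    case False
    then obtain w where w: "w \<in> W" by blast
    have iter_W: "(f ^^ i) v \<in> W" if "v \<in> W" for i v using that prems(3) by (induction i) auto
    have iter_c: "c ((f ^^ i) v) = c v" if "v \<in> W" for i v
      using that iter_W prems(6) by (induction i) auto
    define P where "P n \<longleftrightarrow> n > 0 \<and> (f ^^ n) w = w" for n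
    define d where "d = (LEAST n. P n)"
    have "P (p ^ k)" using prems(2) w prems(4) by (simp add: P_def prime_gt_0_nat)
    then have d: "d > 0" "(f ^^ d) w = w" using LeastI[of P] unfolding d_def P_def by blast+
    have d_min: "\<not> P n" if "n < d" for n using that not_less_Least unfolding d_def by blast
    have mult_d: "(f ^^ (d * q)) w = w" for q
      by (induction q) (simp_all add: funpow_add d(2))
    have iter_mod: "(f ^^ n) w = (f ^^ (n mod d)) w" for n
    proof -
      have "(f ^^ n) w = (f ^^ (n mod d + d * (n div d))) w" by simp
      then show ?thesis unfolding funpow_add o_apply mult_d .
    qed
    have dvd_iff: "(f ^^ n) w = w \<longleftrightarrow> d dvd n" for n
    proof
      assume "(f ^^ n) w = w"
      then have "\<not> n mod d > 0" using d_min[of "n mod d"] d(1) iter_mod[of n] by (auto simp: P_def)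
      then show "d dvd n" by auto
    qed (auto simp: mult_d)
    obtain j where j: "d = p ^ j" "j \<le> k"
      using dvd_iff[of "p ^ k"] prems(4)[OF w] divides_primepow_nat[OF prems(2)] by blast
    have "\<not> d dvd p ^ s" using prems(5)[OF w] dvd_iff by blast
    then have "s \<le> j" using j(1) le_imp_power_dvd by (metis nat_le_linear)
    then have s_d: "int (p ^ s) dvd int d" using j(1) le_imp_power_dvd by fastforce
    define O' where "O' = (\<lambda>i. (f ^^ i) w) ` {..<d}"
    have O_iff: "(f ^^ n) w \<in> O'" for n
      unfolding O'_def by (subst iter_mod) (use d(1) in auto)
    have inj: "inj_on (\<lambda>i. (f ^^ i) w) {..<d}"
    proof (rule linorder_inj_onI)
      fix i j assume ij: "i < j" "i \<in> {..<d}" "j \<in> {..<d}"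
      show "(f ^^ i) w \<noteq> (f ^^ j) w"
      proof
        assume "(f ^^ i) w = (f ^^ j) w"
        then have "(f ^^ (d - j)) ((f ^^ i) w) = (f ^^ (d - j)) ((f ^^ j) w)" by simp
        then have "(f ^^ (d - j + i)) w = (f ^^ (d - j + j)) w" by (simp only: funpow_add o_apply)
        moreover have "d - j + j = d" using ij by simp
        ultimately have "d dvd d - j + i" using d(2) dvd_iff by metis
        then show False using ij by (auto dest: dvd_imp_le)
      qed
    qed auto
    have O_W: "O' \<subseteq> W" using iter_W w by (auto simp: O'_def)
    have "(\<Sum>v\<in>O'. c v) = (\<Sum>i<d. c w)"
      unfolding O'_def using iter_c[OF w] by (simp add: sum.reindex[OF inj])
    then have 1: "int (p ^ s) dvd (\<Sum>v\<in>O'. c v)" using s_d by simp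
    have "w \<in> O'" using O_iff[of 0] by simp
    then have "card (W - O') < card W" using w prems(1) by (intro psubset_card_mono) auto
    moreover have "f v \<in> W - O'" if v: "v \<in> W - O'" for v
    proof -
      \<comment> \<open>On W the map f has the inverse f^(p^k - 1), so a point whose image lies on
        the cycle lies on it as well.\<close>
      have "f v \<notin> O'"
      proof
        assume "f v \<in> O'"
        then obtain i where i: "f v = (f ^^ i) w" by (auto simp: O'_def)
        have pk: "Suc (p ^ k - 1) = p ^ k" using prems(2) by (simp add: prime_gt_0_nat)
        have "v = (f ^^ Suc (p ^ k - 1)) v" unfolding pk using prems(4) v by simp
        also have "\<dots> = (f ^^ (p ^ k - 1)) (f v)" by (simp only: funpow_Suc_right o_apply)
        also have "\<dots> = (f ^^ (p ^ k - 1 + i)) w" unfolding i funpow_add o_apply ..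
        finally show False using O_iff v by auto
      qed
      then show ?thesis using prems(3) v by blast
    qed
    ultimately have 2: "int (p ^ s) dvd (\<Sum>v\<in>W - O'. c v)"
      using prems by (intro less.hyps) auto
    have "(\<Sum>v\<in>W. c v) = (\<Sum>v\<in>W - O'. c v) + (\<Sum>v\<in>O'. c v)"
      using O_W prems(1) by (rule sum.subset_diff)
    then show ?thesis using 1 2 by simp
  qed simp
qed

section \<open>Words of composable arrows, their products and their rotations\<close>

context groupoid
begin

text \<open>In a groupoid with several objects the empty word has no distinguished product, and
  \<open>composable\<close> excludes it.\<close>

fun word_prod :: "'x list \<Rightarrow> 'x" where
  "word_prod [] = undefined"
| "word_prod [x] = x"
| "word_prod (x # y # w) = mul x (word_prod (y # w))"

definition composable :: "'x list \<Rightarrow> bool" where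
  "composable w \<longleftrightarrow> w \<noteq> [] \<and> set w \<subseteq> M \<and> successively (\<lambda>x y. tgt x = src y) w"

lemma composable_single [simp]: "composable [x] \<longleftrightarrow> x \<in> M"
  by (simp add: composable_def)

lemma composable_Cons: "w \<noteq> [] \<Longrightarrow> composable (x # w) \<longleftrightarrow> x \<in> M \<and> tgt x = src (hd w) \<and> composable w"
  by (auto simp: composable_def successively_Cons)

lemma composable_append: "u \<noteq> [] \<Longrightarrow> v \<noteq> [] \<Longrightarrow>
    composable (u @ v) \<longleftrightarrow> composable u \<and> composable v \<and> tgt (last u) = src (hd v)"
  by (auto simp: composable_def successively_append_iff)

lemma word_prod_props:
  "composable w \<Longrightarrow> word_prod w \<in> M \<and> src (word_prod w) = src (hd w) \<and> tgt (word_prod w) = tgt (last w)"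
proof (induction w rule: word_prod.induct)
  case (3 x y w)
  then have c: "x \<in> M" "tgt x = src y" "composable (y # w)" by (simp_all add: composable_Cons)
  then show ?case using 3(1) by (simp add: mul_closed src_mul tgt_mul)
qed (simp_all add: composable_def)

lemma word_prod_Cons: "w \<noteq> [] \<Longrightarrow> word_prod (x # w) = mul x (word_prod w)"
  by (cases w) simp_all

lemma word_prod_append:
  "u \<noteq> [] \<Longrightarrow> v \<noteq> [] \<Longrightarrow> composable (u @ v) \<Longrightarrow> word_prod (u @ v) = mul (word_prod u) (word_prod v)"
proof (induction u)
  case (Cons x u)
  show ?case
  proof (cases "u = []")
    case True
    then show ?thesis using Cons.prems by (simp add: word_prod_Cons)
  next
    case False
    have c: "x \<in> M" "tgt x = src (hd u)" "composable (u @ v)"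
      using Cons.prems False composable_Cons[of "u @ v" x] by auto
    then have uv: "composable u" "composable v" "tgt (last u) = src (hd v)"
      using composable_append[OF False Cons.prems(2)] by auto
    show ?thesis
      using Cons.IH[OF False Cons.prems(2) c(3)] False c uv word_prod_props[of u] word_prod_props[of v]
      by (simp add: word_prod_Cons mul_assoc)
  qed
qed simp

text \<open>All powers of e equal e, so any functional of e is a sum over words of any prescribed
  positive length. This freedom allows lengths that are powers of p, on which rotation acts with
  cycles of p-power length.\<close>

lemma idempotent_word_expansion:
  assumes e: "e \<in> FA" "conv e e = e"
  shows "pairing e \<phi> = (\<Sum>w | set w \<subseteq> supp e \<and> length w = Suc n.
      prod_list (map e w) * (if composable w then \<phi> (word_prod w) else 0))"
proof (induction n arbitrary: \<phi>)
  case 0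
  have "pairing e \<phi> = (\<Sum>w\<in>(\<lambda>x. [x]) ` (supp e). prod_list (map e w) * (if composable w then \<phi> (word_prod w) else 0))"
    unfolding pairing_def by (subst sum.reindex) (auto simp: inj_on_def FA_mem[OF e(1)])
  also have "(\<lambda>x. [x]) ` (supp e) = {w. set w \<subseteq> supp e \<and> length w = Suc 0}"
    by (auto simp: length_Suc_conv)
  finally show ?case .
next
  case (Suc n)
  let ?S = "supp e"
  let ?W = "\<lambda>n. {w. set w \<subseteq> ?S \<and> length w = n}"
  let ?t = "\<lambda>w. prod_list (map e w) * (if composable w then \<phi> (word_prod w) else 0)"
  have "pairing e \<phi> = pairing e (\<lambda>x. pairing e (\<lambda>y. if tgt x = src y then \<phi> (mul x y) else 0))"
    using pairing_conv[OF e(1,1), of \<phi>] e(2) by simp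
  also have "\<dots> = (\<Sum>x\<in>?S. e x * pairing e (\<lambda>y. if tgt x = src y then \<phi> (mul x y) else 0))"
    unfolding pairing_def[of e "\<lambda>x. pairing e (\<lambda>y. if tgt x = src y then \<phi> (mul x y) else 0)"] ..
  also have "\<dots> = (\<Sum>x\<in>?S. e x * (\<Sum>w\<in>?W (Suc n). prod_list (map e w) *
      (if composable w then (if tgt x = src (word_prod w) then \<phi> (mul x (word_prod w)) else 0) else 0)))"
    by (simp only: Suc.IH)
  also have "\<dots> = (\<Sum>x\<in>?S. \<Sum>w\<in>?W (Suc n). ?t (x # w))"
    unfolding sum_distrib_left
  proof (intro sum.cong refl)
    fix x w assume x: "x \<in> ?S" and w: "w \<in> ?W (Suc n)"
    then have "w \<noteq> []" "x \<in> M" using FA_mem[OF e(1)] by auto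
    then show "e x * (prod_list (map e w) *
      (if composable w then (if tgt x = src (word_prod w) then \<phi> (mul x (word_prod w)) else 0) else 0)) = ?t (x # w)"
      using word_prod_props[of w] by (auto simp: composable_Cons word_prod_Cons mult.assoc)
  qed
  also have "\<dots> = (\<Sum>(x, w)\<in>?S \<times> ?W (Suc n). ?t (x # w))"
    by (rule sum.cartesian_product)
  also have "\<dots> = (\<Sum>w\<in>(\<lambda>(x, w). x # w) ` (?S \<times> ?W (Suc n)). ?t w)"
    by (subst sum.reindex) (auto simp: inj_on_def intro!: sum.cong)
  also have "(\<lambda>(x, w). x # w) ` (?S \<times> ?W (Suc n)) = ?W (Suc (Suc n))"
    by (force simp: length_Suc_conv)
  finally show ?case .
qed

definition loop_power :: "'x \<Rightarrow> nat \<Rightarrow> 'x" where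
  "loop_power x n = word_prod (replicate n x)"

lemma composable_replicate:
  assumes "composable u" "tgt (last u) = src (hd u)"
  shows "composable (concat (replicate (Suc n) u)) \<and>
    word_prod (concat (replicate (Suc n) u)) = loop_power (word_prod u) (Suc n)"
proof (induction n)
  case (Suc n)
  let ?v = "concat (replicate (Suc n) u)"
  have ne: "u \<noteq> []" using assms by (simp add: composable_def)
  then have v: "?v \<noteq> []" "hd ?v = hd u" by simp_all
  have "composable (u @ ?v)" using Suc assms v ne composable_append[OF ne v(1)] by metis
  moreover from this have "word_prod (u @ ?v) = mul (word_prod u) (loop_power (word_prod u) (Suc n))"
    using word_prod_append[OF ne v(1)] Suc by metis
  ultimately show ?case by (simp add: loop_power_def word_prod_Cons)
qed (use assms in \<open>simp add: loop_power_def\<close>)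

lemma last_concat_replicate: "u \<noteq> [] \<Longrightarrow> last (concat (replicate (Suc n) u)) = last u"
  by (induction n) simp_all

text \<open>Split w = a b with a of length m. Invariance says b a = a b, so b starts with a again
  and is itself invariant under rotation by m; the induction continues with b.\<close>

lemma rotate_fixed_concat:
  assumes "rotate m w = w" "length w = m * q" "m > 0"
  shows "w = concat (replicate q (take m w))"
  using assms
proof (induction q arbitrary: w)
  case (Suc q)
  show ?case
  proof (cases q)
    case 0
    then show ?thesis using Suc.prems by simp
  next
    case (Suc r)
    define a b where "a = take m w" and "b = drop m w"
    have w: "w = a @ b" "length a = m" "length b = m * q"
      using Suc.prems by (auto simp: a_def b_def)
    have "b @ a = a @ b" using Suc.prems(1) w rotate_append[of a b] by simp
    have lb: "length b \<ge> m" using w(3) Suc by simp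
    have ta: "take m b = a"
      using arg_cong[OF \<open>b @ a = a @ b\<close>, of "take m"] lb w(2) by simp
    then have b: "b = a @ drop m b" by (metis append_take_drop_id)
    have "a @ (drop m b @ a) = a @ b" using \<open>b @ a = a @ b\<close> b by (metis append.assoc)
    then have "drop m b @ a = b" by simp
    moreover have "rotate m (a @ drop m b) = drop m b @ a"
      unfolding w(2)[symmetric] by (rule rotate_append)
    ultimately have "rotate m b = b" using b by metis
    from Suc.IH[OF this w(3) Suc.prems(3)] have "b = concat (replicate q a)" unfolding ta .
    then show ?thesis using w(1) unfolding a_def[symmetric] by simp
  qed
qed simp

text \<open>Moving the first letter x of a closed word to the end turns a product x y into y x, so a
  property invariant under this exchange survives rotation. The last disjunct covers one-letter
  words, which rotation leaves unchanged.\<close>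

lemma rotate1_composable:
  assumes "composable w" "tgt (last w) = src (hd w)"
  shows "composable (rotate1 w) \<and> tgt (last (rotate1 w)) = src (hd (rotate1 w)) \<and>
    (\<exists>x\<in>M. \<exists>y\<in>M. tgt x = src y \<and> tgt y = src x \<and> word_prod w = mul x y \<and> word_prod (rotate1 w) = mul y x)
    \<or> (\<exists>x. w = [x])"
proof -
  obtain x u where w: "w = x # u" using assms(1) by (cases w) (auto simp: composable_def)
  show ?thesis
  proof (cases "u = []")
    case False
    have c: "x \<in> M" "tgt x = src (hd u)" "composable u" "tgt (last u) = src x"
      using assms False unfolding w by (auto simp: composable_Cons)
    have cr: "composable (u @ [x])" using c False composable_append[OF False, of "[x]"] by simp
    moreover have "word_prod (u @ [x]) = mul (word_prod u) x"
      using word_prod_append[OF False _ cr] by simp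
    ultimately show ?thesis
      using c False word_prod_props[OF c(3)] unfolding w
      by (intro disjI1 conjI bexI[of _ x] bexI[of _ "word_prod u"]) (simp_all add: word_prod_Cons)
  qed (use w in simp)
qed

text \<open>Rotation acts on the closed words of length p^(j+m) whose product satisfies P. A word
  with period p^j would have the p^m-th power of a loop as its product, which \<open>no_root\<close>
  forbids; so all cycles are long and the integer in question is divisible by p^j, for every
  j.\<close>

proposition idempotent_class_sum_zero:
  assumes e: "e \<in> FA" "conv e e = e" "\<And>x. e x \<in> \<int>"
    and p: "prime (p::nat)"
    and conj: "\<And>x y. x \<in> M \<Longrightarrow> y \<in> M \<Longrightarrow> tgt x = src y \<Longrightarrow> tgt y = src x \<Longrightarrow> P (mul x y) \<Longrightarrow> P (mul y x)"
    and no_root: "\<And>x. x \<in> M \<Longrightarrow> src x = tgt x \<Longrightarrow> \<not> P (loop_power x (p ^ m))"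
  shows "pairing e (\<lambda>x. if src x = tgt x \<and> P x then 1 else 0) = 0"
proof -
  define e' where "e' x = \<lfloor>e x\<rfloor>" for x
  have e': "e x = real_of_int (e' x)" for x using e(3)[of x] by (auto simp: e'_def elim: Ints_cases)
  let ?S = "supp e"
  define \<phi> :: "'x \<Rightarrow> real" where "\<phi> x = (if src x = tgt x \<and> P x then 1 else 0)" for x
  define r where "r = (\<Sum>x\<in>?S. if src x = tgt x \<and> P x then e' x else 0)"
  have r: "pairing e \<phi> = real_of_int r"
    unfolding pairing_def r_def \<phi>_def of_int_sum by (rule sum.cong) (auto simp: e')
  have dvd: "int (p ^ j) dvd r" for j
  proof -
    \<comment> \<open>The factor p^m of the length is used up by the absence of roots; the factor
      p^j is the divisibility gained.\<close>
    define q where "q = p ^ (j + m)"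
    have q0: "q > 0" "q = Suc (q - 1)" using p by (auto simp: q_def prime_gt_0_nat)
    define W where "W = {w. set w \<subseteq> ?S \<and> length w = q \<and> composable w \<and>
        src (word_prod w) = tgt (word_prod w) \<and> P (word_prod w)}"
    define c where "c w = prod_list (map e' w)" for w
    have "finite {w. set w \<subseteq> ?S \<and> length w = q}"
      using FA_finite[OF e(1)] by (rule finite_lists_length_eq)
    then have fin: "finite {w. set w \<subseteq> ?S \<and> length w = q}" "finite W"
      by (auto simp: W_def elim: rev_finite_subset)
    have c: "prod_list (map e w) = real_of_int (c w)" for w
      unfolding c_def by (induction w) (auto simp: e')
    have "pairing e \<phi> = (\<Sum>w | set w \<subseteq> ?S \<and> length w = q.
        prod_list (map e w) * (if composable w then \<phi> (word_prod w) else 0))"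
      using idempotent_word_expansion[OF e(1,2), of \<phi> "q - 1"] q0(2) by simp
    also have "\<dots> = (\<Sum>w\<in>W. real_of_int (c w))"
      by (rule sum.mono_neutral_cong_right) (use fin c in \<open>auto simp: W_def \<phi>_def\<close>)
    finally have r_eq: "r = (\<Sum>w\<in>W. c w)" using r by (simp flip: of_int_sum)
    have ends_w: "tgt (last w) = src (hd w)" if "w \<in> W" for w
      using that word_prod_props[of w] by (auto simp: W_def)
    have rot: "rotate1 w \<in> W" if w: "w \<in> W" for w
    proof -
      have cw: "composable w" using w by (simp add: W_def)
      from rotate1_composable[OF this ends_w[OF w]] show ?thesis
      proof (elim disjE conjE bexE)
        fix x y assume h: "composable (rotate1 w)" "tgt (last (rotate1 w)) = src (hd (rotate1 w))"
          "x \<in> M" "y \<in> M" "tgt x = src y" "tgt y = src x" "word_prod w = mul x y" "word_prod (rotate1 w) = mul y x"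
        have "P (mul y x)" using conj[OF h(3-6)] h(7) w by (simp add: W_def)
        then show ?thesis using w h word_prod_props[OF h(1)] by (simp add: W_def)
      qed (use w in auto)
    qed
    have no_period: "(rotate1 ^^ (p ^ j)) w \<noteq> w" if w: "w \<in> W" for w
    proof
      assume "(rotate1 ^^ (p ^ j)) w = w"
      then have fixed: "rotate (p ^ j) w = w" by (simp add: rotate_def)
      let ?u = "take (p ^ j) w"
      have pm: "p ^ m = Suc (p ^ m - 1)" "p ^ j > 0" using p by (auto simp: prime_gt_0_nat)
      have "w = concat (replicate (p ^ m) ?u)"
        by (rule rotate_fixed_concat[OF fixed]) (use w pm in \<open>auto simp: W_def q_def power_add\<close>)
      then have w_eq: "w = concat (replicate (Suc (p ^ m - 1)) ?u)" using pm(1) by simp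
      have ne: "?u \<noteq> []" "w \<noteq> []" using w pm q0(1) by (auto simp: W_def)
      have cu: "composable ?u"
        using w ne composable_append[of ?u "drop (p ^ j) w"] by (cases "drop (p ^ j) w = []") (auto simp: W_def)
      have "last w = last ?u"
        using arg_cong[OF w_eq, of last] last_concat_replicate[OF ne(1)] by metis
      then have lu: "tgt (last ?u) = src (hd ?u)" using ends_w[OF w] pm(2) ne by (simp add: hd_take)
      have "word_prod w = loop_power (word_prod ?u) (p ^ m)"
        using composable_replicate[OF cu lu, of "p ^ m - 1"] w_eq pm(1) by metis
      then show False
        using no_root[of "word_prod ?u"] word_prod_props[OF cu] lu w by (auto simp: W_def)
    qed
    have "(rotate1 ^^ q) w = w" if "w \<in> W" for w
    proof -
      have "length w = q" using that by (simp add: W_def)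
      then have "rotate q w = w" by (simp add: rotate_id)
      then show ?thesis by (simp add: rotate_def)
    qed
    moreover have "c (rotate1 w) = c w" for w
      unfolding c_def by (cases w) (simp_all add: mult.commute)
    ultimately show ?thesis
      unfolding r_eq using sum_dvd_if_no_short_periods[OF fin(2) p rot, where k = "j + m" and s = j and c = c] no_period
      by (simp add: q_def)
  qed
  have "r = 0"
  proof (rule ccontr)
    assume "r \<noteq> 0"
    \<comment> \<open>Divisibility by p^|r| alone is contradictory, as p^|r| exceeds |r|.\<close>
    then have "int (p ^ nat \<bar>r\<bar>) \<le> \<bar>r\<bar>" using dvd_imp_le_int[OF _ dvd[of "nat \<bar>r\<bar>"]] by linarith
    moreover have "nat \<bar>r\<bar> < p ^ nat \<bar>r\<bar>" using p prime_gt_1_nat by (intro power_gt_expt) auto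
    ultimately show False by linarith
  qed
  then show ?thesis using r unfolding \<phi>_def by simp
qed

end

section \<open>Integral group rings\<close>

lemma sum_fun_apply: "(\<Sum>i\<in>I. f i) x = (\<Sum>i\<in>I. f i x)"
  by (induction I rule: infinite_finite_induct) simp_all

definition aug :: "('g \<Rightarrow> int) \<Rightarrow> int" where
  "aug a = (\<Sum>x | a x \<noteq> 0. a x)"

definition gr_elem :: "'g \<Rightarrow> 'g \<Rightarrow> int" where
  "gr_elem g = (\<lambda>x. if x = g then 1 else 0)"

lemma finite_support_add:
  "finite (supp a) \<Longrightarrow> finite (supp b) \<Longrightarrow> finite {x. (a + b) x \<noteq> (0 :: 'a :: comm_monoid_add)}"
  by (rule finite_subset[of _ "supp a \<union> supp b"]) auto

lemma aug_superset:
  assumes "finite B" "supp a \<subseteq> B"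
  shows "aug a = (\<Sum>x\<in>B. a x)"
  unfolding aug_def by (rule sum.mono_neutral_left[OF assms]) auto

lemma aug_zero [simp]: "aug 0 = 0"
  by (simp add: aug_def)

lemma aug_gr_elem [simp]: "aug (gr_elem g) = 1"
  by (simp add: aug_superset[of "{g}"] gr_elem_def)

context group
begin

lemma gr_zero: "0 \<in> group_ring G"
  by (simp add: group_ring_def)

lemma gr_add: "a \<in> group_ring G \<Longrightarrow> b \<in> group_ring G \<Longrightarrow> a + b \<in> group_ring G"
  using finite_support_add[of a b] unfolding group_ring_def by force

lemma gr_uminus: "a \<in> group_ring G \<Longrightarrow> - a \<in> group_ring G"
  by (simp add: group_ring_def)

lemma gr_diff: "a \<in> group_ring G \<Longrightarrow> b \<in> group_ring G \<Longrightarrow> a - b \<in> group_ring G"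
  using gr_add[of a "- b"] gr_uminus[of b] by simp

lemma gr_elem_closed: "g \<in> carrier G \<Longrightarrow> gr_elem g \<in> group_ring G"
  by (auto simp: group_ring_def gr_elem_def)

lemma gr_sum: "(\<And>i. i \<in> I \<Longrightarrow> f i \<in> group_ring G) \<Longrightarrow> (\<Sum>i\<in>I. f i) \<in> group_ring G"
  by (induction I rule: infinite_finite_induct) (auto intro: gr_zero gr_add)

lemma aug_add: "a \<in> group_ring G \<Longrightarrow> b \<in> group_ring G \<Longrightarrow> aug (a + b) = aug a + aug b"
proof -
  let ?B = "supp a \<union> supp b"
  assume "a \<in> group_ring G" "b \<in> group_ring G"
  then have B: "finite ?B" by (simp add: group_ring_def)
  have "aug (a + b) = (\<Sum>x\<in>?B. (a + b) x)" by (rule aug_superset[OF B]) auto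
  then show ?thesis
    unfolding aug_superset[OF B Un_upper1] aug_superset[OF B Un_upper2] by (simp add: sum.distrib)
qed

lemma aug_uminus: "aug (- a) = - aug a"
  by (simp add: aug_def sum_negf)

lemma aug_diff: "a \<in> group_ring G \<Longrightarrow> b \<in> group_ring G \<Longrightarrow> aug (a - b) = aug a - aug b"
  using aug_add[of a "- b"] gr_uminus[of b] by (simp add: aug_uminus)

lemma aug_sum: "(\<And>i. i \<in> I \<Longrightarrow> f i \<in> group_ring G) \<Longrightarrow> aug (\<Sum>i\<in>I. f i) = (\<Sum>i\<in>I. aug (f i))"
  by (induction I rule: infinite_finite_induct) (auto simp: aug_add gr_sum)

lemma gr_mult_superset:
  assumes "finite B" "supp a \<subseteq> B"
  shows "gr_mult G a b = (\<lambda>g. if g \<in> carrier G then \<Sum>h\<in>B. a h * b (inv h \<otimes> g) else 0)"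
proof -
  have "(\<Sum>h | a h \<noteq> 0. a h * b (inv h \<otimes> g)) = (\<Sum>h\<in>B. a h * b (inv h \<otimes> g))" for g
    by (rule sum.mono_neutral_left[OF assms]) auto
  then show ?thesis by (simp add: gr_mult_def fun_eq_iff)
qed

lemma gr_mult_add_left:
  assumes "a \<in> group_ring G" "b \<in> group_ring G"
  shows "gr_mult G (a + b) c = gr_mult G a c + gr_mult G b c"
proof -
  let ?B = "supp a \<union> supp b"
  have B: "finite ?B" using assms by (simp add: group_ring_def)
  have "gr_mult G (a + b) c = (\<lambda>g. if g \<in> carrier G then \<Sum>h\<in>?B. (a + b) h * c (inv h \<otimes> g) else 0)"
    by (rule gr_mult_superset[OF B]) auto
  then show ?thesis
    using gr_mult_superset[OF B Un_upper1] gr_mult_superset[OF B Un_upper2]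
    by (simp add: fun_eq_iff distrib_right sum.distrib)
qed

lemma gr_mult_add_right: "gr_mult G c (a + b) = gr_mult G c a + gr_mult G c b"
  by (simp add: gr_mult_def fun_eq_iff distrib_left sum.distrib)

lemma gr_mult_zero_left [simp]: "gr_mult G 0 c = 0"
  and gr_mult_zero_right [simp]: "gr_mult G c 0 = 0"
  by (simp_all add: gr_mult_def fun_eq_iff)

lemma gr_mult_uminus_left: "gr_mult G (- a) c = - gr_mult G a c"
  and gr_mult_uminus_right: "gr_mult G c (- a) = - gr_mult G c a"
  by (simp_all add: gr_mult_def fun_eq_iff sum_negf)

lemma gr_mult_diff_left:
  "a \<in> group_ring G \<Longrightarrow> b \<in> group_ring G \<Longrightarrow> gr_mult G (a - b) c = gr_mult G a c - gr_mult G b c"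
  using gr_mult_add_left[of a "- b" c] gr_uminus[of b] by (simp add: gr_mult_uminus_left)

lemma gr_mult_diff_right: "gr_mult G c (a - b) = gr_mult G c a - gr_mult G c b"
  using gr_mult_add_right[of c a "- b"] by (simp add: gr_mult_uminus_right)

lemma gr_mult_sum_left:
  "(\<And>i. i \<in> I \<Longrightarrow> f i \<in> group_ring G) \<Longrightarrow> gr_mult G (\<Sum>i\<in>I. f i) c = (\<Sum>i\<in>I. gr_mult G (f i) c)"
  by (induction I rule: infinite_finite_induct) (auto simp: gr_mult_add_left gr_sum)

lemma gr_mult_sum_right: "gr_mult G c (\<Sum>i\<in>I. f i) = (\<Sum>i\<in>I. gr_mult G c (f i))"
  by (simp add: gr_mult_def fun_eq_iff sum_fun_apply sum_distrib_left sum.swap[of _ I])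

text \<open>Regarding integral coefficients as real ones embeds the group ring in the convolution
  algebra of the group, and closure, associativity and supports of products are read off
  there.\<close>

interpretation gpd: groupoid "carrier G" "\<lambda>_. ()" "\<lambda>_. ()" "(\<otimes>)" "\<lambda>x. inv x" "\<lambda>_. \<one>"
  by unfold_locales (simp_all add: m_assoc inv_mult_group flip: m_assoc)

lemma group_ring_FA: "a \<in> group_ring G \<longleftrightarrow> (\<lambda>x. real_of_int (a x)) \<in> gpd.FA"
  by (auto simp: group_ring_def gpd.FA_def)

lemma gr_mult_conv:
  "(\<lambda>x. real_of_int (gr_mult G a b x)) = gpd.conv (\<lambda>x. real_of_int (a x)) (\<lambda>x. real_of_int (b x))"
  by (rule ext) (simp add: gpd.conv_def gr_mult_def)

lemma aug_pairing: "real_of_int (aug a) = pairing (\<lambda>x. real_of_int (a x)) (\<lambda>_. 1)"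
  by (simp add: aug_def pairing_def)

lemma gr_mult_closed: "a \<in> group_ring G \<Longrightarrow> b \<in> group_ring G \<Longrightarrow> gr_mult G a b \<in> group_ring G"
  unfolding group_ring_FA gr_mult_conv by (rule gpd.FA_conv)

lemma of_int_fun_eq: "(\<lambda>x. real_of_int (a x)) = (\<lambda>x. real_of_int (b x)) \<Longrightarrow> a = b"
  by (metis ext of_int_eq_iff)

lemma gr_mult_assoc:
  assumes "a \<in> group_ring G" "b \<in> group_ring G" "c \<in> group_ring G"
  shows "gr_mult G (gr_mult G a b) c = gr_mult G a (gr_mult G b c)"
  by (rule of_int_fun_eq) (use assms in \<open>simp add: gr_mult_conv gpd.conv_assoc group_ring_FA\<close>)

lemma gr_mult_support_subset:
  assumes "a \<in> group_ring G" "b \<in> group_ring G" "subgroup H G" "supp a \<subseteq> H" "supp b \<subseteq> H"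
  shows "{x. gr_mult G a b x \<noteq> 0} \<subseteq> H"
proof -
  have "{x. gr_mult G a b x \<noteq> 0} = {x. gpd.conv (\<lambda>x. real_of_int (a x)) (\<lambda>x. real_of_int (b x)) x \<noteq> 0}"
    unfolding gr_mult_conv[symmetric] by simp
  also have "\<dots> \<subseteq> (\<lambda>(x, y). x \<otimes> y) ` {(x, y). a x \<noteq> 0 \<and> b y \<noteq> 0}"
    using gpd.conv_support[of "\<lambda>x. real_of_int (a x)" "\<lambda>x. real_of_int (b x)"] assms
    by (simp add: group_ring_FA)
  also have "\<dots> \<subseteq> H" using assms(4,5) subgroup.m_closed[OF assms(3)] by auto
  finally show ?thesis .
qed

lemma aug_mult:
  assumes "a \<in> group_ring G" "b \<in> group_ring G"
  shows "aug (gr_mult G a b) = aug a * aug b"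
proof -
  have "real_of_int (aug (gr_mult G a b)) =
      pairing (\<lambda>x. real_of_int (a x)) (\<lambda>x. pairing (\<lambda>x. real_of_int (b x)) (\<lambda>_. 1))"
    unfolding aug_pairing gr_mult_conv using assms by (simp add: gpd.pairing_conv group_ring_FA)
  also have "\<dots> = real_of_int (aug b) * pairing (\<lambda>x. real_of_int (a x)) (\<lambda>_. 1)"
    unfolding aug_pairing[symmetric, of b] by (simp flip: pairing_scale_right)
  also have "\<dots> = real_of_int (aug a * aug b)" unfolding aug_pairing[symmetric] by simp
  finally show ?thesis by (simp only: of_int_eq_iff)
qed

lemma gr_one_closed: "gr_elem \<one> \<in> group_ring G"
  by (simp add: gr_elem_closed)

lemma gr_mult_one_left: "a \<in> group_ring G \<Longrightarrow> gr_mult G (gr_elem \<one>) a = a"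
  by (subst gr_mult_superset[of "{\<one>}"]) (auto simp: gr_elem_def group_ring_def fun_eq_iff)

lemma gr_mult_elem_elem:
  assumes "g \<in> carrier G" "h \<in> carrier G"
  shows "gr_mult G (gr_elem g) (gr_elem h) = gr_elem (g \<otimes> h)"
  using assms by (subst gr_mult_superset[of "{g}"]) (auto simp: gr_elem_def fun_eq_iff inv_solve_left')

lemma gr_mult_one_right:
  assumes "a \<in> group_ring G"
  shows "gr_mult G a (gr_elem \<one>) = a"
proof
  fix g
  have fin: "finite (supp a)" and sub: "\<And>x. a x \<noteq> 0 \<Longrightarrow> x \<in> carrier G"
    using assms by (auto simp: group_ring_def)
  show "gr_mult G a (gr_elem \<one>) g = a g"
  proof (cases "g \<in> carrier G")
    case True
    have "(\<Sum>h | a h \<noteq> 0. a h * gr_elem \<one> (inv h \<otimes> g)) = (\<Sum>h | a h \<noteq> 0. if h = g then a h else 0)"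
      by (rule sum.cong) (use True sub in \<open>auto simp: gr_elem_def inv_solve_left'\<close>)
    also have "\<dots> = a g" using fin by (simp add: sum.delta')
    finally show ?thesis using True by (simp add: gr_mult_def)
  qed (use sub in \<open>auto simp: gr_mult_def\<close>)
qed

end

subsection \<open>The augmentation ideal of a perfect subgroup\<close>

text \<open>\<open>a_rel\<close> is the idempotence of the augmentation ideal in coordinates: each
  generator is a left combination of products of two generators. The coefficients
  \<open>c i j k\<close> later define the map that undoes a step of the direct system, and
  \<open>a_nonzero\<close> keeps the limit from vanishing.\<close>

locale tree_module = group G for G (structure) +
  fixes n :: nat and a :: "nat \<Rightarrow> 'a \<Rightarrow> int" and c :: "nat \<Rightarrow> nat \<Rightarrow> nat \<Rightarrow> 'a \<Rightarrow> int"
  assumes n_pos: "n > 0"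
    and a_gr: "\<And>i. i < n \<Longrightarrow> a i \<in> group_ring G"
    and a_aug: "\<And>i. i < n \<Longrightarrow> aug (a i) = 0"
    and a_nonzero: "\<exists>i<n. a i \<noteq> 0"
    and c_gr: "\<And>i j k. i < n \<Longrightarrow> j < n \<Longrightarrow> k < n \<Longrightarrow> c i j k \<in> group_ring G"
    and a_rel: "\<And>i. i < n \<Longrightarrow> a i = (\<Sum>j<n. gr_mult G (\<Sum>k<n. gr_mult G (c i j k) (a k)) (a j))"

section \<open>Left ideals over the group ring of a subgroup\<close>

context group
begin

definition supported_on :: "'a set \<Rightarrow> ('a \<Rightarrow> int) set" where
  "supported_on H = {r \<in> group_ring G. supp r \<subseteq> H}"

text \<open>Two coefficient sets B occur: the group ring of a subgroup H, giving the left ideal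
  generated by the \<open>a j\<close>, and its augmentation ideal, giving the product of the two
  ideals.\<close>

definition left_comb :: "nat \<Rightarrow> (nat \<Rightarrow> 'a \<Rightarrow> int) \<Rightarrow> ('a \<Rightarrow> int) set \<Rightarrow> ('a \<Rightarrow> int) set" where
  "left_comb n a B = {\<Sum>j<n. gr_mult G (r j) (a j) | r. \<forall>j<n. r j \<in> B}"

text \<open>These are the left modules over ZH inside ZG; negatives are contained in the last
  clause, through the multiple by -1.\<close>

definition left_closed :: "'a set \<Rightarrow> ('a \<Rightarrow> int) set \<Rightarrow> bool" where
  "left_closed H J \<longleftrightarrow> 0 \<in> J \<and> (\<forall>x\<in>J. \<forall>y\<in>J. x + y \<in> J) \<and>
     (\<forall>s\<in>supported_on H. \<forall>x\<in>J. gr_mult G s x \<in> J)"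

lemma left_closed_left_comb:
  assumes B: "left_closed H B" "B \<subseteq> group_ring G" and a: "\<And>j. j < n \<Longrightarrow> a j \<in> group_ring G"
  shows "left_closed H (left_comb n a B)"
  unfolding left_closed_def
proof (intro conjI ballI)
  show "0 \<in> left_comb n a B"
    using B(1) unfolding left_comb_def left_closed_def
    by (intro CollectI exI[of _ "\<lambda>_. 0"]) simp
next
  fix x y assume "x \<in> left_comb n a B" "y \<in> left_comb n a B"
  then obtain r s where r: "x = (\<Sum>j<n. gr_mult G (r j) (a j))" "\<And>j. j < n \<Longrightarrow> r j \<in> B"
    and s: "y = (\<Sum>j<n. gr_mult G (s j) (a j))" "\<And>j. j < n \<Longrightarrow> s j \<in> B"
    unfolding left_comb_def by blast
  have "x + y = (\<Sum>j<n. gr_mult G (r j + s j) (a j))"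
    unfolding r(1) s(1) sum.distrib[symmetric]
    by (rule sum.cong) (use r(2) s(2) B(2) in \<open>auto simp: gr_mult_add_left subset_iff\<close>)
  then show "x + y \<in> left_comb n a B"
    using r(2) s(2) B(1) unfolding left_comb_def left_closed_def
    by (intro CollectI exI[of _ "\<lambda>j. r j + s j"]) simp
next
  fix s x assume s: "s \<in> supported_on H" and "x \<in> left_comb n a B"
  then obtain r where r: "x = (\<Sum>j<n. gr_mult G (r j) (a j))" "\<And>j. j < n \<Longrightarrow> r j \<in> B"
    unfolding left_comb_def by blast
  have "s \<in> group_ring G" using s by (simp add: supported_on_def)
  then have "gr_mult G s x = (\<Sum>j<n. gr_mult G (gr_mult G s (r j)) (a j))"
    unfolding r(1) gr_mult_sum_right
    by (intro sum.cong) (use r(2) B(2) a in \<open>auto simp: gr_mult_assoc subset_iff\<close>)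
  then show "gr_mult G s x \<in> left_comb n a B"
    using r(2) s B(1) unfolding left_comb_def left_closed_def
    by (intro CollectI exI[of _ "\<lambda>j. gr_mult G s (r j)"]) simp
qed

lemma left_closed_supported_on:
  assumes "subgroup H G"
  shows "left_closed H (supported_on H)"
proof -
  have "x + y \<in> supported_on H" if "x \<in> supported_on H" "y \<in> supported_on H" for x y
    using that gr_add[of x y] by (force simp: supported_on_def)
  moreover have "gr_mult G s x \<in> supported_on H" if "s \<in> supported_on H" "x \<in> supported_on H" for s x
    using that gr_mult_support_subset[OF _ _ assms] gr_mult_closed unfolding supported_on_def by blast
  ultimately show ?thesis
    by (auto simp: left_closed_def supported_on_def gr_zero)
qed

lemma left_closed_aug_zero:
  assumes "subgroup H G"
  shows "left_closed H {r \<in> supported_on H. aug r = 0}"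
  using left_closed_supported_on[OF assms] unfolding left_closed_def
  by (auto simp: supported_on_def aug_add aug_mult)

lemma gr_elem_supported: "subgroup H G \<Longrightarrow> h \<in> H \<Longrightarrow> gr_elem h \<in> supported_on H"
  using subgroup.mem_carrier[of H G h] gr_elem_closed by (auto simp: supported_on_def gr_elem_def)

lemma uminus_supported: "r \<in> supported_on H \<Longrightarrow> - r \<in> supported_on H"
  by (simp add: supported_on_def gr_uminus)

text \<open>The elements g of H with g - 1 in J form a subgroup, by g h - 1 = g (h - 1) + (g - 1)
  and g^-1 - 1 = -g^-1 (g - 1).\<close>

lemma left_closed_generate:
  assumes H: "subgroup H G" and J: "left_closed H J" "J \<subseteq> group_ring G"
    and S: "S \<subseteq> H" "\<And>s. s \<in> S \<Longrightarrow> gr_elem s - gr_elem \<one> \<in> J"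
    and h: "h \<in> generate G S"
  shows "gr_elem h - gr_elem \<one> \<in> J"
proof -
  interpret H: subgroup H G using H .
  have elem: "gr_elem g \<in> group_ring G" if "g \<in> H" for g using that gr_elem_closed by simp
  have gen_H: "generate G S \<subseteq> H" using S(1) H by (rule generate_subgroup_incl)
  define \<delta> where "\<delta> g = gr_elem g - gr_elem \<one>" for g
  have "\<delta> h \<in> J"
    using h
  proof induction
    case one
    show ?case unfolding \<delta>_def diff_self using J(1) unfolding left_closed_def by (rule conjunct1)
  next
    case (incl s)
    show ?case unfolding \<delta>_def using S(2)[OF incl] .
  next
    case (inv s)
    have s: "s \<in> H" "\<delta> s \<in> J" unfolding \<delta>_def using S(1) S(2)[OF inv] inv by blast+
    have "- gr_elem (inv s) \<in> supported_on H" using s(1) gr_elem_supported[OF H] uminus_supported by simp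
    then have "gr_mult G (- gr_elem (inv s)) (\<delta> s) \<in> J"
      using J(1) s(2) by (simp add: left_closed_def)
    moreover have "gr_mult G (- gr_elem (inv s)) (\<delta> s) = \<delta> (inv s)"
      unfolding \<delta>_def
      using s(1) by (simp add: gr_mult_uminus_left gr_mult_diff_right gr_mult_elem_elem)
    ultimately show ?case by simp
  next
    case (eng g h)
    then have gh: "g \<in> H" "h \<in> H" using gen_H by auto
    have "gr_mult G (gr_elem g) (\<delta> h) + \<delta> g \<in> J"
      using eng J(1) gr_elem_supported[OF H gh(1)] by (simp add: left_closed_def)
    moreover have "gr_mult G (gr_elem g) (\<delta> h) + \<delta> g = \<delta> (g \<otimes> h)"
      unfolding \<delta>_def using gh by (simp add: gr_mult_diff_right gr_mult_elem_elem)
    ultimately show ?case by simp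
  qed
  then show ?thesis by (simp only: \<delta>_def)
qed

text \<open>With augmentation zero, r is the sum of the r_h (h - 1), because the terms with 1 add up
  to the augmentation.\<close>

lemma aug_zero_mem_left_closed:
  assumes H: "subgroup H G" and J: "left_closed H J"
    and diff: "\<And>h. h \<in> H \<Longrightarrow> gr_elem h - gr_elem \<one> \<in> J"
    and r: "r \<in> supported_on H" "aug r = 0"
  shows "r \<in> J"
proof -
  interpret H: subgroup H G using H .
  let ?S = "supp r"
  have S: "finite ?S" "?S \<subseteq> H" using r(1) by (auto simp: supported_on_def group_ring_def)
  \<comment> \<open>The integer coefficient \<open>r h\<close> is written as a multiple of the
    identity in the group ring, so that closure under left multiplication applies to it.\<close>
  define t where "t h = gr_mult G (\<lambda>x. if x = \<one> then r h else 0) (gr_elem h - gr_elem \<one>)" for h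
  have scalar: "(\<lambda>x. if x = \<one> then k else 0) \<in> supported_on H" for k
    by (auto simp: supported_on_def group_ring_def)
  have t: "t h = (\<lambda>x. r h * (gr_elem h x - gr_elem \<one> x))" if "h \<in> H" for h
    unfolding t_def using that by (subst gr_mult_superset[of "{\<one>}"]) (auto simp: fun_eq_iff gr_elem_def)
  have "(\<Sum>h\<in>F. t h) \<in> J" if "finite F" "F \<subseteq> H" for F
    using that
  proof (induction F rule: finite_induct)
    case (insert h F)
    have "t h \<in> J" unfolding t_def using insert J diff scalar by (simp add: left_closed_def)
    moreover have "(\<Sum>h\<in>F. t h) \<in> J" using insert by simp
    ultimately show ?case using J unfolding left_closed_def sum.insert[OF insert(1,2)] by blast
  qed (use J in \<open>simp add: left_closed_def\<close>)
  then have "(\<Sum>h\<in>?S. t h) \<in> J" using S by blast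
  moreover have "(\<Sum>h\<in>?S. t h) = r"
  proof
    fix x
    have "(\<Sum>h\<in>?S. t h) x = (\<Sum>h\<in>?S. r h * gr_elem h x) - (\<Sum>h\<in>?S. r h) * gr_elem \<one> x"
      unfolding sum_fun_apply sum_distrib_right sum_subtractf[symmetric]
      by (rule sum.cong) (use S(2) t in \<open>auto simp: right_diff_distrib subset_iff\<close>)
    also have "(\<Sum>h\<in>?S. r h) = 0" using r(2) by (simp add: aug_def)
    also have "(\<Sum>h\<in>?S. r h * gr_elem h x) = (\<Sum>h\<in>?S. if h = x then r h else 0)"
      by (rule sum.cong) (auto simp: gr_elem_def)
    also have "\<dots> = r x" using S(1) by simp
    finally show "(\<Sum>h\<in>?S. t h) x = r x" by simp
  qed
  ultimately show ?thesis by simp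
qed

text \<open>The augmentation ideal of a perfect group is idempotent, because modulo its square a commutator
  becomes trivial.\<close>

proposition perfect_subgroup_relations:
  assumes X: "finite X" "X \<subseteq> carrier G"
    and perfect: "derived G (generate G X) = generate G X" "generate G X \<noteq> {\<one>}"
  shows "\<exists>n a c. tree_module G n a c"
proof -
  let ?H = "generate G X"
  have H: "subgroup ?H G" using X(2) by (rule generate_is_subgroup)
  interpret H: subgroup ?H G using H .
  obtain n :: nat and h where h: "X = h ` {i. i < n}"
    using X(1) finite_imp_nat_seg_image_inj_on by blast
  define a where "a i = gr_elem (h i) - gr_elem \<one>" for i
  have hX: "h i \<in> X" if "i < n" for i using that h by blast
  have hG: "h i \<in> carrier G" if "i < n" for i using hX[OF that] X(2) by blast
  have a: "a i \<in> group_ring G" if "i < n" for i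
    unfolding a_def using hG[OF that] by (intro gr_diff gr_elem_closed one_closed)
  have a_aug: "aug (a i) = 0" if "i < n" for i
    unfolding a_def using hG[OF that] by (simp add: aug_diff gr_elem_closed)
  let ?R = "supported_on ?H" and ?I = "{r \<in> supported_on ?H. aug r = 0}"
  have RI: "?R \<subseteq> group_ring G" "?I \<subseteq> group_ring G" by (auto simp: supported_on_def)
  \<comment> \<open>\<open>L\<close> is the left ideal of ZH generated by the \<open>a i\<close>; it
    will be seen to contain the augmentation ideal I. \<open>L2\<close> has coefficients in I and
    plays the role of the square of I.\<close>
  define L L2 where "L = left_comb n a ?R" and "L2 = left_comb n a ?I"
  have L: "left_closed ?H L" and L2: "left_closed ?H L2"
    unfolding L_def L2_def
    using left_closed_left_comb[OF left_closed_supported_on[OF H] RI(1) a]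
      left_closed_left_comb[OF left_closed_aug_zero[OF H] RI(2) a] by auto
  have comb_gr: "left_comb n a B \<subseteq> group_ring G" if "B \<subseteq> group_ring G" for B
    unfolding left_comb_def using that a by (auto intro!: gr_sum gr_mult_closed simp: subset_iff)
  have L_gr: "L \<subseteq> group_ring G" "L2 \<subseteq> group_ring G"
    unfolding L_def L2_def using comb_gr RI by auto
  have one_R: "gr_elem \<one> \<in> ?R" by (rule gr_elem_supported[OF H H.one_closed])
  have a_L: "a i \<in> L" if i: "i < n" for i
  proof -
    have "a i = (\<Sum>j<n. gr_mult G (if j = i then gr_elem \<one> else 0) (a j))"
      using i a by (simp add: if_distrib[of "\<lambda>r. gr_mult G r _"] gr_mult_one_left cong: if_cong)
    moreover have "0 \<in> ?R" using left_closed_supported_on[OF H] by (simp add: left_closed_def)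
    ultimately show ?thesis
      unfolding L_def left_comb_def using one_R
      by (intro CollectI exI[of _ "\<lambda>j. if j = i then gr_elem \<one> else 0"]) auto
  qed
  have diff_L: "gr_elem g - gr_elem \<one> \<in> L" if "g \<in> ?H" for g
    using left_closed_generate[OF H L L_gr(1) _ _ that] a_L h generate.incl[of _ X G]
    by (auto simp: a_def)
  have I_L: "r \<in> L" if "r \<in> ?I" for r
    using aug_zero_mem_left_closed[OF H L diff_L] that by blast
  \<comment> \<open>Write v - 1 as a combination of the \<open>a j\<close>. Multiplication by u - 1
    from the left then puts all coefficients into I.\<close>
  have prod_L2: "gr_mult G (gr_elem u - gr_elem \<one>) (gr_elem v - gr_elem \<one>) \<in> L2"
    if uv: "u \<in> ?H" "v \<in> ?H" for u v
  proof -
    let ?u = "gr_elem u - gr_elem \<one>"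
    obtain r where r: "gr_elem v - gr_elem \<one> = (\<Sum>j<n. gr_mult G (r j) (a j))" "\<And>j. j < n \<Longrightarrow> r j \<in> ?R"
      using diff_L[OF uv(2)] unfolding L_def left_comb_def by blast
    have u: "?u \<in> ?I"
      using gr_elem_supported[OF H uv(1)] uminus_supported[OF one_R] left_closed_supported_on[OF H] uv(1)
      unfolding left_closed_def by (simp add: aug_diff gr_elem_closed flip: diff_conv_add_uminus)
        (metis diff_conv_add_uminus)
    have "gr_mult G ?u (r j) \<in> ?I" if "j < n" for j
      using left_closed_supported_on[OF H] u r(2)[OF that] RI
      by (auto simp: left_closed_def aug_mult subset_iff)
    moreover have "gr_mult G ?u (gr_elem v - gr_elem \<one>) = (\<Sum>j<n. gr_mult G (gr_mult G ?u (r j)) (a j))"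
      unfolding r(1) gr_mult_sum_right
      by (rule sum.cong) (use r(2) u RI a in \<open>auto simp: gr_mult_assoc subset_iff\<close>)
    ultimately show ?thesis unfolding L2_def left_comb_def by (intro CollectI exI[of _ "\<lambda>j. gr_mult G ?u (r j)"]) simp
  qed
  have comm_L2: "gr_elem s - gr_elem \<one> \<in> L2" if s: "s \<in> derived_set G ?H" for s
  proof -
    obtain x y where xy: "x \<in> ?H" "y \<in> ?H" "s = x \<otimes> y \<otimes> inv x \<otimes> inv y" using s by blast
    \<comment> \<open>From u v - v u = (u - 1)(v - 1) - (v - 1)(u - 1) left multiplication by (v
      u)^-1 produces (v u)^-1 u v - 1. The choice of inverses makes this the given commutator minus
      1.\<close>
    define u v where "u = inv x" and "v = inv y"
    have uv: "u \<in> ?H" "v \<in> ?H" using xy by (simp_all add: u_def v_def)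
    let ?\<delta> = "\<lambda>g. gr_elem g - gr_elem \<one>"
    let ?d = "gr_mult G (?\<delta> u) (?\<delta> v) + gr_mult G (- gr_elem \<one>) (gr_mult G (?\<delta> v) (?\<delta> u))"
    have d: "?d = gr_elem (u \<otimes> v) - gr_elem (v \<otimes> u)"
    proof -
      have prod: "gr_mult G (?\<delta> g) (?\<delta> g') = gr_elem (g \<otimes> g') - gr_elem g - gr_elem g' + gr_elem \<one>"
        if "g \<in> ?H" "g' \<in> ?H" for g g'
        using that by (simp add: gr_mult_diff_left gr_mult_diff_right gr_mult_elem_elem gr_elem_closed)
      have "gr_mult G (?\<delta> v) (?\<delta> u) \<in> group_ring G"
        using uv by (intro gr_mult_closed gr_diff gr_elem_closed) auto
      then show ?thesis
        unfolding gr_mult_uminus_left by (simp add: gr_mult_one_left prod uv)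
    qed
    have "?d \<in> L2"
      using L2 prod_L2 uv uminus_supported[OF one_R] by (simp add: left_closed_def)
    then have "gr_mult G (gr_elem (inv (v \<otimes> u))) ?d \<in> L2"
      using L2 gr_elem_supported[OF H, of "inv (v \<otimes> u)"] uv by (simp add: left_closed_def)
    moreover have eq: "gr_mult G (gr_elem (inv (v \<otimes> u))) ?d = ?\<delta> s"
    proof -
      have uvG: "u \<in> carrier G" "v \<in> carrier G" using uv by simp_all
      have "inv (v \<otimes> u) \<otimes> (u \<otimes> v) = s"
        unfolding xy(3) u_def v_def using xy(1,2) by (simp add: inv_mult_group m_assoc)
      then show ?thesis
        unfolding d using uvG by (simp add: gr_mult_diff_right gr_mult_elem_elem)
    qed
    ultimately show ?thesis by (simp only: eq)
  qed
  have H_eq: "?H = generate G (derived_set G ?H)" using perfect(1) unfolding derived_def by simp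
  have a_L2: "a i \<in> L2" if "i < n" for i
  proof -
    have "h i \<in> generate G (derived_set G ?H)" using H_eq hX[OF that] generate.incl[of _ X G] by blast
    from left_closed_generate[OF H L2 L_gr(2) derived_set_incl[OF subset_refl H] comm_L2 this]
    show ?thesis by (simp add: a_def)
  qed
  define good where "good i c \<longleftrightarrow> (\<forall>j<n. \<forall>k<n. c j k \<in> group_ring G) \<and>
      a i = (\<Sum>j<n. gr_mult G (\<Sum>k<n. gr_mult G (c j k) (a k)) (a j))" for i c
  have good_ex: "\<exists>c. good i c" if i: "i < n" for i
  proof -
    \<comment> \<open>The coefficients b lie in I, hence in \<open>L\<close>; expanding them once
      more in the generators gives the quadratic relations.\<close>
    obtain b where b: "a i = (\<Sum>j<n. gr_mult G (b j) (a j))" "\<And>j. j < n \<Longrightarrow> b j \<in> ?I"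
      using a_L2[OF i] unfolding L2_def left_comb_def by blast
    have "\<forall>j. \<exists>r. j < n \<longrightarrow> b j = (\<Sum>k<n. gr_mult G (r k) (a k)) \<and> (\<forall>k<n. r k \<in> ?R)"
      using I_L[OF b(2)] unfolding L_def left_comb_def by blast
    then obtain r where r: "\<And>j. j < n \<Longrightarrow> b j = (\<Sum>k<n. gr_mult G (r j k) (a k)) \<and> (\<forall>k<n. r j k \<in> ?R)"
      by metis
    have "a i = (\<Sum>j<n. gr_mult G (\<Sum>k<n. gr_mult G (r j k) (a k)) (a j))"
      unfolding b(1) by (rule sum.cong) (use r in auto)
    then show ?thesis unfolding good_def using r RI(1) by (intro exI[of _ r]) blast
  qed
  define c where "c i = (SOME c. good i c)" for i
  have "good i (c i)" if "i < n" for i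
    unfolding c_def using good_ex[OF that] by (rule someI_ex)
  then have c: "j < n \<Longrightarrow> k < n \<Longrightarrow> c i j k \<in> group_ring G"
    "a i = (\<Sum>j<n. gr_mult G (\<Sum>k<n. gr_mult G (c i j k) (a k)) (a j))" if "i < n" for i j k
    using that unfolding good_def by blast+
  have nz: "\<exists>i<n. a i \<noteq> 0"
  proof (rule ccontr)
    assume "\<not> (\<exists>i<n. a i \<noteq> 0)"
    then have "gr_elem (h i) = gr_elem \<one>" if "i < n" for i using that by (simp add: a_def)
    then have "h i = \<one>" if "i < n" for i using that unfolding gr_elem_def by (metis zero_neq_one)
    then have "X \<subseteq> {\<one>}" using h by auto
    then have "?H \<subseteq> {\<one>}" using generate_subgroup_incl triv_subgroup by blast
    then show False using perfect(2) H.one_closed by blast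
  qed
  then have n0: "n > 0" by auto
  have "tree_module G n a c" by unfold_locales (fact n0 a a_aug nz c)+
  then show ?thesis by blast
qed

end

subsection \<open>Idempotent matrices of augmentation zero\<close>

text \<open>An arrow (i, j, g) stands for the matrix with g in row i and column j and zeros
  elsewhere, so convolution is multiplication of N by N matrices over the group ring.\<close>

locale matrix_groupoid = group G for G (structure) +
  fixes N :: nat
begin

sublocale mg: groupoid "{..<N} \<times> {..<N} \<times> carrier G" fst "\<lambda>x. fst (snd x)"
  "\<lambda>x y. (fst x, fst (snd y), snd (snd x) \<otimes> snd (snd y))"
  "\<lambda>x. (fst (snd x), fst x, inv (snd (snd x)))" "\<lambda>v. (v, v, \<one>)"
proof unfold_locales
  show "finite (fst ` ({..<N} \<times> {..<N} \<times> carrier G))"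
    by (rule finite_subset[of _ "{..<N}"]) auto
qed (auto simp: m_assoc inv_mult_group simp flip: m_assoc)

abbreviation triples :: "(nat \<times> nat \<times> 'a) set" where
  "triples \<equiv> {..<N} \<times> {..<N} \<times> carrier G"

lemma loop_power_eq:
  assumes "g \<in> carrier G"
  shows "mg.loop_power (i, i, g) (Suc n) = (i, i, g [^] Suc n)"
proof (induction n)
  case (Suc n)
  have "mg.loop_power (i, i, g) (Suc (Suc n)) = (i, i, g \<otimes> g [^] Suc n)"
    using Suc unfolding mg.loop_power_def by (simp add: mg.word_prod_Cons)
  also have "g \<otimes> g [^] Suc n = g [^] Suc (Suc n)" using assms by (rule nat_pow_Suc2[symmetric])
  finally show ?case .
qed (use assms in \<open>simp add: mg.loop_power_def\<close>)

theorem idempotent_matrix_zero: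
  fixes E :: "nat \<Rightarrow> nat \<Rightarrow> 'a \<Rightarrow> int"
  assumes E: "\<And>i j. i < N \<Longrightarrow> j < N \<Longrightarrow> E i j \<in> group_ring G"
    and idem: "\<And>i k. i < N \<Longrightarrow> k < N \<Longrightarrow> E i k = (\<Sum>j<N. gr_mult G (E i j) (E j k))"
    and aug0: "\<And>i. i < N \<Longrightarrow> aug (E i i) = 0"
    and rootless: "\<And>g. g \<in> carrier G \<Longrightarrow> g \<noteq> \<one> \<Longrightarrow>
      \<exists>p m. prime (p::nat) \<and> (\<forall>x\<in>carrier G. x [^] (p ^ m) \<noteq> g)"
    and ij: "i < N" "j < N"
  shows "E i j = 0"
proof -
  define e :: "nat \<times> nat \<times> 'a \<Rightarrow> real"
    where "e x = (if fst x < N \<and> fst (snd x) < N then of_int (E (fst x) (fst (snd x)) (snd (snd x))) else 0)" for x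
  have e_eq: "e (i, j, g) = of_int (E i j g)" if "i < N" "j < N" for i j g
    using that by (simp add: e_def)
  have supp: "(supp e) = (\<Union>i<N. \<Union>j<N. (\<lambda>g. (i, j, g)) ` {g. E i j g \<noteq> 0})"
    by (auto simp: e_def intro!: bexI imageI)
  have fin_E: "finite {g. E i j g \<noteq> 0}" and sub_E: "\<And>g. E i j g \<noteq> 0 \<Longrightarrow> g \<in> carrier G"
    if "i < N" "j < N" for i j
    using E[OF that] by (auto simp: group_ring_def)
  have e_fin: "finite (supp e)" unfolding supp using fin_E by blast
  have "supp e \<subseteq> triples" unfolding supp using sub_E by auto
  then have e_FA: "e \<in> mg.FA" using e_fin by (simp add: mg.FA_def)
  have e_idem: "mg.conv e e = e"
  proof
    fix z :: "nat \<times> nat \<times> 'a"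
    obtain i k g where z: "z = (i, k, g)" by (cases z) auto
    show "mg.conv e e z = e z"
    proof (cases "z \<in> triples")
      case True
      then have ik: "i < N" "k < N" "g \<in> carrier G" using z by auto
      have set_eq: "{x. e x \<noteq> 0 \<and> fst x = fst z} = (\<lambda>(j, h). (i, j, h)) ` (SIGMA j:{..<N}. {h. E i j h \<noteq> 0})"
        using ik by (force simp: z e_def)
      have "mg.conv e e z = (\<Sum>x\<in>(\<lambda>(j, h). (i, j, h)) ` (SIGMA j:{..<N}. {h. E i j h \<noteq> 0}).
          e x * e (fst (snd x), k, inv (snd (snd x)) \<otimes> g))"
        unfolding mg.conv_def set_eq using True by (simp add: z)
      also have "\<dots> = (\<Sum>(j, h)\<in>(SIGMA j:{..<N}. {h. E i j h \<noteq> 0}). e (i, j, h) * e (j, k, inv h \<otimes> g))"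
        by (subst sum.reindex) (auto simp: inj_on_def intro!: sum.cong)
      also have "\<dots> = (\<Sum>j<N. \<Sum>h | E i j h \<noteq> 0. e (i, j, h) * e (j, k, inv h \<otimes> g))"
        by (rule sum.Sigma[symmetric]) (use ik fin_E in auto)
      also have "\<dots> = (\<Sum>j<N. of_int (gr_mult G (E i j) (E j k) g))"
        by (rule sum.cong) (use ik in \<open>auto simp: gr_mult_def e_eq\<close>)
      also have "\<dots> = of_int (E i k g)"
        unfolding idem[OF ik(1,2)] sum_fun_apply by simp
      finally show ?thesis using ik by (simp add: z e_eq)
    next
      case False
      then have "e z = 0" using e_FA mg.FA_mem by blast
      then show ?thesis unfolding mg.conv_def using False by simp
    qed
  qed
  \<comment> \<open>The coefficients of the trace are sorted by the conjugacy class of their group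
    element. Z collects the diagonal entries away from the identity, the part to be shown to sum to
    0.\<close>
  define cls where "cls x = {u \<otimes> snd (snd x) \<otimes> inv u | u. u \<in> carrier G}" for x :: "nat \<times> nat \<times> 'a"
  define Z where "Z = {x. e x \<noteq> 0 \<and> fst x = fst (snd x) \<and> snd (snd x) \<noteq> \<one>}"
  have Z_fin: "finite Z" using e_fin by (simp add: Z_def)
  have cls_conj: "cls (i, i', b) = cls (j, j', c)"
    if "c = v \<otimes> b \<otimes> inv v" "v \<in> carrier G" "b \<in> carrier G" for i i' j j' b c v
  proof -
    have "u \<otimes> b \<otimes> inv u = (u \<otimes> inv v) \<otimes> c \<otimes> inv (u \<otimes> inv v)" if "u \<in> carrier G" for u
      using that \<open>v \<in> carrier G\<close> \<open>b \<in> carrier G\<close> unfolding \<open>c = v \<otimes> b \<otimes> inv v\<close>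
      by (simp add: m_assoc inv_mult_group) (simp flip: m_assoc)
    moreover have "u \<otimes> c \<otimes> inv u = (u \<otimes> v) \<otimes> b \<otimes> inv (u \<otimes> v)" if "u \<in> carrier G" for u
      using that \<open>v \<in> carrier G\<close> \<open>b \<in> carrier G\<close> unfolding \<open>c = v \<otimes> b \<otimes> inv v\<close>
      by (simp add: m_assoc inv_mult_group)
    moreover have "u \<otimes> inv v \<in> carrier G" "u \<otimes> v \<in> carrier G" if "u \<in> carrier G" for u
      using that \<open>v \<in> carrier G\<close> by simp_all
    ultimately show ?thesis unfolding cls_def snd_conv by blast
  qed
  have class_zero: "(\<Sum>x | x \<in> Z \<and> cls x = C. e x) = 0" if C: "C \<in> cls ` Z" for C
  proof -
    obtain x0 where x0: "x0 \<in> Z" "C = cls x0" using C by blast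
    define g0 where "g0 = snd (snd x0)"
    have g0: "g0 \<in> carrier G" "g0 \<noteq> \<one>"
      using x0 mg.FA_mem[OF e_FA, of x0] by (auto simp: Z_def g0_def)
    obtain p m where p: "prime (p::nat)" and m: "\<And>x. x \<in> carrier G \<Longrightarrow> x [^] (p ^ m) \<noteq> g0"
      using rootless[OF g0] by blast
    have pm: "p ^ m = Suc (p ^ m - 1)" using p by (simp add: prime_gt_0_nat)
    define P where "P x \<longleftrightarrow> snd (snd x) \<in> C" for x :: "nat \<times> nat \<times> 'a"
    have C_eq: "C = {u \<otimes> g0 \<otimes> inv u | u. u \<in> carrier G}" unfolding x0(2) cls_def g0_def by (rule refl)
    have C_E: "\<exists>u. u \<in> carrier G \<and> c = u \<otimes> g0 \<otimes> inv u" if "c \<in> C" for c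
      using that unfolding C_eq mem_Collect_eq by (elim exE conjE) (intro exI conjI)
    have C_I: "u \<otimes> g0 \<otimes> inv u \<in> C" if "u \<in> carrier G" for u
      unfolding C_eq mem_Collect_eq using that by (intro exI conjI) (rule refl)
    have C_conj: "v \<otimes> c \<otimes> inv v \<in> C" if "c \<in> C" "v \<in> carrier G" for c v
    proof -
      from C_E[OF that(1)] obtain u where u: "u \<in> carrier G" "c = u \<otimes> g0 \<otimes> inv u"
        by (elim exE conjE)
      have "v \<otimes> c \<otimes> inv v = (v \<otimes> u) \<otimes> g0 \<otimes> inv (v \<otimes> u)"
        unfolding u(2) using u(1) that(2) g0 by (simp add: m_assoc inv_mult_group)
      then show ?thesis using C_I[of "v \<otimes> u"] u(1) that(2) by simp
    qed
    have "pairing e (\<lambda>x. if fst x = fst (snd x) \<and> P x then 1 else 0) = 0"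
    proof (rule mg.idempotent_class_sum_zero[OF e_FA e_idem _ p])
      show "e x \<in> \<int>" for x by (simp add: e_def)
    next
      fix x y :: "nat \<times> nat \<times> 'a"
      assume xy: "x \<in> triples" "y \<in> triples"
        and "P (fst x, fst (snd y), snd (snd x) \<otimes> snd (snd y))"
      then have "snd (snd x) \<otimes> snd (snd y) \<in> C" by (simp add: P_def)
      \<comment> \<open>The product in the other order is the conjugate by the inverse of the first
        factor.\<close>
      then have "inv (snd (snd x)) \<otimes> (snd (snd x) \<otimes> snd (snd y)) \<otimes> inv (inv (snd (snd x))) \<in> C"
        using xy by (intro C_conj) auto
      moreover have "inv (snd (snd x)) \<otimes> (snd (snd x) \<otimes> snd (snd y)) \<otimes> inv (inv (snd (snd x))) =
          snd (snd y) \<otimes> snd (snd x)"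
        using xy by (auto simp flip: m_assoc)
      ultimately show "P (fst y, fst (snd x), snd (snd y) \<otimes> snd (snd x))" by (simp add: P_def)
    next
      fix x :: "nat \<times> nat \<times> 'a"
      assume x: "x \<in> triples" "fst x = fst (snd x)"
      obtain i h where ih: "x = (i, i, h)" "h \<in> carrier G" using x by (cases x) auto
      show "\<not> P (mg.loop_power x (p ^ m))"
      proof
        assume "P (mg.loop_power x (p ^ m))"
        then have "h [^] (p ^ m) \<in> C"
          unfolding P_def ih(1) loop_power_eq[OF ih(2), of i "p ^ m - 1", folded pm] snd_conv .
        from C_E[OF this] obtain u where u: "u \<in> carrier G" "h [^] (p ^ m) = u \<otimes> g0 \<otimes> inv u"
          by (elim exE conjE)
        \<comment> \<open>The absence of roots is known for g0 alone; a root of a conjugate of g0 is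
          conjugated back to a root of g0.\<close>
        have "(inv u \<otimes> h \<otimes> u) [^] k = inv u \<otimes> h [^] k \<otimes> u" for k :: nat
        proof (induction k)
          case (Suc k)
          have "u \<otimes> (inv u \<otimes> y) = y" if "y \<in> carrier G" for y
            using that u(1) by (simp flip: m_assoc)
          then show ?case using Suc u(1) ih(2) by (simp add: m_assoc)
        qed (use u in simp)
        then have "(inv u \<otimes> h \<otimes> u) [^] (p ^ m) = inv u \<otimes> (u \<otimes> g0 \<otimes> inv u) \<otimes> u" using u(2) by simp
        also have "\<dots> = inv u \<otimes> u \<otimes> g0 \<otimes> (inv u \<otimes> u)"
          using u(1) g0(1) by (simp only: m_assoc m_closed inv_closed)
        also have "\<dots> = g0" using u(1) g0(1) by simp
        finally show False using m[of "inv u \<otimes> h \<otimes> u"] u(1) ih(2) by simp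
      qed
    qed
    then have "0 = (\<Sum>x | e x \<noteq> 0. e x * (if fst x = fst (snd x) \<and> P x then 1 else 0))"
      by (simp add: pairing_def)
    also have "\<dots> = (\<Sum>x | x \<in> Z \<and> cls x = C. e x)"
    proof (rule sum.mono_neutral_cong_right[OF e_fin])
      show "{x. x \<in> Z \<and> cls x = C} \<subseteq> supp e" by (auto simp: Z_def)
      have iff: "fst x = fst (snd x) \<and> P x \<longleftrightarrow> x \<in> Z \<and> cls x = C" if ex: "e x \<noteq> 0" for x
      proof -
        obtain i j b where x: "x = (i, j, b)" by (cases x) auto
        have b: "b \<in> carrier G" using mg.FA_mem[OF e_FA ex] x by auto
        have "cls x = C \<and> b \<noteq> \<one>" if "b \<in> C"
        proof -
          from C_E[OF that] obtain u where u: "u \<in> carrier G" "b = u \<otimes> g0 \<otimes> inv u"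
            by (elim exE conjE)
          have "b \<noteq> \<one>"
          proof
            assume "b = \<one>"
            then have "u \<otimes> g0 = u" using u g0 by (metis inv_equality inv_inv inv_closed m_closed)
            then show False using u g0 by simp
          qed
          moreover obtain a a' where "x0 = (a, a', g0)" by (cases x0) (auto simp: g0_def)
          ultimately show ?thesis using cls_conj[OF u(2,1) g0(1)] x0(2) x by metis
        qed
        moreover have "b \<in> C" if "cls x = C"
        proof -
          have "b \<in> cls x" unfolding cls_def x using b by (intro CollectI exI[of _ \<one>]) simp
          then show ?thesis using that by simp
        qed
        ultimately show ?thesis using ex by (auto simp: Z_def P_def x)
      qed
      show "\<forall>x\<in>(supp e) - {x. x \<in> Z \<and> cls x = C}. e x * (if fst x = fst (snd x) \<and> P x then 1 else 0) = 0"
        using iff by auto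
      show "e x * (if fst x = fst (snd x) \<and> P x then 1 else 0) = e x" if "x \<in> {x. x \<in> Z \<and> cls x = C}" for x
        using iff[of x] that by (auto simp: Z_def)
    qed
    finally show ?thesis by simp
  qed
  have Z0: "(\<Sum>x\<in>Z. e x) = 0"
    using sum.image_gen[OF Z_fin, of e cls] class_zero by (simp add: Collect_conj_eq)
  have "(\<Sum>x | e x \<noteq> 0 \<and> fst x = fst (snd x). e x) = (\<Sum>i<N. \<Sum>g | E i i g \<noteq> 0. e (i, i, g))"
  proof -
    have set_eq: "{x. e x \<noteq> 0 \<and> fst x = fst (snd x)} = (\<lambda>(i, g). (i, i, g)) ` (SIGMA i:{..<N}. {g. E i i g \<noteq> 0})"
      by (force simp: e_def)
    show ?thesis
      unfolding set_eq
      by (subst sum.reindex, force simp: inj_on_def, subst sum.Sigma) (use fin_E in \<open>auto intro!: sum.cong\<close>)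
  qed
  also have "\<dots> = (\<Sum>i<N. of_int (aug (E i i)))"
    unfolding aug_def of_int_sum by (intro sum.cong refl) (simp add: e_eq)
  finally have closed0: "(\<Sum>x | e x \<noteq> 0 \<and> fst x = fst (snd x). e x) = 0" using aug0 by simp
  have unit_iff: "x \<in> (\<lambda>v. (v, v, \<one>)) ` fst ` triples \<longleftrightarrow>
      fst x = fst (snd x) \<and> snd (snd x) = \<one>" if "e x \<noteq> 0" for x
    using mg.FA_mem[OF e_FA that] by (cases x) (force simp: image_image)
  have "pairing e mg.unit_fun = (\<Sum>x | e x \<noteq> 0 \<and> fst x = fst (snd x) \<and> snd (snd x) = \<one>. e x)"
    unfolding pairing_def
    by (rule sum.mono_neutral_cong_right) (use e_fin unit_iff in \<open>auto simp: mg.unit_fun_def\<close>)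
  also have "\<dots> = (\<Sum>x | e x \<noteq> 0 \<and> fst x = fst (snd x). e x) - (\<Sum>x\<in>Z. e x)"
  proof -
    have "{x. e x \<noteq> 0 \<and> fst x = fst (snd x) \<and> snd (snd x) = \<one>} = {x. e x \<noteq> 0 \<and> fst x = fst (snd x)} - Z"
      by (auto simp: Z_def)
    moreover have "Z \<subseteq> {x. e x \<noteq> 0 \<and> fst x = fst (snd x)}" by (auto simp: Z_def)
    ultimately show ?thesis using e_fin by (simp add: sum_diff)
  qed
  finally have "pairing e mg.unit_fun = 0" using closed0 Z0 by simp
  from mg.idempotent_trace_zero[OF e_FA e_idem this]
  have "e (i, j, g) = 0" for g by simp
  then show ?thesis using ij by (intro ext) (simp add: e_eq)
qed

end

section \<open>Submodules of the free module of countable rank\<close>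

context group
begin

lemma free_mod_comp: "x \<in> free_mod G \<Longrightarrow> x m \<in> group_ring G"
  by (simp add: free_mod_def)

lemma free_mod_iff: "x \<in> free_mod G \<longleftrightarrow> (\<forall>m. x m \<in> group_ring G) \<and> (\<exists>N. \<forall>m\<ge>N. x m = 0)"
proof -
  have "finite (supp x) \<longleftrightarrow> (\<exists>N. \<forall>m\<ge>N. x m = 0)"
    unfolding finite_nat_set_iff_bounded by (auto simp: not_le[symmetric])
  then show ?thesis by (auto simp: free_mod_def)
qed

lemma free_modI: "(\<And>m. x m \<in> group_ring G) \<Longrightarrow> (\<And>m. m \<ge> N \<Longrightarrow> x m = 0) \<Longrightarrow> x \<in> free_mod G"
  unfolding free_mod_iff by blast

lemma free_mod_bound:
  assumes "x \<in> free_mod G"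
  obtains N where "\<And>m. m \<ge> N \<Longrightarrow> x m = 0"
  using assms unfolding free_mod_iff by blast

lemma fm_zero: "0 \<in> free_mod G"
  by (rule free_modI[of _ 0]) (simp_all add: gr_zero)

lemma fm_add:
  assumes "x \<in> free_mod G" "y \<in> free_mod G"
  shows "x + y \<in> free_mod G"
proof -
  obtain N where N: "\<And>m. m \<ge> N \<Longrightarrow> x m = 0" using free_mod_bound[OF assms(1)] by blast
  obtain N' where N': "\<And>m. m \<ge> N' \<Longrightarrow> y m = 0" using free_mod_bound[OF assms(2)] by blast
  show ?thesis
    by (rule free_modI[of _ "max N N'"]) (use N N' assms in \<open>auto simp: gr_add free_mod_comp\<close>)
qed

lemma fm_uminus: "x \<in> free_mod G \<Longrightarrow> - x \<in> free_mod G"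
  unfolding free_mod_iff by (auto simp: gr_uminus)

lemma fm_diff: "x \<in> free_mod G \<Longrightarrow> y \<in> free_mod G \<Longrightarrow> x - y \<in> free_mod G"
  using fm_add[of x "- y"] fm_uminus[of y] by simp

lemma fm_rsmult: "x \<in> free_mod G \<Longrightarrow> r \<in> group_ring G \<Longrightarrow> rsmult G x r \<in> free_mod G"
  unfolding free_mod_iff rsmult_def using gr_mult_closed gr_mult_zero_left by metis

lemma fm_sum: "(\<And>i. i \<in> I \<Longrightarrow> f i \<in> free_mod G) \<Longrightarrow> (\<Sum>i\<in>I. f i) \<in> free_mod G"
  by (induction I rule: infinite_finite_induct) (auto intro: fm_zero fm_add)

lemma rsmult_add: "x \<in> free_mod G \<Longrightarrow> y \<in> free_mod G \<Longrightarrow> rsmult G (x + y) r = rsmult G x r + rsmult G y r"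
  by (rule ext) (simp add: rsmult_def gr_mult_add_left free_mod_comp)

lemma rsmult_diff: "x \<in> free_mod G \<Longrightarrow> y \<in> free_mod G \<Longrightarrow> rsmult G (x - y) r = rsmult G x r - rsmult G y r"
  by (rule ext) (simp add: rsmult_def gr_mult_diff_left free_mod_comp)

lemma rsmult_add_right: "rsmult G x (r + s) = rsmult G x r + rsmult G x s"
  by (rule ext) (simp add: rsmult_def gr_mult_add_right)

lemma rsmult_uminus_right: "rsmult G x (- r) = - rsmult G x r"
  by (rule ext) (simp add: rsmult_def gr_mult_uminus_right)

lemma rsmult_zero_left: "rsmult G 0 r = 0" and rsmult_zero_right: "rsmult G x 0 = 0"
  by (rule ext, simp add: rsmult_def)+

lemma rsmult_assoc: "x \<in> free_mod G \<Longrightarrow> r \<in> group_ring G \<Longrightarrow> s \<in> group_ring G \<Longrightarrow>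
    rsmult G (rsmult G x r) s = rsmult G x (gr_mult G r s)"
  by (rule ext) (simp add: rsmult_def gr_mult_assoc free_mod_comp)

lemma rsmult_one: "x \<in> free_mod G \<Longrightarrow> rsmult G x (gr_elem \<one>) = x"
  by (rule ext) (simp add: rsmult_def gr_mult_one_right free_mod_comp)

lemma rsmult_sum: "(\<And>i. i \<in> I \<Longrightarrow> f i \<in> free_mod G) \<Longrightarrow> rsmult G (\<Sum>i\<in>I. f i) r = (\<Sum>i\<in>I. rsmult G (f i) r)"
  by (rule ext) (simp add: rsmult_def sum_fun_apply gr_mult_sum_left free_mod_comp)

lemma submodD:
  assumes "submod G S"
  shows "S \<subseteq> free_mod G" "0 \<in> S" "x \<in> S \<Longrightarrow> y \<in> S \<Longrightarrow> x + y \<in> S" "x \<in> S \<Longrightarrow> - x \<in> S"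
    "x \<in> S \<Longrightarrow> r \<in> group_ring G \<Longrightarrow> rsmult G x r \<in> S"
  using assms unfolding submod_def by blast+

lemma submod_diff: "submod G S \<Longrightarrow> x \<in> S \<Longrightarrow> y \<in> S \<Longrightarrow> x - y \<in> S"
  using submodD(3)[of S x "- y"] submodD(4)[of S y] by simp

lemma submod_sum: "submod G S \<Longrightarrow> (\<And>i. i \<in> I \<Longrightarrow> f i \<in> S) \<Longrightarrow> (\<Sum>i\<in>I. f i) \<in> S"
  by (induction I rule: infinite_finite_induct) (auto intro: submodD)

lemma rspanI:
  assumes "finite Y" "Y \<subseteq> X" "\<And>x. x \<in> Y \<Longrightarrow> c x \<in> group_ring G"
  shows "(\<Sum>x\<in>Y. rsmult G x (c x)) \<in> rspan G X"
  using assms unfolding rspan_def by blast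

text \<open>The coefficients are extended by zero outside Y, so that two combinations can be written
  over a common finite set.\<close>

lemma rspanE:
  assumes "z \<in> rspan G X"
  obtains Y c where "finite Y" "Y \<subseteq> X" "\<And>x. c x \<in> group_ring G" "\<And>x. x \<notin> Y \<Longrightarrow> c x = 0"
    "z = (\<Sum>x\<in>Y. rsmult G x (c x))"
proof -
  obtain Y c where Y: "finite Y" "Y \<subseteq> X" "\<And>x. x \<in> Y \<Longrightarrow> c x \<in> group_ring G"
    "z = (\<Sum>x\<in>Y. rsmult G x (c x))"
    using assms unfolding rspan_def by blast
  show ?thesis
    by (rule that[of Y "\<lambda>x. if x \<in> Y then c x else 0"]) (use Y gr_zero in \<open>auto cong: sum.cong\<close>)
qed

lemma rspan_superset:
  assumes "finite Z" "Y \<subseteq> Z" "\<And>x. x \<notin> Y \<Longrightarrow> c x = 0"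
  shows "(\<Sum>x\<in>Y. rsmult G x (c x)) = (\<Sum>x\<in>Z. rsmult G x (c x))"
  by (rule sum.mono_neutral_left) (use assms rsmult_zero_right in auto)

lemma submod_rspan:
  assumes "X \<subseteq> free_mod G"
  shows "submod G (rspan G X)"
  unfolding submod_def
proof (intro conjI ballI)
  have mem: "(\<Sum>x\<in>Y. rsmult G x (c x)) \<in> free_mod G" if "Y \<subseteq> X" "\<And>x. c x \<in> group_ring G" for Y c
    using that assms by (intro fm_sum fm_rsmult) auto
  then show "rspan G X \<subseteq> free_mod G" by (auto elim!: rspanE)
  show "0 \<in> rspan G X" using rspanI[of "{}" X] by simp
next
  fix x y assume "x \<in> rspan G X" "y \<in> rspan G X"
  then obtain Y c Y' c' where x: "finite Y" "Y \<subseteq> X" "\<And>x. c x \<in> group_ring G" "\<And>x. x \<notin> Y \<Longrightarrow> c x = 0"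
    "x = (\<Sum>x\<in>Y. rsmult G x (c x))"
    and y: "finite Y'" "Y' \<subseteq> X" "\<And>x. c' x \<in> group_ring G" "\<And>x. x \<notin> Y' \<Longrightarrow> c' x = 0"
    "y = (\<Sum>x\<in>Y'. rsmult G x (c' x))"
    by (elim rspanE) blast
  have fin: "finite (Y \<union> Y')" using x y by simp
  have "x = (\<Sum>z\<in>Y \<union> Y'. rsmult G z (c z))"
    unfolding x(5) by (rule rspan_superset[OF fin Un_upper1 x(4)])
  moreover have "y = (\<Sum>z\<in>Y \<union> Y'. rsmult G z (c' z))"
    unfolding y(5) by (rule rspan_superset[OF fin Un_upper2 y(4)])
  ultimately have "x + y = (\<Sum>z\<in>Y \<union> Y'. rsmult G z (c z + c' z))"
    by (simp only: rsmult_add_right sum.distrib)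
  then show "x + y \<in> rspan G X"
    using rspanI[of "Y \<union> Y'" X "\<lambda>z. c z + c' z"] x y gr_add by simp
next
  fix x assume "x \<in> rspan G X"
  then obtain Y c where x: "finite Y" "Y \<subseteq> X" "\<And>x. c x \<in> group_ring G"
    "x = (\<Sum>x\<in>Y. rsmult G x (c x))" by (elim rspanE) blast
  have "- x = (\<Sum>z\<in>Y. rsmult G z (- c z))"
    unfolding x(4) rsmult_uminus_right by (rule sum_negf[symmetric])
  then show "- x \<in> rspan G X"
    using rspanI[of Y X "\<lambda>z. - c z"] x gr_uminus by simp
  fix r assume r: "r \<in> group_ring G"
  have "rsmult G x r = (\<Sum>z\<in>Y. rsmult G (rsmult G z (c z)) r)"
    unfolding x(4) using x assms by (intro rsmult_sum fm_rsmult) auto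
  also have "\<dots> = (\<Sum>z\<in>Y. rsmult G z (gr_mult G (c z) r))"
    by (rule sum.cong) (use x r assms in \<open>auto simp: rsmult_assoc subset_iff\<close>)
  finally show "rsmult G x r \<in> rspan G X"
    using rspanI[of Y X "\<lambda>z. gr_mult G (c z) r"] x r gr_mult_closed by simp
qed

lemma rspan_incl:
  assumes "b \<in> X" "b \<in> free_mod G"
  shows "b \<in> rspan G X"
  using rspanI[of "{b}" X "\<lambda>_. gr_elem \<one>"] assms by (simp add: rsmult_one gr_one_closed)

text \<open>A basis element b splits off: P is the direct sum of the span of b and the span of the
  remaining basis. Non-freeness of a nonzero module thus follows from the absence of nonzero
  finitely generated summands.\<close>

lemma free_submod_has_fg_summand:
  assumes P: "submod G P" "free_submod G P" "P \<noteq> {0}"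
  shows "\<exists>S. direct_summand G S P \<and> fin_gen G S \<and> S \<noteq> {0}"
proof -
  obtain B where B: "B \<subseteq> P" "rlin_indep G B" "P = rspan G B"
    using P(2) unfolding free_submod_def by blast
  have BF: "B \<subseteq> free_mod G" using B(1) submodD(1)[OF P(1)] by blast
  have "B \<noteq> {}"
  proof
    assume "B = {}"
    then have "P \<subseteq> {0}" using B(3) by (auto elim!: rspanE)
    then show False using P(3) submodD(2)[OF P(1)] by blast
  qed
  then obtain b where b: "b \<in> B" by blast
  have bF: "b \<in> free_mod G" using b BF by blast
  have one_nz: "gr_elem \<one> \<noteq> (0 :: 'a \<Rightarrow> int)" using aug_gr_elem[of \<one>] by fastforce
  have indep: "c x = 0" if "finite Y" "Y \<subseteq> B" "\<And>x. x \<in> Y \<Longrightarrow> c x \<in> group_ring G"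
    "(\<Sum>x\<in>Y. rsmult G x (c x)) = 0" "x \<in> Y" for Y c x
    using B(2) that unfolding rlin_indep_def by blast
  have "b \<noteq> 0"
  proof
    assume "b = 0"
    then have "(\<Sum>x\<in>{b}. rsmult G x (gr_elem \<one>)) = 0" by (simp add: rsmult_zero_left)
    from indep[OF _ _ _ this] show False using b one_nz gr_one_closed by simp
  qed
  let ?S = "rspan G {b}" and ?T = "rspan G (B - {b})"
  have S: "submod G ?S" and T: "submod G ?T" using bF BF by (auto intro!: submod_rspan)
  have bS: "b \<in> ?S" using rspan_incl bF by blast
  have S_form: "\<exists>r\<in>group_ring G. z = rsmult G b r" if "z \<in> ?S" for z
  proof -
    obtain Y c where Y: "finite Y" "Y \<subseteq> {b}" "\<And>x. c x \<in> group_ring G" "\<And>x. x \<notin> Y \<Longrightarrow> c x = 0"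
      "z = (\<Sum>x\<in>Y. rsmult G x (c x))" using \<open>z \<in> ?S\<close> by (elim rspanE) blast
    then have "z = rsmult G b (c b)" using rspan_superset[of "{b}" Y c] by simp
    then show ?thesis using Y(3) by blast
  qed
  have "?S \<inter> ?T \<subseteq> {0}"
  proof
    fix z assume z: "z \<in> ?S \<inter> ?T"
    obtain r where r: "r \<in> group_ring G" "z = rsmult G b r" using S_form z by blast
    obtain Y c where Y: "finite Y" "Y \<subseteq> B - {b}" "\<And>x. c x \<in> group_ring G" "\<And>x. x \<notin> Y \<Longrightarrow> c x = 0"
      "z = (\<Sum>x\<in>Y. rsmult G x (c x))" using z by (elim IntE rspanE) blast
    have bY: "b \<notin> Y" using Y(2) by blast
    let ?c = "\<lambda>x. if x = b then - r else c x"
    have "(\<Sum>x\<in>insert b Y. rsmult G x (?c x)) = rsmult G b (- r) + (\<Sum>x\<in>Y. rsmult G x (?c x))"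
      using Y(1) bY by (subst sum.insert) auto
    also have "(\<Sum>x\<in>Y. rsmult G x (?c x)) = z"
      unfolding Y(5) by (rule sum.cong) (use bY in auto)
    also have "rsmult G b (- r) + z = 0" unfolding r(2) rsmult_uminus_right by simp
    finally have "(\<Sum>x\<in>insert b Y. rsmult G x (?c x)) = 0" .
    moreover have "finite (insert b Y)" "insert b Y \<subseteq> B" using Y(1,2) b by auto
    moreover have "?c x \<in> group_ring G" for x using Y(3) r(1) gr_uminus by simp
    ultimately have "?c b = 0" using indep[of "insert b Y" ?c b] by blast
    then have "- r = 0" by simp
    then show "z \<in> {0}" using r(2) rsmult_zero_right by simp
  qed
  moreover have "P = {x + y | x y. x \<in> ?S \<and> y \<in> ?T}"
  proof
    show "P \<subseteq> {x + y | x y. x \<in> ?S \<and> y \<in> ?T}"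
    proof
      fix z assume "z \<in> P"
      then obtain Y c where Y: "finite Y" "Y \<subseteq> B" "\<And>x. c x \<in> group_ring G" "\<And>x. x \<notin> Y \<Longrightarrow> c x = 0"
        "z = (\<Sum>x\<in>Y. rsmult G x (c x))" unfolding B(3) by (elim rspanE) blast
      have "z = (\<Sum>x\<in>insert b (Y - {b}). rsmult G x (c x))"
        unfolding Y(5) by (rule rspan_superset) (use Y in auto)
      also have "\<dots> = rsmult G b (c b) + (\<Sum>x\<in>Y - {b}. rsmult G x (c x))"
        using Y(1) by (subst sum.insert) auto
      finally show "z \<in> {x + y | x y. x \<in> ?S \<and> y \<in> ?T}"
        using submodD(5)[OF S bS Y(3)] rspanI[of "Y - {b}" "B - {b}" c] Y by blast
    qed
    have mono: "rspan G X \<subseteq> P" if "X \<subseteq> B" for X using that unfolding B(3) rspan_def by blast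
    show "{x + y | x y. x \<in> ?S \<and> y \<in> ?T} \<subseteq> P"
      using mono[of "{b}"] mono[of "B - {b}"] b submodD(3)[OF P(1)] by blast
  qed
  ultimately have "is_dsum G ?S ?T P"
    unfolding is_dsum_def using S T submodD(2)[OF S] submodD(2)[OF T] by blast
  moreover have "fin_gen G ?S" unfolding fin_gen_def using bS by (intro exI[of _ "{b}"]) simp
  ultimately show ?thesis using bS \<open>b \<noteq> 0\<close> unfolding direct_summand_def by blast
qed

text \<open>Finitely many generators live in finitely many coordinates, and so do their
  combinations. This is what cuts a projection of the countable free module down to a finite
  matrix.\<close>

lemma fin_gen_bounded:
  assumes "fin_gen G S" "S \<subseteq> free_mod G"
  obtains N where "\<And>s m. s \<in> S \<Longrightarrow> m \<ge> N \<Longrightarrow> s m = 0"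
proof -
  obtain X where X: "finite X" "X \<subseteq> S" "S = rspan G X" using assms(1) unfolding fin_gen_def by blast
  have "\<exists>N. \<forall>x\<in>X. \<forall>m\<ge>N. x m = 0"
    using X(1,2)
  proof (induction X rule: finite_induct)
    case (insert x X)
    then obtain N where N: "\<forall>x\<in>X. \<forall>m\<ge>N. x m = 0" by blast
    obtain N' where "\<And>m. m \<ge> N' \<Longrightarrow> x m = 0" using insert.prems assms(2) by (elim free_mod_bound[of x, rotated]) auto
    then show ?case using N by (intro exI[of _ "max N N'"]) auto
  qed simp
  then obtain N where N: "\<And>x m. x \<in> X \<Longrightarrow> m \<ge> N \<Longrightarrow> x m = 0" by blast
  have "s m = 0" if s: "s \<in> S" and m: "m \<ge> N" for s m
  proof -
    obtain Y c where Y: "Y \<subseteq> X" "s = (\<Sum>x\<in>Y. rsmult G x (c x))" using s unfolding X(3) by (elim rspanE) blast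
    show ?thesis
      unfolding Y(2)
    proof (subst sum_fun_apply, rule sum.neutral, rule ballI)
      fix x assume "x \<in> Y"
      then have "x m = 0" using Y(1) N m by blast
      then show "rsmult G x (c x) m = 0" unfolding rsmult_def by (simp only: gr_mult_zero_left)
    qed
  qed
  then show ?thesis using that by blast
qed

end

section \<open>A projective module without finitely generated summands\<close>

lemma rsmult_sum_apply: "(\<Sum>j\<in>I. rsmult G (f j) (r j)) i = (\<Sum>j\<in>I. gr_mult G (f j i) (r j))"
  by (rule trans[OF sum_fun_apply]) (simp only: rsmult_def)

lemma is_dsumD:
  assumes "is_dsum G A B C"
  shows "submod G A" "submod G B" "A \<inter> B = {0}" "C = {x + y | x y. x \<in> A \<and> y \<in> B}"
  using assms unfolding is_dsum_def by - (elim conjE, assumption)+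

lemma is_dsum_decompose:
  assumes "is_dsum G A B C" "z \<in> C"
  obtains x y where "x \<in> A" "y \<in> B" "z = x + y"
  using assms(2) unfolding is_dsumD(4)[OF assms(1)] by blast

lemma is_dsum_add_mem: "is_dsum G A B C \<Longrightarrow> x \<in> A \<Longrightarrow> y \<in> B \<Longrightarrow> x + y \<in> C"
  by (subst is_dsumD(4)) blast+

lemma diff_eq_swap:
  fixes w :: "'b :: ab_group_add"
  shows "y - p = z - w \<Longrightarrow> w - p = z - y"
  by (simp add: algebra_simps)

section \<open>The structure map of the direct system on a tree, and a map that undoes it\<close>

context tree_module
begin

text \<open>The coordinates are the nodes of the \<open>n\<close>-ary tree with root \<open>0\<close> in which \<open>p\<close> has the children
  \<open>n p + 1 + i\<close>, \<open>i < n\<close>. The map \<open>child\<close> sends the value \<open>x\<close> at a node to the values \<open>a i x\<close> at its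
  children.\<close>

definition child :: "(nat \<Rightarrow> 'a \<Rightarrow> int) \<Rightarrow> nat \<Rightarrow> 'a \<Rightarrow> int" where
  "child x m = (if m = 0 then 0 else gr_mult G (a ((m - 1) mod n)) (x ((m - 1) div n)))"

text \<open>If m is child i of the node p, the argument of y is child k of child j of p. So the
  value at m is recombined from the values at all grandchildren of p, with the coefficients that
  express \<open>a i\<close> through the products of \<open>a k\<close> and
  \<open>a j\<close>.\<close>

definition parent :: "(nat \<Rightarrow> 'a \<Rightarrow> int) \<Rightarrow> nat \<Rightarrow> 'a \<Rightarrow> int" where
  "parent y m = (if m = 0 then 0 else \<Sum>j<n. \<Sum>k<n.
     gr_mult G (c ((m - 1) mod n) j k) (y (n * (n * ((m - 1) div n) + 1 + j) + 1 + k)))"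

lemma child_zero: "child x 0 = 0" and child_Suc: "child x (Suc q) = gr_mult G (a (q mod n)) (x (q div n))"
  by (simp_all add: child_def)

lemma parent_zero: "parent y 0 = 0"
  and parent_Suc: "parent y (Suc q) = (\<Sum>j<n. \<Sum>k<n.
     gr_mult G (c (q mod n) j k) (y (Suc (n * Suc (n * (q div n) + j) + k))))"
  by (simp_all add: parent_def)

lemma gr_mult_sum_sum_left:
  assumes "\<And>i j. i \<in> I \<Longrightarrow> j \<in> J \<Longrightarrow> f i j \<in> group_ring G"
  shows "gr_mult G (\<Sum>i\<in>I. \<Sum>j\<in>J. f i j) r = (\<Sum>i\<in>I. \<Sum>j\<in>J. gr_mult G (f i j) r)"
proof -
  have "gr_mult G (\<Sum>i\<in>I. \<Sum>j\<in>J. f i j) r = (\<Sum>i\<in>I. gr_mult G (\<Sum>j\<in>J. f i j) r)"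
    by (intro gr_mult_sum_left gr_sum assms)
  also have "\<dots> = (\<Sum>i\<in>I. \<Sum>j\<in>J. gr_mult G (f i j) r)"
    by (intro sum.cong refl gr_mult_sum_left assms)
  finally show ?thesis .
qed

lemma mod_n: "q mod n < n"
  using n_pos by simp

lemma child_index:
  assumes "k < n"
  shows "child x (Suc (n * p + k)) = gr_mult G (a k) (x p)"
  using assms by (simp add: child_Suc)

text \<open>At child i of p the left side is the sum of the c_ijk a_k a_j x_p, which
  \<open>a_rel\<close> collapses to a_i x_p.\<close>

lemma parent_child_child:
  assumes x: "x \<in> free_mod G"
  shows "parent (child (child x)) = child x"
proof
  fix m
  show "parent (child (child x)) m = child x m"
  proof (cases m)
    case (Suc q)
    let ?i = "q mod n" and ?x = "x (q div n)"
    have xg: "?x \<in> group_ring G" using x by (rule free_mod_comp)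
    have "parent (child (child x)) m =
        (\<Sum>j<n. \<Sum>k<n. gr_mult G (c ?i j k) (gr_mult G (a k) (gr_mult G (a j) ?x)))"
      unfolding Suc parent_Suc
    proof (intro sum.cong refl)
      fix j k assume "j \<in> {..<n}" "k \<in> {..<n}"
      then have jk: "j < n" "k < n" by auto
      show "gr_mult G (c ?i j k) (child (child x) (Suc (n * Suc (n * (q div n) + j) + k))) =
          gr_mult G (c ?i j k) (gr_mult G (a k) (gr_mult G (a j) ?x))"
        unfolding child_index[OF jk(2)] child_index[OF jk(1)] ..
    qed
    also have "\<dots> = (\<Sum>j<n. \<Sum>k<n. gr_mult G (gr_mult G (gr_mult G (c ?i j k) (a k)) (a j)) ?x)"
    proof (intro sum.cong refl)
      fix j k assume "j \<in> {..<n}" "k \<in> {..<n}"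
      then have jk: "j < n" "k < n" by auto
      show "gr_mult G (c ?i j k) (gr_mult G (a k) (gr_mult G (a j) ?x)) =
          gr_mult G (gr_mult G (gr_mult G (c ?i j k) (a k)) (a j)) ?x"
        using c_gr[OF mod_n jk] a_gr[OF jk(1)] a_gr[OF jk(2)] xg
        by (simp add: gr_mult_assoc gr_mult_closed)
    qed
    also have "\<dots> = gr_mult G (\<Sum>j<n. \<Sum>k<n. gr_mult G (gr_mult G (c ?i j k) (a k)) (a j)) ?x"
      by (rule gr_mult_sum_sum_left[symmetric]) (auto intro!: gr_mult_closed c_gr mod_n a_gr)
    also have "(\<Sum>j<n. \<Sum>k<n. gr_mult G (gr_mult G (c ?i j k) (a k)) (a j)) =
        (\<Sum>j<n. gr_mult G (\<Sum>k<n. gr_mult G (c ?i j k) (a k)) (a j))"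
      by (intro sum.cong refl gr_mult_sum_left[symmetric]) (auto intro!: gr_mult_closed c_gr mod_n a_gr)
    also have "gr_mult G (\<Sum>j<n. gr_mult G (\<Sum>k<n. gr_mult G (c ?i j k) (a k)) (a j)) ?x = child x m"
      unfolding Suc child_Suc a_rel[OF mod_n, symmetric] ..
    finally show ?thesis .
  qed (simp add: child_zero parent_zero)
qed

lemma child_closed:
  assumes "x \<in> free_mod G"
  shows "child x \<in> free_mod G"
proof -
  obtain N where N: "\<And>m. m \<ge> N \<Longrightarrow> x m = 0" using free_mod_bound[OF assms] by blast
  show ?thesis
  proof (rule free_modI)
    show "child x m \<in> group_ring G" for m
      using a_gr[OF mod_n] free_mod_comp[OF assms] gr_zero by (simp add: child_def gr_mult_closed)
    fix m assume m: "m \<ge> Suc (n * N)"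
    then obtain q where q: "m = Suc q" "q \<ge> n * N" by (cases m) auto
    have "q div n \<ge> N" using div_le_mono[OF q(2), of n] n_pos by simp
    from N[OF this] show "child x m = 0" unfolding q(1) child_Suc by (simp only: gr_mult_zero_right)
  qed
qed

text \<open>\<open>parent\<close> reads only nodes of larger index than the one it writes, so it
  shortens the support of a vector. It is therefore locally nilpotent, and 1 - \<open>parent\<close>
  is invertible.\<close>

lemma index_gt: "Suc (n * Suc (n * (q div n) + j) + k) > Suc q"
proof -
  have "q < n * (q div n) + n" using mod_n[of q] mult_div_mod_eq[of n q] by linarith
  also have "\<dots> \<le> n * (n * (q div n)) + n" using n_pos by simp
  also have "\<dots> \<le> n * Suc (n * (q div n) + j) + k" by (simp add: algebra_simps)
  finally show ?thesis by simp
qed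

lemma parent_bound:
  assumes "\<And>m. m \<ge> Suc N \<Longrightarrow> y m = 0" "m \<ge> N"
  shows "parent y m = 0"
proof (cases m)
  case (Suc q)
  have "y (Suc (n * Suc (n * (q div n) + j) + k)) = 0" for j k
    using assms(1)[of "Suc (n * Suc (n * (q div n) + j) + k)"] index_gt[of q j k] assms(2) Suc by linarith
  then show ?thesis unfolding Suc parent_Suc by (simp only: gr_mult_zero_right sum.neutral_const)
qed (simp add: parent_zero)

lemma parent_closed:
  assumes "y \<in> free_mod G"
  shows "parent y \<in> free_mod G"
proof -
  obtain N where N: "\<And>m. m \<ge> N \<Longrightarrow> y m = 0" using free_mod_bound[OF assms] by blast
  show ?thesis
  proof (rule free_modI)
    show "parent y m = 0" if "m \<ge> N" for m
      by (rule parent_bound[OF _ that]) (simp add: N)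
    show "parent y m \<in> group_ring G" for m
      unfolding parent_def using c_gr[OF mod_n] free_mod_comp[OF assms] gr_zero
      by (auto intro!: gr_sum gr_mult_closed)
  qed
qed

lemma child_add: "child (x + y) = child x + child y"
  by (rule ext) (simp add: child_def gr_mult_add_right)

lemma child_diff: "child (x - y) = child x - child y"
  by (rule ext) (simp add: child_def gr_mult_diff_right)

lemma child_uminus: "child (- x) = - child x"
  by (rule ext) (simp add: child_def gr_mult_uminus_right)

lemma parent_add: "parent (x + y) = parent x + parent y"
  by (rule ext) (simp add: parent_def gr_mult_add_right sum.distrib)

lemma parent_uminus: "parent (- x) = - parent x"
  by (rule ext) (simp add: parent_def gr_mult_uminus_right sum_negf)

lemma parent_diff: "parent (x - y) = parent x - parent y"
  unfolding diff_conv_add_uminus parent_add parent_uminus ..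

lemma child_rsmult:
  assumes "x \<in> free_mod G" "r \<in> group_ring G"
  shows "child (rsmult G x r) = rsmult G (child x) r"
  by (rule ext) (use assms a_gr[OF mod_n] in \<open>simp add: child_def rsmult_def gr_mult_assoc free_mod_comp\<close>)

lemma parent_rsmult:
  assumes "x \<in> free_mod G" "r \<in> group_ring G"
  shows "parent (rsmult G x r) = rsmult G (parent x) r"
proof
  fix m
  show "parent (rsmult G x r) m = rsmult G (parent x) r m"
  proof (cases m)
    case (Suc q)
    have "rsmult G (parent x) r m = (\<Sum>j<n. \<Sum>k<n. gr_mult G
        (gr_mult G (c (q mod n) j k) (x (Suc (n * Suc (n * (q div n) + j) + k)))) r)"
      unfolding Suc parent_Suc rsmult_def
      by (rule gr_mult_sum_sum_left) (simp add: gr_mult_closed c_gr mod_n free_mod_comp[OF assms(1)])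
    also have "\<dots> = parent (rsmult G x r) m"
      unfolding Suc parent_Suc rsmult_def
      by (intro sum.cong refl gr_mult_assoc) (simp_all add: c_gr mod_n free_mod_comp[OF assms(1)] assms(2))
    finally show ?thesis ..
  qed (simp add: parent_zero rsmult_def)
qed

lemma one_minus_parent_inj:
  assumes "y \<in> free_mod G" "y = parent y"
  shows "y = 0"
proof -
  have "(\<And>m. m \<ge> N \<Longrightarrow> y m = 0) \<Longrightarrow> y = 0" for N
  proof (induction N)
    case 0
    show ?case by (rule ext) (simp only: 0 zero_fun_apply le0)
  next
    case (Suc N)
    have "parent y m = 0" if "m \<ge> N" for m
      by (rule parent_bound[OF _ that]) (rule Suc.prems)
    then have "y m = 0" if "m \<ge> N" for m
      using that fun_cong[OF assms(2), of m] by metis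
    then show ?case by (rule Suc.IH)
  qed
  then show ?thesis using free_mod_bound[OF assms(1)] by blast
qed

text \<open>The geometric series z + \<open>parent z\<close> + ... is finite. The induction solves
  the equation for \<open>parent z\<close>, whose support is shorter, and adds z.\<close>

lemma one_minus_parent_surj:
  assumes "z \<in> free_mod G"
  shows "\<exists>y\<in>free_mod G. y - parent y = z"
proof -
  have "z \<in> free_mod G \<Longrightarrow> (\<And>m. m \<ge> N \<Longrightarrow> z m = 0) \<Longrightarrow> \<exists>y\<in>free_mod G. y - parent y = z" for N
  proof (induction N arbitrary: z)
    case 0
    have "z = 0" by (rule ext, subst zero_fun_apply, rule 0(2), rule le0)
    moreover have "parent 0 = 0" using parent_diff[of 0 0] by simp
    ultimately have "0 - parent 0 = z" by (simp only: diff_self)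
    then show ?case using fm_zero by blast
  next
    case (Suc N)
    have "parent z m = 0" if "m \<ge> N" for m by (rule parent_bound[OF _ that]) (rule Suc.prems(2))
    from Suc.IH[OF parent_closed[OF Suc.prems(1)] this]
    obtain y where y: "y \<in> free_mod G" "y - parent y = parent z" by blast
    have "z + y - parent (z + y) = z + (y - parent y) - parent z" unfolding parent_add by (simp only: algebra_simps)
    also have "\<dots> = z" unfolding y(2) by (simp only: add_diff_cancel)
    finally show ?case using fm_add[OF Suc.prems(1) y(1)] by blast
  qed
  then show ?thesis using free_mod_bound[OF assms] assms by blast
qed

section \<open>The direct limit as a direct summand of the free module\<close>

definition P :: "(nat \<Rightarrow> 'a \<Rightarrow> int) set" where
  "P = {x \<in> free_mod G. parent (x + child x) = x}"

text \<open>The quotient of the free module by Q identifies each x with \<open>child x\<close>,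
  which is the direct limit over the levels of the tree. A complement of Q is a copy of that
  limit.\<close>

definition Q :: "(nat \<Rightarrow> 'a \<Rightarrow> int) set" where
  "Q = {x - child x | x. x \<in> free_mod G}"

lemma submod_P: "submod G P"
proof -
  have "parent (x + y + child (x + y)) = parent (x + child x) + parent (y + child y)" for x y
    unfolding child_add parent_add by (simp only: ac_simps)
  moreover have "parent (- x + child (- x)) = - parent (x + child x)" for x
    unfolding child_uminus parent_add parent_uminus by (simp only: minus_add_distrib)
  moreover have "parent (rsmult G x r + child (rsmult G x r)) = rsmult G (parent (x + child x)) r"
    if "x \<in> free_mod G" "r \<in> group_ring G" for x r
    using that by (simp only: child_rsmult rsmult_add[symmetric] child_closed parent_rsmult fm_add)
  moreover have "parent (0 + child 0) = 0"
    using child_diff[of 0 0] parent_diff[of 0 0] by simp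
  ultimately show ?thesis
    unfolding submod_def P_def
    using fm_zero fm_add fm_uminus fm_rsmult by simp
qed

lemma submod_Q: "submod G Q"
  unfolding submod_def
proof (intro conjI ballI)
  show "Q \<subseteq> free_mod G" unfolding Q_def using fm_diff child_closed by blast
  have "child 0 = 0" using child_diff[of 0 0] by (simp only: diff_self)
  then have "0 = 0 - child 0" by (simp only: diff_self)
  then show "0 \<in> Q" unfolding Q_def using fm_zero by blast
next
  fix x y assume "x \<in> Q" "y \<in> Q"
  then obtain u v where uv: "u \<in> free_mod G" "v \<in> free_mod G" "x = u - child u" "y = v - child v"
    unfolding Q_def by blast
  have "x + y = (u + v) - child (u + v)" unfolding uv child_add by (simp only: algebra_simps)
  then show "x + y \<in> Q" unfolding Q_def using fm_add[OF uv(1,2)] by blast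
next
  fix x assume "x \<in> Q"
  then obtain u where u: "u \<in> free_mod G" "x = u - child u" unfolding Q_def by blast
  have "- x = - u - child (- u)" unfolding u(2) child_uminus by (rule minus_diff_minus[symmetric])
  then show "- x \<in> Q" unfolding Q_def using fm_uminus[OF u(1)] by blast
  fix r assume r: "r \<in> group_ring G"
  have "rsmult G x r = rsmult G u r - child (rsmult G u r)"
    unfolding u(2) child_rsmult[OF u(1) r] by (rule rsmult_diff[OF u(1) child_closed[OF u(1)]])
  then show "rsmult G x r \<in> Q" unfolding Q_def using fm_rsmult[OF u(1) r] by blast
qed

text \<open>From \<open>parent \<circ> child \<circ> child = child\<close> one gets
  \<open>(1 - parent - parent child) (1 - child) = 1 - parent\<close>, which is bijective. So the kernel of the
  first factor is a complement of the range of the second.\<close>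

lemma is_dsum_P_Q: "is_dsum G P Q (free_mod G)"
proof -
  have key: "parent ((y - child y) + child (y - child y)) = parent y - child y" if "y \<in> free_mod G" for y
  proof -
    have "(y - child y) + child (y - child y) = y - child (child y)"
      unfolding child_diff by (simp only: algebra_simps diff_add_cancel)
    then show ?thesis by (simp only: parent_diff parent_child_child[OF that])
  qed
  have "x = 0" if x: "x \<in> P" "x \<in> Q" for x
  proof -
    obtain y where y: "y \<in> free_mod G" "x = y - child y" using x(2) unfolding Q_def by blast
    have "parent y - child y = y - child y" using x(1) key[OF y(1)] unfolding P_def y(2) by simp
    then have "y = parent y" by simp
    then have y0: "y = 0" using one_minus_parent_inj[OF y(1)] by blast
    show ?thesis unfolding y(2) y0 using child_diff[of 0 0] by simp
  qed
  then have "P \<inter> Q = {0}" using submodD(2)[OF submod_P] submodD(2)[OF submod_Q] by blast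
  moreover have "free_mod G = {x + y | x y. x \<in> P \<and> y \<in> Q}"
  proof
    show "{x + y | x y. x \<in> P \<and> y \<in> Q} \<subseteq> free_mod G"
      using submodD(1)[OF submod_P] submodD(1)[OF submod_Q] fm_add by blast
    show "free_mod G \<subseteq> {x + y | x y. x \<in> P \<and> y \<in> Q}"
    proof
      fix z assume z: "z \<in> free_mod G"
      \<comment> \<open>The vector y is chosen so that 1 - \<open>parent\<close> -
        \<open>parent\<close> \<open>child\<close> takes the same value at z and at y -
        \<open>child y\<close>. The difference of these two is the component in P.\<close>
      have "z - parent (z + child z) \<in> free_mod G"
        using z by (intro fm_diff parent_closed fm_add child_closed)
      then obtain y where y: "y \<in> free_mod G" "y - parent y = z - parent (z + child z)"
        using one_minus_parent_surj by blast
      define x where "x = z - (y - child y)"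
      have "parent (x + child x) = parent (z + child z) - parent ((y - child y) + child (y - child y))"
        unfolding x_def child_diff parent_add parent_diff by (simp only: algebra_simps)
      also have "\<dots> = parent (z + child z) - parent y + child y"
        unfolding key[OF y(1)] by (simp only: algebra_simps)
      also have "parent (z + child z) - parent y = z - y"
        using diff_eq_swap[OF y(2)] .
      also have "z - y + child y = x" unfolding x_def by (simp only: algebra_simps)
      finally have "x \<in> P" unfolding P_def using z y(1) by (auto simp only: x_def intro!: fm_diff child_closed)
      moreover have "y - child y \<in> Q" unfolding Q_def using y(1) by blast
      moreover have "z = x + (y - child y)" unfolding x_def by (simp only: diff_add_cancel)
      ultimately show "z \<in> {x + y | x y. x \<in> P \<and> y \<in> Q}" by blast
    qed
  qed
  ultimately show ?thesis unfolding is_dsum_def using submod_P submod_Q by blast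
qed

definition basis :: "nat \<Rightarrow> nat \<Rightarrow> 'a \<Rightarrow> int" where
  "basis j m = (if m = j then gr_elem \<one> else 0)"

lemma basis_closed: "basis j \<in> free_mod G"
  by (rule free_modI[of _ "Suc j"]) (auto simp: basis_def gr_one_closed gr_zero)

lemma basis_expansion:
  assumes "x \<in> free_mod G" "\<And>m. m \<ge> N \<Longrightarrow> x m = 0"
  shows "x = (\<Sum>j<N. rsmult G (basis j) (x j))"
proof
  fix m
  have "(\<Sum>j<N. rsmult G (basis j) (x j)) m = (\<Sum>j<N. gr_mult G (basis j m) (x j))"
    by (subst sum_fun_apply) (simp add: rsmult_def)
  also have "\<dots> = (\<Sum>j<N. if j = m then x j else 0)"
    by (rule sum.cong) (auto simp: basis_def gr_mult_one_left free_mod_comp[OF assms(1)])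
  also have "\<dots> = (if m < N then x m else 0)" by (simp add: sum.delta)
  also have "\<dots> = x m"
  proof (cases "m < N")
    case False
    then have "x m = 0" by (intro assms(2)) simp
    then show ?thesis using False by (simp only: if_False)
  qed (simp only: if_True)
  finally show "x m = (\<Sum>j<N. rsmult G (basis j) (x j)) m" ..
qed

text \<open>Otherwise the root vector would be x - \<open>child x\<close>, and the value of x at
  each node would be the product of the generators along the path from the root. Such an x cannot
  have finite support, since nonzero values recur at ever larger nodes.\<close>

lemma P_nonzero: "P \<noteq> {0}"
proof
  assume P0: "P = {0}"
  obtain u v where "u \<in> P" "v \<in> Q" "basis 0 = u + v"
    using is_dsum_decompose[OF is_dsum_P_Q basis_closed] .
  then have "basis 0 \<in> Q" unfolding P0 by simp
  then obtain x where x: "x \<in> free_mod G" "basis 0 = x - child x" unfolding Q_def by blast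
  have x_child: "x = basis 0 + child x" unfolding x(2) by (simp only: diff_add_cancel)
  have x_0: "x 0 = gr_elem \<one>"
    using fun_cong[OF x_child, of 0] by (simp add: basis_def child_zero)
  have x_Suc: "x (Suc (n * p + j)) = gr_mult G (a j) (x p)" if "j < n" for p j
    using fun_cong[OF x_child, of "Suc (n * p + j)"] child_index[OF that, of x p] by (simp add: basis_def)
  define good where "good p \<longleftrightarrow> (\<exists>i<n. gr_mult G (a i) (x p) \<noteq> 0)" for p
  have "good 0"
    unfolding good_def x_0 using a_nonzero a_gr gr_mult_one_right by metis
  \<comment> \<open>If no child of p were good, all a_k a_j x_p would vanish, and the relations
    would give a_i x_p = 0 for every i.\<close>
  have step: "\<exists>p'>p. good p'" if p: "good p" for p
  proof (rule ccontr)
    assume contra: "\<not> (\<exists>p'>p. good p')"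
    obtain i where i: "i < n" "gr_mult G (a i) (x p) \<noteq> 0" using p unfolding good_def by blast
    have zero: "gr_mult G (a k) (gr_mult G (a j) (x p)) = 0" if jk: "j < n" "k < n" for j k
    proof -
      have "p \<le> n * p" using n_pos by simp
      then have "Suc (n * p + j) > p" by linarith
      then show ?thesis
        using contra jk x_Suc[OF jk(1), of p] unfolding good_def by metis
    qed
    have "gr_mult G (a i) (x p) = parent (child (child x)) (Suc (n * p + i))"
      unfolding parent_child_child[OF x(1)] child_index[OF i(1)] ..
    also have "\<dots> = (\<Sum>j<n. \<Sum>k<n. gr_mult G (c i j k) (child (child x) (Suc (n * Suc (n * p + j) + k))))"
      unfolding parent_Suc using i(1) by simp
    also have "\<dots> = 0"
    proof (intro sum.neutral ballI)
      fix j k assume "j \<in> {..<n}" "k \<in> {..<n}"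
      then have jk: "j < n" "k < n" by auto
      show "gr_mult G (c i j k) (child (child x) (Suc (n * Suc (n * p + j) + k))) = 0"
        unfolding child_index[OF jk(2)] child_index[OF jk(1)] zero[OF jk] gr_mult_zero_right ..
    qed
    finally show False using i(2) by blast
  qed
  have "\<exists>p\<ge>N. good p" for N
  proof (induction N)
    case (Suc N)
    then show ?case using step by (meson Suc_leI le_less_trans)
  qed (use \<open>good 0\<close> in blast)
  moreover obtain M where M: "\<And>m. m \<ge> M \<Longrightarrow> x m = 0" using free_mod_bound[OF x(1)] by blast
  ultimately obtain p where p: "p \<ge> M" "good p" by blast
  then show False unfolding good_def M[OF p(1)] gr_mult_zero_right by blast
qed

section \<open>Finitely generated summands of the limit\<close>

lemma is_dsum_extend:
  assumes "is_dsum G S S' P"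
  shows "\<exists>U. is_dsum G S U (free_mod G) \<and> Q \<subseteq> U"
proof -
  note S = is_dsumD(1)[OF assms] and S' = is_dsumD(2)[OF assms] and int = is_dsumD(3)[OF assms]
  note PQ = is_dsumD(3)[OF is_dsum_P_Q]
  have SP: "S \<subseteq> P" "S' \<subseteq> P"
  proof -
    have "s + 0 \<in> P" if "s \<in> S" for s by (rule is_dsum_add_mem[OF assms that submodD(2)[OF S']])
    moreover have "0 + s \<in> P" if "s \<in> S'" for s by (rule is_dsum_add_mem[OF assms submodD(2)[OF S] that])
    ultimately show "S \<subseteq> P" "S' \<subseteq> P" by auto
  qed
  \<comment> \<open>The complement contains Q by construction, so that the projection to S cannot
    distinguish x from \<open>child x\<close>.\<close>
  define U where "U = {s + q | s q. s \<in> S' \<and> q \<in> Q}"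
  have UI: "s + q \<in> U" if "s \<in> S'" "q \<in> Q" for s q using that unfolding U_def by blast
  have "submod G U"
    unfolding submod_def
  proof (intro conjI ballI)
    show "U \<subseteq> free_mod G"
      unfolding U_def using submodD(1)[OF S'] submodD(1)[OF submod_Q] fm_add by blast
    show "0 \<in> U" using UI[OF submodD(2)[OF S'] submodD(2)[OF submod_Q]] by simp
  next
    fix x y assume "x \<in> U" "y \<in> U"
    then obtain s q s' q' where u: "s \<in> S'" "q \<in> Q" "s' \<in> S'" "q' \<in> Q" "x = s + q" "y = s' + q'"
      unfolding U_def by blast
    have "x + y = (s + s') + (q + q')" unfolding u by (simp only: ac_simps)
    then show "x + y \<in> U"
      using UI[OF submodD(3)[OF S' u(1,3)] submodD(3)[OF submod_Q u(2,4)]] by simp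
  next
    fix x assume "x \<in> U"
    then obtain s q where u: "s \<in> S'" "q \<in> Q" "x = s + q" unfolding U_def by blast
    have "- x = - s + - q" unfolding u by (simp only: minus_add_distrib)
    then show "- x \<in> U" using UI[OF submodD(4)[OF S' u(1)] submodD(4)[OF submod_Q u(2)]] by simp
    fix r assume r: "r \<in> group_ring G"
    have "rsmult G x r = rsmult G s r + rsmult G q r"
      unfolding u(3) using submodD(1)[OF S'] submodD(1)[OF submod_Q] u(1,2) by (intro rsmult_add) auto
    then show "rsmult G x r \<in> U"
      using UI[OF submodD(5)[OF S' u(1) r] submodD(5)[OF submod_Q u(2) r]] by simp
  qed
  have sub_U: "S \<inter> U \<subseteq> {0}"
  proof
    fix x assume x: "x \<in> S \<inter> U"
    then obtain s q where u: "s \<in> S'" "q \<in> Q" "x = s + q" unfolding U_def by blast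
    have "x - s \<in> P" using submod_diff[OF submod_P] x SP u(1) by blast
    moreover have "x - s = q" unfolding u(3) by simp
    ultimately have "q = 0" using u(2) PQ by blast
    then have "x = s" using u(3) by simp
    then show "x \<in> {0}" using x u(1) int by blast
  qed
  have sum_U: "free_mod G = {s + u | s u. s \<in> S \<and> u \<in> U}"
  proof
    show "{s + u | s u. s \<in> S \<and> u \<in> U} \<subseteq> free_mod G"
      using submodD(1)[OF S] submodD(1)[OF \<open>submod G U\<close>] fm_add by blast
    show "free_mod G \<subseteq> {s + u | s u. s \<in> S \<and> u \<in> U}"
    proof
      fix z assume "z \<in> free_mod G"
      then obtain x q where z: "x \<in> P" "q \<in> Q" "z = x + q" by (rule is_dsum_decompose[OF is_dsum_P_Q])
      from z(1) obtain s s' where x: "s \<in> S" "s' \<in> S'" "x = s + s'" by (rule is_dsum_decompose[OF assms])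
      have "z = s + (s' + q)" unfolding z x by (rule add.assoc)
      then show "z \<in> {s + u | s u. s \<in> S \<and> u \<in> U}" using x(1) UI[OF x(2) z(2)] by blast
    qed
  qed
  have "{0} \<subseteq> S \<inter> U" using submodD(2)[OF S] submodD(2)[OF \<open>submod G U\<close>] by blast
  with sub_U have int_U: "S \<inter> U = {0}" by (rule subset_antisym)
  have "is_dsum G S U (free_mod G)"
    unfolding is_dsum_def by (intro conjI S \<open>submod G U\<close> int_U sum_U)
  moreover have "Q \<subseteq> U"
  proof
    fix q assume "q \<in> Q"
    then show "q \<in> U" using UI[OF submodD(2)[OF S']] by fastforce
  qed
  ultimately show ?thesis by blast
qed

text \<open>The projection onto a summand \<open>S\<close> of \<open>P\<close> kills \<open>x - child x\<close>, hence factors through \<open>child\<close>, whose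
  matrix has augmentation zero. If \<open>S\<close> is finitely generated, it is the image of a finite idempotent
  matrix of augmentation zero.\<close>

proposition fg_summand_trivial:
  assumes rootless: "\<And>g. g \<in> carrier G \<Longrightarrow> g \<noteq> \<one> \<Longrightarrow>
      \<exists>p m. prime (p::nat) \<and> (\<forall>x\<in>carrier G. x [^] (p ^ m) \<noteq> g)"
    and "direct_summand G S P" "fin_gen G S"
  shows "S = {0}"
proof -
  obtain S' where "is_dsum G S S' P" using assms(2) unfolding direct_summand_def by blast
  from is_dsum_extend[OF this] obtain U where U: "is_dsum G S U (free_mod G)" "Q \<subseteq> U" by blast
  note S = is_dsumD(1)[OF U(1)] and Um = is_dsumD(2)[OF U(1)] and int = is_dsumD(3)[OF U(1)]
  have SF: "S \<subseteq> free_mod G" using submodD(1)[OF S] .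
  obtain N where N: "\<And>s m. s \<in> S \<Longrightarrow> m \<ge> N \<Longrightarrow> s m = 0"
    using fin_gen_bounded[OF assms(3) SF] by blast
  define \<pi> where "\<pi> x = (SOME s. s \<in> S \<and> x - s \<in> U)" for x
  have \<pi>: "\<pi> x \<in> S \<and> x - \<pi> x \<in> U" if "x \<in> free_mod G" for x
  proof -
    from that obtain s u where su: "s \<in> S" "u \<in> U" "x = s + u" by (rule is_dsum_decompose[OF U(1)])
    have "x - s = u" unfolding su(3) by simp
    then have "\<exists>s. s \<in> S \<and> x - s \<in> U" using su by blast
    from someI_ex[OF this] show ?thesis unfolding \<pi>_def .
  qed
  have \<pi>_unique: "\<pi> x = s" if x: "x \<in> free_mod G" and s: "s \<in> S" "x - s \<in> U" for x s
  proof -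
    have "(x - \<pi> x) - (x - s) \<in> U" using \<pi>[OF x] s(2) submod_diff[OF Um] by blast
    moreover have "(x - \<pi> x) - (x - s) = s - \<pi> x" by simp
    ultimately have "s - \<pi> x \<in> U" by (simp only:)
    moreover have "s - \<pi> x \<in> S" using submod_diff[OF S s(1)] \<pi>[OF x] by blast
    ultimately have "s - \<pi> x = 0" using int by blast
    then show ?thesis by simp
  qed
  have \<pi>_S: "\<pi> s = s" if "s \<in> S" for s
    using \<pi>_unique[of s s] that SF submodD(2)[OF Um] by auto
  have \<pi>_child: "\<pi> (child x) = \<pi> x" if x: "x \<in> free_mod G" for x
  proof (rule \<pi>_unique[OF child_closed[OF x]])
    show "\<pi> x \<in> S" using \<pi>[OF x] by blast
    have "x - child x \<in> U" using x U(2) unfolding Q_def by blast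
    then have "(x - \<pi> x) - (x - child x) \<in> U" using \<pi>[OF x] submod_diff[OF Um] by blast
    moreover have "(x - \<pi> x) - (x - child x) = child x - \<pi> x" by simp
    ultimately show "child x - \<pi> x \<in> U" by (simp only:)
  qed
  \<comment> \<open>Linearity of the projection is used only in this form, and uniqueness gives it:
    the combination of the \<open>\<pi> (basis j)\<close> lies in S and differs from x by an element
    of U.\<close>
  have \<pi>_expand: "\<pi> x = (\<Sum>j<M. rsmult G (\<pi> (basis j)) (x j))"
    if x: "x \<in> free_mod G" and M: "\<And>m. m \<ge> M \<Longrightarrow> x m = 0" for x M
  proof (rule \<pi>_unique[OF x])
    show "(\<Sum>j<M. rsmult G (\<pi> (basis j)) (x j)) \<in> S"
      using \<pi>[OF basis_closed] free_mod_comp[OF x] by (intro submod_sum[OF S] submodD(5)[OF S]) auto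
    have "x - (\<Sum>j<M. rsmult G (\<pi> (basis j)) (x j)) =
        (\<Sum>j<M. rsmult G (basis j) (x j)) - (\<Sum>j<M. rsmult G (\<pi> (basis j)) (x j))"
      using basis_expansion[OF x M] by (rule arg_cong)
    also have "\<dots> = (\<Sum>j<M. rsmult G (basis j - \<pi> (basis j)) (x j))"
      unfolding sum_subtractf[symmetric]
      using \<pi>[OF basis_closed] SF by (intro sum.cong refl rsmult_diff[symmetric] basis_closed) auto
    also have "\<dots> \<in> U"
      using \<pi>[OF basis_closed] free_mod_comp[OF x] by (intro submod_sum[OF Um] submodD(5)[OF Um]) auto
    finally show "x - (\<Sum>j<M. rsmult G (\<pi> (basis j)) (x j)) \<in> U" .
  qed
  have \<pi>_gr: "\<pi> x i \<in> group_ring G" if "x \<in> free_mod G" for x i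
    using \<pi>[OF that] SF free_mod_comp by blast
  \<comment> \<open>The vector x may be replaced by \<open>child x\<close>, whose coordinates have
    augmentation 0; multiplicativity of \<open>aug\<close> then kills every term of the
    expansion.\<close>
  have aug_\<pi>: "aug (\<pi> x i) = 0" if x: "x \<in> free_mod G" for x i
  proof -
    have cx: "child x \<in> free_mod G" by (rule child_closed[OF x])
    obtain M where M: "\<And>m. m \<ge> M \<Longrightarrow> child x m = 0" using free_mod_bound[OF cx] by blast
    have aug_child: "aug (child x m) = 0" for m
      using a_gr[OF mod_n] a_aug[OF mod_n] free_mod_comp[OF x] by (simp add: child_def aug_mult)
    have "\<pi> (child x) i = (\<Sum>j<M. rsmult G (\<pi> (basis j)) (child x j)) i"
      using cx M by (intro fun_cong[OF \<pi>_expand])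
    then have eq: "\<pi> x i = (\<Sum>j<M. gr_mult G (\<pi> (basis j) i) (child x j))"
      unfolding \<pi>_child[OF x] rsmult_sum_apply .
    have "aug (\<pi> x i) = (\<Sum>j<M. aug (gr_mult G (\<pi> (basis j) i) (child x j)))"
      unfolding eq using \<pi>_gr[OF basis_closed] free_mod_comp[OF cx] by (intro aug_sum gr_mult_closed) auto
    also have "\<dots> = 0"
      using \<pi>_gr[OF basis_closed] free_mod_comp[OF cx] aug_child by (simp add: aug_mult)
    finally show ?thesis .
  qed
  interpret matrix_groupoid G N ..
  \<comment> \<open>The columns of E are the images of the basis vectors. Rows from N on vanish
    because S lives in the first N coordinates, so the finite block determines S.\<close>
  define E where "E i j = \<pi> (basis j) i" for i j
  have S_expand: "s = (\<Sum>j<N. rsmult G (\<pi> (basis j)) (s j))" if s: "s \<in> S" for s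
  proof -
    have "\<pi> s = (\<Sum>j<N. rsmult G (\<pi> (basis j)) (s j))"
      using s SF N[OF s] by (intro \<pi>_expand) auto
    then show ?thesis unfolding \<pi>_S[OF s] .
  qed
  have E0: "E i j = 0" if ij: "i < N" "j < N" for i j
  proof (rule idempotent_matrix_zero[OF _ _ _ rootless ij])
    show "E i j \<in> group_ring G" for i j unfolding E_def by (rule \<pi>_gr[OF basis_closed])
    show "aug (E i i) = 0" for i unfolding E_def by (rule aug_\<pi>[OF basis_closed])
    \<comment> \<open>The image of a basis vector is fixed by the projection; its own expansion,
      which needs only the first N coordinates, is the idempotence of E.\<close>
    show "E i k = (\<Sum>j<N. gr_mult G (E i j) (E j k))" for i k
    proof -
      have "\<pi> (basis k) \<in> S" using \<pi>[OF basis_closed] by blast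
      from fun_cong[OF S_expand[OF this], of i]
      show ?thesis
        unfolding E_def rsmult_sum_apply .
    qed
  qed
  have "\<pi> (basis j) = 0" if j: "j < N" for j
  proof
    fix i
    have "\<pi> (basis j) i = 0"
    proof (cases "i < N")
      case True
      then show ?thesis using E0[OF True j] by (simp only: E_def)
    next
      case False
      then show ?thesis using N[of "\<pi> (basis j)" i] \<pi>[OF basis_closed] by (meson not_less)
    qed
    then show "\<pi> (basis j) i = 0 i" by (subst zero_fun_apply)
  qed
  then have "s = 0" if "s \<in> S" for s
    using S_expand[OF that] by (simp add: rsmult_zero_left)
  then show ?thesis using submodD(2)[OF S] by blast
qed

end

theorem mainTheorem9:
  fixes G :: "('g, 'b) monoid_scheme"
  assumes "group G"
    and "polycyclic_by_finite G"
    and "\<not> polycyclic G"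
  shows "\<exists>P. projective_submod G P \<and> P \<noteq> {0} \<and>
           (\<forall>S. direct_summand G S P \<and> fin_gen G S \<longrightarrow> S = {0}) \<and>
           \<not> free_submod G P"
proof -
  interpret group G by (rule assms(1))
  obtain X where X: "finite X" "X \<subseteq> carrier G" "derived G (generate G X) = generate G X"
    "generate G X \<noteq> {\<one>\<^bsub>G\<^esub>}"
    by (rule not_polycyclic_perfect_subgroup[OF assms(2,3)])
  obtain n a c where "tree_module G n a c"
    using perfect_subgroup_relations[OF X] by blast
  then interpret tree_module G n a c .
  have "series_of G cyclic_or_finite (carrier G)"
    using assms(2) series_ofI[of G _ cyclic_or_finite] unfolding polycyclic_by_finite_def by blast
  note trivial = fg_summand_trivial[OF series_not_prime_power_root[OF this]]
  have "projective_submod G P"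
    unfolding projective_submod_def direct_summand_def using is_dsum_P_Q by blast
  moreover have "\<not> free_submod G P"
    using free_submod_has_fg_summand[OF submod_P _ P_nonzero] trivial by blast
  ultimately show ?thesis using P_nonzero trivial by blast
qed

end
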